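(* Let $f\in\mathcal C$. (i) If the series $\sum_{\ell\in\mathbb Z}c_f(\ell)$ converges, then for every $n\ge1$, $$E_n(f)=\Big(f(1)-\sum_{\ell\in\mathbb Z}c_f(\ell)\Big)+\sum_{\ell\in\mathbb Z_*}c_f(\ell)\Big(\sum_{d\le n,\ d\mid\ell}d\,M\big(\tfrac nd\big)\Big).$$ (ii) If the series $\sum_{\ell\in\mathbb Z_*}|c_f(\ell)|\,d(\ell)$ converges, then $E_n(f)=o(n)$ as $n\to\infty$. If in addition $f(1)=\sum_{\ell\in\mathbb Z}c_f(\ell)$, then $\sum_{n\ge1}|E_n(f)|/n^2<\infty$.
   Context: $\mathcal F_n=\{j/m: 1\le j\le m\le n,\ \gcd(j,m)=1\}$, $\Phi(n)=\#\mathcal F_n$, $F_n(f)=\sum_{\kappa/\lambda\in\mathcal F_n}f(\kappa/\lambda)$, $E_n(f)=F_n(f)-\Phi(n)\int_0^1f(x)dx$. $M(x)=\sum_{\lambda\le x}\mu(\lambda)$ with $\mu$ the Möbius function; $d(\ell)$ is the number of positive divisors of $|\ell|$. $\mathcal C$ is the class of functions $g\colon[0,1]\to\mathbb R$ such that for every rational $x\in(0,1)$, $g(x-0)=g(x+0)$ and $\int_0^\delta\frac{|g(x+u)+g(x-u)-2g(x)|}{u}du<\infty$ for some $\delta>0$. Functions are regarded as $1$-periodic and tacitly Lebesgue integrable on $[0,1]$, with Fourier coefficients $c_g(\ell)=\int_0^1g(x)e^{-2\pi i\ell x}dx$. $\mathbb Z_*=\mathbb Z\setminus\{0\}$; series over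 $\mathbb Z$ are limits of symmetric partial sums; for negative $\ell$, $d\mid\ell$ means $d\mid|\ell|$. *)

theory Defs
  imports "HOL-Analysis.Analysis" "HOL-Computational_Algebra.Squarefree"
    "HOL-Library.Landau_Symbols"
begin

definition moebius :: "nat \<Rightarrow> int" where
  "moebius k = (if k = 0 then 0 else if squarefree k then (-1) ^ card (prime_factors k) else 0)"

definition mertens :: "real \<Rightarrow> int" where
  "mertens x = (\<Sum>k\<in>{1..nat \<lfloor>x\<rfloor>}. moebius k)"

definition ndiv :: "int \<Rightarrow> nat" where
  "ndiv l = card {k::nat. 0 < k \<and> int k dvd l}"

definition farey :: "nat \<Rightarrow> real set" where
  "farey n = {real j / real m | j m. 1 \<le> j \<and> j \<le> m \<and> m \<le> n \<and> coprime j m}"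

definition Phi :: "nat \<Rightarrow> nat" where
  "Phi n = card (farey n)"

definition Fsum :: "nat \<Rightarrow> (real \<Rightarrow> real) \<Rightarrow> real" where
  "Fsum n f = (\<Sum>x\<in>farey n. f x)"

definition Ferr :: "nat \<Rightarrow> (real \<Rightarrow> real) \<Rightarrow> real" where
  "Ferr n f = Fsum n f - real (Phi n) * integral {0..1} f"

definition fcoeff :: "(real \<Rightarrow> real) \<Rightarrow> int \<Rightarrow> complex" where
  "fcoeff g l = integral {0..1} (\<lambda>x. complex_of_real (g x) * cis (- 2 * pi * real_of_int l * x))"

definition symsum :: "(int \<Rightarrow> 'a::comm_monoid_add) \<Rightarrow> nat \<Rightarrow> 'a" where
  "symsum a N = (\<Sum>l\<in>{- int N..int N}. a l)"

definition symsum_nz :: "(int \<Rightarrow> 'a::comm_monoid_add) \<Rightarrow> nat \<Rightarrow> 'a" where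
  "symsum_nz a N = (\<Sum>l\<in>{- int N..int N} - {0}. a l)"

definition classC :: "(real \<Rightarrow> real) \<Rightarrow> bool" where
  "classC g \<longleftrightarrow> (\<forall>x\<in>\<rat>. 0 < x \<and> x < 1 \<longrightarrow>
      (\<exists>L. (g \<longlongrightarrow> L) (at_left x) \<and> (g \<longlongrightarrow> L) (at_right x)) \<and>
      (\<exists>\<delta>>0. (\<lambda>u. \<bar>g (x + u) + g (x - u) - 2 * g x\<bar> / u) integrable_on {0..\<delta>}))"

end

theory Submission
  imports Defs "HOL-Probability.Probability" "HOL-Real_Asymp.Real_Asymp"
begin

text \<open>
  Part (i): at every rational point of \<open>(0,1)\<close> the Dini condition makes the symmetric Fourier sums of \<open>f\<close>
  converge to the value of \<open>f\<close>. Summing over the Farey fractions turns the exponentials into Ramanujan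
  sums, which add up to \<open>\<Sum>d M(n/d)\<close> over the divisors \<open>d \<le> n\<close> of \<open>l\<close>; the fraction 1 contributes the
  correction \<open>f(1) - \<Sum>c(l)\<close>.

  Part (ii) rests on the convergence of \<open>\<Sum>|M(k)|/k\<^sup>2\<close>, which has the strength of the prime number theorem
  with an error term. It also implies \<open>M(n) = o(n)\<close>, because \<open>M\<close> changes by at most 1 at each step. To prove
  it, consider \<open>u M(e^u) e^(-\<sigma>u)\<close> for \<open>\<sigma> > 1\<close>. Its Fourier transform is \<open>-(1/(s \<zeta>(s)))'\<close> at
  \<open>s = \<sigma> + it\<close>. Euler-Maclaurin summation bounds \<open>\<zeta>\<close> and \<open>\<zeta>'\<close> from above and the 3-4-1 inequality
  bounds \<open>\<zeta>\<close> from below, all in the half-plane \<open>Re s > 1\<close>, so that this transform is bounded by a multiple of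
  \<open>(|t|+2)^(-3/4)\<close> uniformly in \<open>\<sigma>\<close>. By Plancherel's inequality \<open>\<Sum>(ln k)\<^sup>2 M(k)\<^sup>2/k\<^sup>3\<close> converges, and
  the claim follows by comparison with \<open>\<Sum>1/(k (ln k)\<^sup>2)\<close>.
\<close>

section \<open>Ramanujan sums over Farey fractions\<close>

text \<open>The exponents are chosen backwards from the Plancherel step. With
  \<open>L = (|t| + 2) powr (1/36)\<close>, \<zeta> and \<zeta>' are O(L) away from the pole and the
  3-4-1 inequality yields 1/\<zeta> = O(L^4), so (1/\<zeta>)' = -\<zeta>'/\<zeta>^2 is O(L^9) =
  O((|t|+2)^(1/4)). Division by s leaves the exponent -3/4, whose square is integrable; any exponent
  below 1/18 in place of 1/36 would do the same. The factor u = ln k is what makes the final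
  comparison possible. A bound for \<Sum>M(k)^2/k^3 alone would have to be paired with the divergent
  \<Sum>1/k; with (ln k)^2 as a weight the partner is \<Sum>1/(k (ln k)^2). The price is the
  derivative of 1/\<zeta> in the transform. The divisor function in (ii) comes from two estimates of
  the inner sum over d. |M(m)| \<le> m bounds it by n d(l), which controls the tail in l. Grouping
  the n with the same n div d bounds its sum over n, weighted by 1/n^2, by d(l)
  \<Sum>|M(k)|/k^2.\<close>

lemma moebius_prime_mult:
  assumes p: "prime p" and pd: "\<not> p dvd d" and d: "d > 0"
  shows "moebius (p * d) = - moebius d"
proof -
  have cop: "coprime p d" using p pd prime_imp_coprime by blast
  have sq: "squarefree (p * d) \<longleftrightarrow> squarefree d"
    using cop p squarefree_mult_coprime squarefree_prime[OF p] by (metis dvd_triv_right squarefree_mono)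
  have pf: "prime_factors (p * d) = insert p (prime_factors d)"
    using p d by (subst prime_factors_product) (auto simp: prime_prime_factors prime_gt_0_nat)
  have "p \<notin> prime_factors d" using pd by auto
  then show ?thesis
    using sq pf p d by (auto simp: moebius_def prime_gt_0_nat)
qed

text \<open>Fix a prime p dividing n > 1. The divisors d prime to p (the set \<open>A\<close>) are
  paired with p*d (the set \<open>B\<close>), and the two values cancel; a divisor outside both sets
  is divisible by p^2 and contributes 0.\<close>

lemma sum_moebius_divisors:
  assumes "n > 0"
  shows "(\<Sum>d | d dvd n. moebius d) = (if n = 1 then 1 else 0)"
proof (cases "n = 1")
  case True
  have "{d. d dvd Suc 0} = {1}" by auto
  then show ?thesis using True by (simp add: moebius_def)
next
  case False
  then obtain p where p: "prime p" "p dvd n" using prime_factor_nat by blast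
  define A where "A = {d. d dvd n \<and> \<not> p dvd d}"
  define B where "B = (\<lambda>d. p * d) ` A"
  have fin: "finite {d. d dvd n}" using assms by (simp add: finite_divisors_nat)
  have finA: "finite A" unfolding A_def by (rule finite_subset[OF _ fin]) auto
  have posA: "d > 0" if "d \<in> A" for d using that assms unfolding A_def by (auto intro: Nat.gr0I)
  have BD: "B \<subseteq> {d. d dvd n}"
  proof
    fix x assume "x \<in> B"
    then obtain d where d: "x = p * d" "d dvd n" "\<not> p dvd d" by (auto simp: B_def A_def)
    have "coprime p d" using p d prime_imp_coprime by blast
    then show "x \<in> {d. d dvd n}" using d p by (simp add: divides_mult)
  qed
  have AB: "A \<inter> B = {}" by (auto simp: A_def B_def)
  have zero: "moebius d = 0" if "d dvd n" "d \<notin> A \<union> B" for d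
  proof -
    from that have "p dvd d" by (auto simp: A_def)
    then obtain e where e: "d = p * e" by blast
    have "e dvd n" using that e by (metis dvd_mult_right)
    then have "p dvd e" using that e by (auto simp: A_def B_def)
    then have "p * p dvd d" using e by auto
    then have "\<not> squarefree d" using p by (auto simp: squarefree_def power2_eq_square)
    then show ?thesis by (simp add: moebius_def)
  qed
  have "(\<Sum>d | d dvd n. moebius d) = sum moebius (A \<union> B)"
    by (rule sum.mono_neutral_right) (use fin BD zero in \<open>auto simp: A_def\<close>)
  also have "\<dots> = sum moebius A + sum moebius B"
    using finA AB by (intro sum.union_disjoint) (auto simp: B_def)
  also have "sum moebius B = (\<Sum>d\<in>A. moebius (p * d))"
    unfolding B_def using p by (subst sum.reindex) (auto simp: inj_on_def prime_gt_0_nat)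
  also have "\<dots> = (\<Sum>d\<in>A. - moebius d)"
    by (rule sum.cong) (use p posA in \<open>auto simp: A_def moebius_prime_mult\<close>)
  finally show ?thesis using False by (simp add: sum_negf)
qed

lemma abs_moebius_le_1: "\<bar>moebius k\<bar> \<le> 1"
  by (auto simp: moebius_def power_abs)

lemma finite_farey: "finite (farey n)"
proof -
  have "farey n \<subseteq> (\<lambda>(j,m). real j / real m) ` ({..n} \<times> {..n})"
    unfolding farey_def by force
  then show ?thesis by (rule finite_subset) auto
qed

text \<open>Since \<open>farey\<close> is a set of reals, the reindexing rests on the fact that a
  fraction in lowest terms determines its numerator and denominator.\<close>

lemma sum_farey:
  fixes g :: "real \<Rightarrow> 'a::comm_monoid_add"
  shows "(\<Sum>x\<in>farey n. g x) = (\<Sum>m\<in>{1..n}. \<Sum>j\<in>{j\<in>{1..m}. coprime j m}. g (real j / real m))"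
proof -
  let ?S = "SIGMA m:{1..n}. {j\<in>{1..m}. coprime j m}"
  have inj: "inj_on (\<lambda>(m,j). real j / real m) ?S"
  proof (rule inj_onI)
    fix a b assume ab: "a \<in> ?S" "b \<in> ?S" "(case a of (m,j) \<Rightarrow> real j / real m) = (case b of (m,j) \<Rightarrow> real j / real m)"
    obtain m j where a: "a = (m,j)" by (cases a)
    obtain m' j' where b: "b = (m',j')" by (cases b)
    from ab a b have "real (j * m') = real (j' * m)" by (auto simp: field_simps)
    then have e: "j * m' = j' * m" using of_nat_eq_iff by blast
    have c: "coprime j m" "coprime j' m'" using ab a b by auto
    then have "j = j'" using e by (metis coprime_crossproduct_nat)
    then show "a = b" using e c a b by (metis coprime_crossproduct_nat)
  qed
  have im: "farey n = (\<lambda>(m,j). real j / real m) ` ?S"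
    unfolding farey_def by force
  have "(\<Sum>x\<in>farey n. g x) = (\<Sum>(m,j)\<in>?S. g (real j / real m))"
    unfolding im by (subst sum.reindex[OF inj]) (simp add: case_prod_unfold)
  also have "\<dots> = (\<Sum>m\<in>{1..n}. \<Sum>j\<in>{j\<in>{1..m}. coprime j m}. g (real j / real m))"
    by (subst sum.Sigma) auto
  finally show ?thesis .
qed

text \<open>The terms are the powers of an e-th root of unity \<open>w\<close>, so the geometric sum
  vanishes unless \<open>w = 1\<close>, which happens exactly when e divides l.\<close>

lemma sum_roots_of_unity:
  fixes l :: int
  assumes e: "e > 0"
  shows "(\<Sum>i\<in>{1..e}. cis (2 * pi * real_of_int l * (real i / real e)))
           = (if int e dvd l then of_nat e else 0)"
proof -
  define w where "w = cis (2 * pi * real_of_int l / real e)"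
  have wi: "cis (2 * pi * real_of_int l * (real i / real e)) = w ^ i" for i
    unfolding w_def Complex.DeMoivre by (rule arg_cong[of _ _ cis]) (simp add: field_simps)
  have we: "w ^ e = 1"
    using wi[of e] e cis_multiple_2pi[of "real_of_int l"] by (simp add: mult.assoc)
  have w1: "w = 1 \<longleftrightarrow> int e dvd l"
  proof
    assume "int e dvd l"
    then obtain k where "l = int e * k" by blast
    then have "w = cis (2 * pi * real_of_int k)" using e unfolding w_def by (intro arg_cong[of _ _ cis]) simp
    then show "w = 1" using cis_multiple_2pi[of "real_of_int k"] by simp
  next
    assume "w = 1"
    then have "cos (2 * pi * real_of_int l / real e) = 1"
      unfolding w_def by (metis Re_complex_of_real cis.simps(1) of_real_1)
    then obtain k :: int where "2 * pi * real_of_int l / real e = real_of_int k * 2 * pi"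
      using cos_one_2pi_int by auto
    then have "real_of_int l = real_of_int (k * int e)" using e by (simp add: field_simps)
    then have "l = k * int e" using of_int_eq_iff by blast
    then show "int e dvd l" by simp
  qed
  have "(\<Sum>i\<in>{1..e}. w ^ i) = (\<Sum>i<e. w * w ^ i)"
    by (rule sum.reindex_bij_witness[of _ Suc "\<lambda>i. i - 1"]) (auto simp: power_eq_if)
  also have "\<dots> = w * (\<Sum>i<e. w ^ i)" by (simp add: sum_distrib_left)
  also have "\<dots> = (if w = 1 then of_nat e else 0)"
    using we by (auto simp: sum_gp_strict)
  finally show ?thesis using wi w1 by simp
qed

text \<open>The coprimality condition is replaced by the sum of \<mu>(d) over the common divisors d
  of j and m; after exchanging the sums, j runs through the multiples of d.\<close>

lemma sum_coprime_eq_moebius_sum: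
  fixes h :: "nat \<Rightarrow> complex"
  assumes m: "m > 0"
  shows "(\<Sum>j\<in>{j\<in>{1..m}. coprime j m}. h j) =
     (\<Sum>d | d dvd m. of_int (moebius d) * (\<Sum>i\<in>{1..m div d}. h (d * i)))"
proof -
  have fin: "finite {d. d dvd m}" using m by simp
  have "(\<Sum>j\<in>{j\<in>{1..m}. coprime j m}. h j) = (\<Sum>j\<in>{1..m}. if coprime j m then h j else 0)"
    by (rule sum.inter_filter) simp
  also have "\<dots> = (\<Sum>j\<in>{1..m}. \<Sum>d | d dvd m. if d dvd j then of_int (moebius d) * h j else 0)"
  proof (rule sum.cong)
    fix j assume "j \<in> {1..m}"
    have "{d. d dvd gcd j m} = {d\<in>{d. d dvd m}. d dvd j}" by auto
    then have "(\<Sum>d\<in>{d\<in>{d. d dvd m}. d dvd j}. moebius d) = (if gcd j m = 1 then 1 else 0)"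
      using sum_moebius_divisors[of "gcd j m"] m by simp
    then have *: "(\<Sum>d | d dvd m. if d dvd j then moebius d else 0) = (if coprime j m then 1 else 0)"
      using sum.inter_filter[OF fin, of moebius "\<lambda>d. d dvd j"] by (simp add: coprime_iff_gcd_eq_1)
    have "(\<Sum>d | d dvd m. if d dvd j then of_int (moebius d) * h j else 0)
       = of_int (\<Sum>d | d dvd m. if d dvd j then moebius d else 0) * h j"
      unfolding of_int_sum sum_distrib_right by (rule sum.cong) auto
    then show "(if coprime j m then h j else 0) = (\<Sum>d | d dvd m. if d dvd j then of_int (moebius d) * h j else 0)"
      unfolding * by simp
  qed simp
  also have "\<dots> = (\<Sum>d | d dvd m. \<Sum>j\<in>{1..m}. if d dvd j then of_int (moebius d) * h j else 0)"
    by (rule sum.swap)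
  also have "\<dots> = (\<Sum>d | d dvd m. of_int (moebius d) * (\<Sum>i\<in>{1..m div d}. h (d * i)))"
  proof (rule sum.cong)
    fix d assume "d \<in> {d. d dvd m}"
    then have d: "d dvd m" "d > 0" using m by (auto intro: Nat.gr0I)
    have "(\<Sum>j\<in>{1..m}. if d dvd j then of_int (moebius d) * h j else 0)
      = (\<Sum>j\<in>{j\<in>{1..m}. d dvd j}. of_int (moebius d) * h j)"
      by (rule sum.inter_filter[symmetric]) simp
    also have "\<dots> = (\<Sum>i\<in>{1..m div d}. of_int (moebius d) * h (d * i))"
    proof (rule sum.reindex_bij_witness[of _ "\<lambda>i. d * i" "\<lambda>j. j div d"])
      fix i assume "i \<in> {1..m div d}"
      then have "d * i \<le> m" "1 \<le> i" using d by (auto simp: less_eq_div_iff_mult_less_eq mult.commute)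
      then show "d * i \<in> {j\<in>{1..m}. d dvd j}" using d by auto
    next
      fix j assume "j \<in> {j\<in>{1..m}. d dvd j}"
      then show "j div d \<in> {1..m div d}" using d by (auto simp: div_le_mono Suc_leI div_greater_zero_iff dvd_imp_le)
    qed (use d in auto)
    finally show "(\<Sum>j\<in>{1..m}. if d dvd j then of_int (moebius d) * h j else 0) = of_int (moebius d) * (\<Sum>i\<in>{1..m div d}. h (d * i))"
      by (simp add: sum_distrib_left)
  qed simp
  finally show ?thesis .
qed

lemma mertens_div: "mertens (real n / real d) = (\<Sum>k\<in>{1..n div d}. moebius k)"
  by (simp add: mertens_def floor_divide_of_nat_eq)

text \<open>For one denominator m the sum is the Ramanujan sum \<Sum> e \<mu>(m/e) over the common
  divisors e of m and l. Summing over m \<le> n, the factor e is met once with each \<mu>(d), d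
  \<le> n/e, and these add up to M(n/e). For l = 0 every e counts as a divisor.\<close>

lemma sum_farey_cis:
  fixes l :: int
  shows "(\<Sum>x\<in>farey n. cis (2 * pi * real_of_int l * x)) =
     of_int (\<Sum>d\<in>{d\<in>{1..n}. int d dvd l}. int d * mertens (real n / real d))"
proof -
  define R :: "nat \<Rightarrow> complex" where "R e = (if int e dvd l then of_nat e else 0)" for e
  have "(\<Sum>x\<in>farey n. cis (2 * pi * real_of_int l * x))
     = (\<Sum>m\<in>{1..n}. \<Sum>d | d dvd m. of_int (moebius d) * R (m div d))"
    unfolding sum_farey
  proof (rule sum.cong)
    fix m assume "m \<in> {1..n}"
    then have m: "m > 0" by auto
    show "(\<Sum>j\<in>{j\<in>{1..m}. coprime j m}. cis (2 * pi * real_of_int l * (real j / real m)))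
        = (\<Sum>d | d dvd m. of_int (moebius d) * R (m div d))"
      unfolding sum_coprime_eq_moebius_sum[OF m]
    proof (rule sum.cong)
      fix d assume "d \<in> {d. d dvd m}"
      then obtain e where e: "m = d * e" by auto
      with m have de: "d > 0" "e > 0" by auto
      have "(\<Sum>i\<in>{1..e}. cis (2 * pi * real_of_int l * (real (d * i) / real m))) = R e"
        unfolding R_def sum_roots_of_unity[OF de(2), symmetric] e using de by simp
      then show "of_int (moebius d) * (\<Sum>i\<in>{1..m div d}. cis (2 * pi * real_of_int l * (real (d * i) / real m)))
           = of_int (moebius d) * R (m div d)"
        using e de by simp
    qed simp
  qed simp
  also have "\<dots> = (\<Sum>(m,d)\<in>(SIGMA m:{1..n}. {d. d dvd m}). of_int (moebius d) * R (m div d))"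
    by (subst sum.Sigma) auto
  \<comment> \<open>Substitution m = e * d: the constraint m \<le> n becomes d \<le> n div e, and
    the complementary divisor e becomes the outer variable.\<close>
  also have "\<dots> = (\<Sum>(e,d)\<in>(SIGMA e:{1..n}. {1..n div e}). of_int (moebius d) * R e)"
  proof (rule sum.reindex_bij_witness[of _ "\<lambda>(e,d). (e * d, d)" "\<lambda>(m,d). (m div d, d)"])
    fix a assume "a \<in> (SIGMA m:{1..n}. {d. d dvd m})"
    then obtain m d e where a: "a = (m,d)" "m = d * e" "1 \<le> m" "m \<le> n" by auto
    then have de: "d > 0" "e > 0" by (auto intro: Nat.gr0I)
    have "e \<le> n" "d \<le> n div e" using a de
      by (auto simp: less_eq_div_iff_mult_less_eq intro: order.trans[of e "d*e" n])
    then show "(case a of (m,d) \<Rightarrow> (m div d, d)) \<in> (SIGMA e:{1..n}. {1..n div e})"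
      "(case case a of (m,d) \<Rightarrow> (m div d, d) of (e,d) \<Rightarrow> (e * d, d)) = a"
      "(case case a of (m,d) \<Rightarrow> (m div d, d) of (e,d) \<Rightarrow> of_int (moebius d) * R e) =
         (case a of (m,d) \<Rightarrow> of_int (moebius d) * R (m div d))"
      using a de by auto
  next
    fix b assume "b \<in> (SIGMA e:{1..n}. {1..n div e})"
    then obtain e d where b: "b = (e,d)" "1 \<le> e" "1 \<le> d" "d \<le> n div e" by auto
    then have "e * d \<le> n" by (auto simp: less_eq_div_iff_mult_less_eq mult.commute)
    then show "(case b of (e,d) \<Rightarrow> (e * d, d)) \<in> (SIGMA m:{1..n}. {d. d dvd m})"
      "(case case b of (e,d) \<Rightarrow> (e * d, d) of (m,d) \<Rightarrow> (m div d, d)) = b"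
      using b by auto
  qed
  also have "\<dots> = (\<Sum>e\<in>{1..n}. R e * of_int (\<Sum>d\<in>{1..n div e}. moebius d))"
    by (subst sum.Sigma[symmetric]) (auto simp: sum_distrib_left mult.commute)
  also have "\<dots> = (\<Sum>e\<in>{1..n}. if int e dvd l then of_int (int e * mertens (real n / real e)) else 0)"
    by (rule sum.cong) (auto simp: R_def mertens_div)
  also have "\<dots> = of_int (\<Sum>d\<in>{d\<in>{1..n}. int d dvd l}. int d * mertens (real n / real d))"
    unfolding of_int_sum by (rule sum.inter_filter[symmetric]) simp
  finally show ?thesis .
qed

section \<open>Elementary bounds for the Mertens function\<close>

lemma mertens_0: "mertens 0 = 0"
  by (simp add: mertens_def)

lemma mertens_nat: "mertens (real n) = (\<Sum>k\<in>{1..n}. moebius k)"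
  by (simp add: mertens_def)

lemma mertens_div_nat: "mertens (real n / real d) = mertens (real (n div d))"
  by (simp add: mertens_div mertens_nat)

lemma abs_mertens_diff_le: "m \<le> n \<Longrightarrow> \<bar>mertens (real n) - mertens (real m)\<bar> \<le> int (n - m)"
proof -
  assume mn: "m \<le> n"
  then have "{1..n} = {1..m} \<union> {m<..n}" by auto
  moreover have "{1..m} \<inter> {m<..n} = {}" by auto
  ultimately have "mertens (real n) - mertens (real m) = (\<Sum>k\<in>{m<..n}. moebius k)"
    unfolding mertens_nat using sum.union_disjoint[of "{1..m}" "{m<..n}" moebius] by simp
  also have "\<bar>\<dots>\<bar> \<le> (\<Sum>k\<in>{m<..n}. \<bar>moebius k\<bar>)" by (rule sum_abs)
  also have "\<dots> \<le> (\<Sum>k\<in>{m<..n}. 1)" by (intro sum_mono abs_moebius_le_1)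
  finally show ?thesis by simp
qed

lemma abs_mertens_le: "\<bar>mertens (real n)\<bar> \<le> int n"
  using abs_mertens_diff_le[of 0 n] by (simp add: mertens_0)

lemma abs_mertens_le_real: "\<bar>real_of_int (mertens (real n))\<bar> \<le> real n"
  by (metis abs_mertens_le of_int_abs of_int_le_iff of_int_of_nat_eq)

section \<open>Pointwise convergence of Fourier series\<close>

lemma integral_cis_period:
  fixes m :: int
  shows "integral {0..1} (\<lambda>x. cis (2 * pi * real_of_int m * x)) = (if m = 0 then 1 else 0)"
proof (cases "m = 0")
  case False
  define F where "F x = cis (2 * pi * real_of_int m * x) / (2 * pi * of_int m * \<i>)" for x :: real
  have "((\<lambda>x. cis (2 * pi * real_of_int m * x)) has_integral (F 1 - F 0)) {0..1}"
  proof (rule fundamental_theorem_of_calculus)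
    fix x :: real
    show "(F has_vector_derivative cis (2 * pi * real_of_int m * x)) (at x within {0..1})"
      unfolding F_def using False
      by (auto intro!: derivative_eq_intros simp: has_vector_derivative_def scaleR_conv_of_real field_simps)
  qed simp
  moreover have "cis (2 * pi * real_of_int m) = 1"
    using cis_multiple_2pi[of "real_of_int m"] by simp
  ultimately show ?thesis using False by (simp add: F_def integral_unique)
qed simp

lemma absolutely_integrable_on_imp_integrable_on:
  fixes f :: "real \<Rightarrow> real"
  shows "f absolutely_integrable_on S \<Longrightarrow> f integrable_on S"
  by (simp add: absolutely_integrable_on_def)

lemma integrable_lebesgue_on_bounded:
  fixes g :: "real \<Rightarrow> complex"
  assumes "g \<in> borel_measurable (lebesgue_on {0..1})" "\<And>x. norm (g x) \<le> B"
  shows "integrable (lebesgue_on {0..1}) g"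
proof -
  have "finite_measure (lebesgue_on {0..1::real})" by (rule finite_measure_lebesgue_on) simp
  then show ?thesis using assms by (intro finite_measure.integrable_const_bound[of _ _ B]) auto
qed

lemma borel_measurable_cis_lebesgue_on:
  "(\<lambda>x. cis (a * x)) \<in> borel_measurable (lebesgue_on S)" if "S \<in> sets lebesgue"
  using that by (intro continuous_imp_measurable_on_sets_lebesgue continuous_intros) auto

text \<open>Expand the integral of |g - P|^2 \<ge> 0, where P is the orthogonal projection of g onto
  finitely many exponentials; the cross term and the norm of P both equal the sum of the |d k|^2.
  Boundedness of g makes every product that occurs integrable, and it can be arranged by truncation
  later.\<close>

lemma Bessel_inequality_bounded:
  fixes g :: "real \<Rightarrow> complex"
  assumes g[measurable]: "g \<in> borel_measurable (lebesgue_on {0..1})" and B: "\<And>x. norm (g x) \<le> B"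
  defines "d \<equiv> \<lambda>k::nat. \<integral>x. g x * cis (2 * pi * real k * x) \<partial>lebesgue_on {0..1}"
  shows "(\<Sum>k<N. (norm (d k))\<^sup>2) \<le> (\<integral>x. (norm (g x))\<^sup>2 \<partial>lebesgue_on {0..1})"
proof -
  let ?M = "lebesgue_on {0..1::real}"
  define \<phi> where "\<phi> k x = cis (2 * pi * real k * x)" for k :: nat and x :: real
  have \<phi>m[measurable]: "\<phi> k \<in> borel_measurable ?M" for k
    unfolding \<phi>_def by (rule borel_measurable_cis_lebesgue_on) simp
  have n\<phi>: "norm (\<phi> k x) = 1" for k x by (simp add: \<phi>_def)
  have B0: "B \<ge> 0" using B[of 0] norm_ge_zero order_trans by blast
  have \<phi>_cnj: "cnj (\<phi> j x) * \<phi> k x = cis (2 * pi * real_of_int (int k - int j) * x)" for j k x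
    unfolding \<phi>_def cis_cnj cis_mult by (rule arg_cong[of _ _ cis]) (simp add: algebra_simps)
  have orth: "(\<integral>x. cnj (\<phi> j x) * \<phi> k x \<partial>?M) = (if j = k then 1 else 0)" for j k
  proof -
    have "integrable ?M (\<lambda>x. cis (2 * pi * real_of_int (int k - int j) * x))"
      by (rule integrable_lebesgue_on_bounded[OF borel_measurable_cis_lebesgue_on, where B = 1]) simp_all
    then show ?thesis unfolding \<phi>_cnj using integral_cis_period[of "int k - int j"]
      by (subst lebesgue_integral_eq_integral) (auto split: if_splits)
  qed
  have int1: "integrable ?M (\<lambda>x. g x * \<phi> k x)" for k
    by (rule integrable_lebesgue_on_bounded[where B = B]) (measurable, simp add: norm_mult n\<phi> B)
  have int2: "integrable ?M (\<lambda>x. cnj (\<phi> j x) * \<phi> k x)" for j k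
    unfolding \<phi>_cnj by (rule integrable_lebesgue_on_bounded[OF borel_measurable_cis_lebesgue_on, where B = 1]) simp_all
  have int3: "integrable ?M (\<lambda>x. of_real ((norm (g x))\<^sup>2) :: complex)"
    by (rule integrable_lebesgue_on_bounded[where B = "B\<^sup>2"]) (measurable, simp add: norm_power B power_mono)
  \<comment> \<open>The conjugate appears because \<open>d k\<close> is formed with the exponential
    itself, hence is the coefficient of g along its conjugate.\<close>
  define P where "P x = (\<Sum>k<N. d k * cnj (\<phi> k x))" for x
  have dk: "d k = (\<integral>x. g x * \<phi> k x \<partial>?M)" for k by (simp add: d_def \<phi>_def)
  have intA: "integrable ?M (\<lambda>x. g x * cnj (P x))"
    unfolding P_def cnj_sum sum_distrib_left
    using int1 by (auto simp: mult.left_commute[of "g _"] intro!: Bochner_Integration.integrable_sum)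
  have A: "(\<integral>x. g x * cnj (P x) \<partial>?M) = of_real (\<Sum>k<N. (norm (d k))\<^sup>2)"
  proof -
    have "(\<integral>x. g x * cnj (P x) \<partial>?M) = (\<integral>x. (\<Sum>k<N. cnj (d k) * (g x * \<phi> k x)) \<partial>?M)"
      unfolding P_def cnj_sum sum_distrib_left by (simp add: mult.left_commute)
    also have "\<dots> = (\<Sum>k<N. cnj (d k) * d k)"
      using int1 by (subst Bochner_Integration.integral_sum) (auto simp: dk)
    finally show ?thesis by (simp add: complex_norm_square mult.commute del: of_real_power)
  qed
  have PP: "of_real ((norm (P x))\<^sup>2) = (\<Sum>j<N. \<Sum>k<N. d j * cnj (d k) * (cnj (\<phi> j x) * \<phi> k x))" for x
    unfolding complex_norm_square P_def cnj_sum sum_product by (simp add: mult.assoc mult.left_commute)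
  have intP: "integrable ?M (\<lambda>x. of_real ((norm (P x))\<^sup>2) :: complex)"
    unfolding PP using int2 by (auto intro!: Bochner_Integration.integrable_sum)
  have Pn: "(\<integral>x. of_real ((norm (P x))\<^sup>2) \<partial>?M) = (of_real (\<Sum>k<N. (norm (d k))\<^sup>2) :: complex)"
  proof -
    have "(\<integral>x. of_real ((norm (P x))\<^sup>2) \<partial>?M) = (\<Sum>j<N. \<Sum>k<N. d j * cnj (d k) * (if j = k then 1 else 0))"
      unfolding PP using int2 by (simp add: Bochner_Integration.integral_sum Bochner_Integration.integrable_sum orth)
    also have "\<dots> = (\<Sum>j<N. d j * cnj (d j))"
      by (simp add: if_distrib cong: if_cong)
    finally show ?thesis by (simp add: complex_norm_square del: of_real_power)
  qed
  define r where "r x = Re (g x * cnj (P x))" for x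
  have expand': "(norm (g x - P x))\<^sup>2 = (norm (g x))\<^sup>2 - 2 * r x + (norm (P x))\<^sup>2" for x
    unfolding cmod_power2 r_def by (simp add: power2_eq_square algebra_simps)
  have i3: "integrable ?M (\<lambda>x. (norm (g x))\<^sup>2)" using integrable_Re[OF int3] by simp
  have iP: "integrable ?M (\<lambda>x. (norm (P x))\<^sup>2)" using integrable_Re[OF intP] by simp
  have iA: "integrable ?M (\<lambda>x. r x)" unfolding r_def using integrable_Re[OF intA] .
  have vA: "(\<integral>x. r x \<partial>?M) = (\<Sum>k<N. (norm (d k))\<^sup>2)"
    unfolding r_def using integral_Re[OF intA] A by simp
  have vP: "(\<integral>x. (norm (P x))\<^sup>2 \<partial>?M) = (\<Sum>k<N. (norm (d k))\<^sup>2)"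
    using integral_Re[OF intP] Pn by simp
  have "0 \<le> (\<integral>x. (norm (g x - P x))\<^sup>2 \<partial>?M)" by simp
  also have "\<dots> = (\<integral>x. (norm (g x))\<^sup>2 \<partial>?M) - 2 * (\<integral>x. r x \<partial>?M) + (\<integral>x. (norm (P x))\<^sup>2 \<partial>?M)"
    unfolding expand' using i3 iP iA by simp
  finally show ?thesis using vA vP by simp
qed

text \<open>Truncating g at height K changes every coefficient by at most the L^1 norm of the
  removed part, uniformly in k. The truncated function is bounded, so by Bessel's inequality its
  coefficients are square summable and tend to 0.\<close>

lemma Riemann_Lebesgue_unit:
  fixes g :: "real \<Rightarrow> complex"
  assumes g: "integrable (lebesgue_on {0..1}) g"
  shows "(\<lambda>k::nat. \<integral>x. g x * cis (2 * pi * real k * x) \<partial>lebesgue_on {0..1}) \<longlonglongrightarrow> 0"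
proof (rule LIMSEQ_I)
  fix e :: real assume e: "e > 0"
  let ?M = "lebesgue_on {0..1::real}"
  have gm[measurable]: "g \<in> borel_measurable ?M" using g by simp
  define G where "G K x = (if norm (g x) \<le> real K then g x else 0)" for K :: nat and x
  have Gm[measurable]: "G K \<in> borel_measurable ?M" for K unfolding G_def by measurable
  have cm[measurable]: "(\<lambda>x. cis (2 * pi * real k * x)) \<in> borel_measurable ?M" for k :: nat
    by (rule borel_measurable_cis_lebesgue_on) simp
  have "(\<lambda>K. \<integral>x. norm (g x - G K x) \<partial>?M) \<longlonglongrightarrow> (\<integral>x. 0 \<partial>?M)"
  proof (rule integral_dominated_convergence[where w = "\<lambda>x. norm (g x)"])
    show "AE x in ?M. (\<lambda>K. norm (g x - G K x)) \<longlonglongrightarrow> 0"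
    proof (rule AE_I2)
      fix x
      obtain K0 where "norm (g x) \<le> real K0" using real_arch_simple by blast
      then have "\<forall>\<^sub>F K in sequentially. norm (g x - G K x) = 0"
        unfolding eventually_sequentially G_def by (intro exI[of _ K0]) auto
      then show "(\<lambda>K. norm (g x - G K x)) \<longlonglongrightarrow> 0" by (rule tendsto_eventually)
    qed
  qed (use g in \<open>auto simp: G_def\<close>)
  then have "(\<lambda>K. \<integral>x. norm (g x - G K x) \<partial>?M) \<longlonglongrightarrow> 0" by simp
  from LIMSEQ_D[OF this, of "e/2"] e obtain K where "norm ((\<integral>x. norm (g x - G K x) \<partial>?M) - 0) < e/2" by auto
  then have K: "(\<integral>x. norm (g x - G K x) \<partial>?M) < e/2" by simp
  have GB: "norm (G K x) \<le> real K" for x by (simp add: G_def)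
  have iG: "integrable ?M (G K)" by (rule integrable_lebesgue_on_bounded[OF Gm GB])
  define d where "d k = (\<integral>x. G K x * cis (2 * pi * real k * x) \<partial>?M)" for k :: nat
  have "summable (\<lambda>k. (norm (d k))\<^sup>2)"
    by (rule bounded_imp_summable[where B = "\<integral>x. (norm (G K x))\<^sup>2 \<partial>?M"])
      (use Bessel_inequality_bounded[OF Gm GB] in \<open>simp_all only: d_def zero_le_power2 flip: lessThan_Suc_atMost\<close>)
  then have "(\<lambda>k. (norm (d k))\<^sup>2) \<longlonglongrightarrow> 0" by (rule summable_LIMSEQ_zero)
  then have "(\<lambda>k. sqrt ((norm (d k))\<^sup>2)) \<longlonglongrightarrow> sqrt 0" by (rule tendsto_real_sqrt)
  then have "d \<longlonglongrightarrow> 0" by (simp add: tendsto_norm_zero_iff)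
  from LIMSEQ_D[OF this, of "e/2"] e obtain N where N: "\<And>k. k \<ge> N \<Longrightarrow> norm (d k) < e/2" by auto
  show "\<exists>no. \<forall>k\<ge>no. norm ((\<integral>x. g x * cis (2 * pi * real k * x) \<partial>?M) - 0) < e"
  proof (intro exI allI impI)
    fix k assume k: "k \<ge> N"
    have i1: "integrable ?M (\<lambda>x. G K x * cis (2 * pi * real k * x))"
      by (rule integrable_lebesgue_on_bounded[where B = "real K"]) (measurable, simp add: norm_mult GB)
    have i2: "integrable ?M (\<lambda>x. g x * cis (2 * pi * real k * x))"
      by (rule Bochner_Integration.integrable_bound[OF g]) (measurable, simp add: norm_mult)
    have "(\<integral>x. g x * cis (2 * pi * real k * x) \<partial>?M) - d k
        = (\<integral>x. (g x - G K x) * cis (2 * pi * real k * x) \<partial>?M)"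
      unfolding d_def using i1 i2 by (simp add: left_diff_distrib)
    also have "norm \<dots> \<le> (\<integral>x. norm ((g x - G K x) * cis (2 * pi * real k * x)) \<partial>?M)"
      by (rule integral_norm_bound)
    also have "\<dots> = (\<integral>x. norm (g x - G K x) \<partial>?M)" by (simp add: norm_mult)
    finally have "norm ((\<integral>x. g x * cis (2 * pi * real k * x) \<partial>?M) - d k) < e/2" using K by simp
    with N[OF k] have "norm (((\<integral>x. g x * cis (2 * pi * real k * x) \<partial>?M) - d k) + d k) < e/2 + e/2"
      by (intro norm_triangle_lt) auto
    then show "norm ((\<integral>x. g x * cis (2 * pi * real k * x) \<partial>?M) - 0) < e" by simp
  qed
qed

text \<open>The frequency (2N+1)/2 is not an integer. Absorbing \<open>cis (pi * y)\<close> into the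
  integrand leaves the integer frequency N, and the shift by x is a factor \<open>c N\<close> of
  modulus 1.\<close>

lemma Riemann_Lebesgue_sin:
  fixes w :: "real \<Rightarrow> real"
  assumes w: "w absolutely_integrable_on {0..1}"
  shows "(\<lambda>N::nat. integral {0..1} (\<lambda>y. w y * sin ((2 * real N + 1) * pi * (y - x)))) \<longlonglongrightarrow> 0"
proof -
  let ?M = "lebesgue_on {0..1::real}"
  have w': "integrable ?M w" using w by (simp add: set_integrable_def integrable_restrict_space)
  then have wm[measurable]: "w \<in> borel_measurable ?M" by simp
  have cm[measurable]: "(\<lambda>y. cis (a * y)) \<in> borel_measurable ?M" for a
    by (rule borel_measurable_cis_lebesgue_on) simp
  define g where "g y = of_real (w y) * cis (pi * y)" for y
  have g: "integrable ?M g" unfolding g_def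
    by (rule Bochner_Integration.integrable_bound[OF w']) (measurable, simp add: norm_mult)
  have gm[measurable]: "g \<in> borel_measurable ?M" using g by simp
  have gk: "integrable ?M (\<lambda>y. g y * cis (2 * pi * real N * y))" for N :: nat
    by (rule Bochner_Integration.integrable_bound[OF g]) (measurable, simp add: norm_mult)
  define c where "c N = cis (- (2 * real N + 1) * pi * x)" for N :: nat
  define J where "J N = (\<integral>y. g y * cis (2 * pi * real N * y) \<partial>?M)" for N :: nat
  have J: "J \<longlonglongrightarrow> 0" unfolding J_def by (rule Riemann_Lebesgue_unit[OF g])
  have eq: "integral {0..1} (\<lambda>y. w y * sin ((2 * real N + 1) * pi * (y - x))) = Im (c N * J N)" for N :: nat
  proof -
    have *: "w y * sin ((2 * real N + 1) * pi * (y - x)) = Im (c N * (g y * cis (2 * pi * real N * y)))" for y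
    proof -
      have "c N * (g y * cis (2 * pi * real N * y)) = of_real (w y) * cis ((2 * real N + 1) * pi * (y - x))"
        unfolding c_def g_def by (simp only: mult.left_commute[of _ "of_real (w y)"] cis_mult mult.assoc) (simp add: algebra_simps)
      then show ?thesis by simp
    qed
    have i: "integrable ?M (\<lambda>y. c N * (g y * cis (2 * pi * real N * y)))" using gk by simp
    have "integral {0..1} (\<lambda>y. w y * sin ((2 * real N + 1) * pi * (y - x)))
       = (\<integral>y. Im (c N * (g y * cis (2 * pi * real N * y))) \<partial>?M)"
      unfolding * using integrable_Im[OF i] by (subst lebesgue_integral_eq_integral) auto
    also have "\<dots> = Im (c N * J N)"
      using integral_Im[OF i] by (simp add: J_def)
    finally show ?thesis .
  qed
  have "(\<lambda>N. Im (c N * J N)) \<longlonglongrightarrow> 0"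
  proof (rule Lim_null_comparison)
    show "\<forall>\<^sub>F N in sequentially. norm (Im (c N * J N)) \<le> norm (J N)"
    proof (rule always_eventually, rule allI)
      fix N
      have "\<bar>Im (c N * J N)\<bar> \<le> norm (c N * J N)" by (rule abs_Im_le_cmod)
      then show "norm (Im (c N * J N)) \<le> norm (J N)" by (simp add: norm_mult c_def)
    qed
    show "(\<lambda>N. norm (J N)) \<longlonglongrightarrow> 0" using J by (simp add: tendsto_norm_zero_iff)
  qed
  then show ?thesis unfolding eq .
qed


section \<open>The Dirichlet kernel and Dini's criterion\<close>

lemma symsum_0: "symsum a 0 = a 0"
  by (simp add: symsum_def)

lemma symsum_Suc: "symsum a (Suc N) = symsum a N + (a (int (Suc N)) + a (- int (Suc N)))"
proof -
  have "{- int (Suc N)..int (Suc N)} = insert (int (Suc N)) (insert (- int (Suc N)) {- int N..int N})"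
    by auto
  then show ?thesis by (simp add: symsum_def add_ac)
qed

definition Dirichlet_kernel :: "nat \<Rightarrow> real \<Rightarrow> real" where
  "Dirichlet_kernel N u = symsum (\<lambda>l. cos (2 * pi * real_of_int l * u)) N"

text \<open>The closed form is kept multiplied out, so that it also holds at the zeros of
  \<open>sin (pi * u)\<close>; the induction step is the product formula for sin and cos.\<close>

lemma Dirichlet_kernel_sin: "sin (pi * u) * Dirichlet_kernel N u = sin ((2 * real N + 1) * pi * u)"
proof (induction N)
  case 0
  then show ?case by (simp add: Dirichlet_kernel_def symsum_0)
next
  case (Suc N)
  have "2 * (sin (pi * u) * cos (2 * pi * real (Suc N) * u))
      = sin ((2 * real (Suc N) + 1) * pi * u) - sin ((2 * real N + 1) * pi * u)"
    using sin_add[of "2 * pi * real (Suc N) * u" "pi * u"] sin_diff[of "2 * pi * real (Suc N) * u" "pi * u"]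
    by (simp add: algebra_simps)
  moreover have "cos (2 * pi * real_of_int (- int (Suc N)) * u) = cos (2 * pi * real (Suc N) * u)"
    using cos_minus[of "2 * pi * real (Suc N) * u"] by (simp add: algebra_simps del: cos_minus)
  ultimately show ?case using Suc
    by (simp add: Dirichlet_kernel_def symsum_Suc distrib_left del: of_nat_Suc)
qed

lemma symsum_cis_eq_Dirichlet_kernel:
  "symsum (\<lambda>l. cis (2 * pi * real_of_int l * u)) N = of_real (Dirichlet_kernel N u)"
proof (induction N)
  case 0
  then show ?case by (simp add: Dirichlet_kernel_def symsum_0)
next
  case (Suc N)
  have "cis (2 * pi * real_of_int (int (Suc N)) * u) + cis (2 * pi * real_of_int (- int (Suc N)) * u)
     = of_real (cos (2 * pi * real_of_int (int (Suc N)) * u) + cos (2 * pi * real_of_int (- int (Suc N)) * u))"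
    using sin_minus[of "2 * pi * real_of_int (int (Suc N)) * u"] by (simp add: complex_eq_iff algebra_simps)
  then show ?case using Suc unfolding Dirichlet_kernel_def symsum_Suc by simp
qed

lemma Dirichlet_kernel_minus: "Dirichlet_kernel N (- u) = Dirichlet_kernel N u"
  by (simp add: Dirichlet_kernel_def)

lemma continuous_on_Dirichlet_kernel:
  fixes g :: "real \<Rightarrow> real"
  shows "continuous_on A g \<Longrightarrow> continuous_on A (\<lambda>x. Dirichlet_kernel N (g x))"
  unfolding Dirichlet_kernel_def symsum_def by (auto intro!: continuous_intros)

lemma absolutely_integrable_continuous_mult:
  fixes h :: "real \<Rightarrow> real"
  assumes "continuous_on {a..b} h" "g absolutely_integrable_on {a..b}"
  shows "(\<lambda>x. h x * g x) absolutely_integrable_on {a..b}"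
  using assms
  by (intro absolutely_integrable_bounded_measurable_product_real continuous_imp_measurable_on_sets_lebesgue
       compact_imp_bounded compact_continuous_image) auto

lemma absolutely_integrable_cis_mult:
  fixes f :: "real \<Rightarrow> real"
  assumes "f absolutely_integrable_on {0..1}"
  shows "(\<lambda>y. complex_of_real (f y) * cis (a * y)) integrable_on {0..1}"
proof -
  have 1: "(\<lambda>y. cos (a * y) * f y) integrable_on {0..1}"
    by (rule absolutely_integrable_on_imp_integrable_on, rule absolutely_integrable_continuous_mult[OF _ assms]) (intro continuous_intros)
  have 2: "(\<lambda>y. sin (a * y) * f y) integrable_on {0..1}"
    by (rule absolutely_integrable_on_imp_integrable_on, rule absolutely_integrable_continuous_mult[OF _ assms]) (intro continuous_intros)
  have "(\<lambda>y. complex_of_real (cos (a * y) * f y) + \<i> * complex_of_real (sin (a * y) * f y)) integrable_on {0..1}"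
    using has_integral_of_real[OF integrable_integral[OF 1], where 'b = complex] has_integral_of_real[OF integrable_integral[OF 2], where 'b = complex]
    by (intro integrable_add integrable_on_mult_right) (auto simp: integrable_on_def)
  then show ?thesis by (rule integrable_eq) (simp add: complex_eq_iff)
qed

lemma Fourier_partial_sum:
  fixes f :: "real \<Rightarrow> real"
  assumes f: "f absolutely_integrable_on {0..1}"
  shows "symsum (\<lambda>l. fcoeff f l * cis (2 * pi * real_of_int l * x)) N
      = of_real (integral {0..1} (\<lambda>y. f y * Dirichlet_kernel N (y - x)))"
proof -
  have cis_eq: "complex_of_real (f y) * cis (- 2 * pi * real_of_int l * y) * cis (2 * pi * real_of_int l * x) =
     complex_of_real (f y) * cis (2 * pi * real_of_int l * (x - y))" for y and l :: int
    unfolding mult.assoc cis_mult by (simp add: algebra_simps)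
  have int: "(\<lambda>y. complex_of_real (f y) * cis (- 2 * pi * real_of_int l * y) * cis (2 * pi * real_of_int l * x)) integrable_on {0..1}" for l
    using absolutely_integrable_cis_mult[OF f] by (intro integrable_on_mult_left)
  have "symsum (\<lambda>l. fcoeff f l * cis (2 * pi * real_of_int l * x)) N
     = (\<Sum>l\<in>{- int N..int N}. integral {0..1} (\<lambda>y. complex_of_real (f y) * cis (2 * pi * real_of_int l * (x - y))))"
    unfolding symsum_def fcoeff_def cis_eq[symmetric] by simp
  also have "\<dots> = integral {0..1} (\<lambda>y. \<Sum>l\<in>{- int N..int N}. complex_of_real (f y) * cis (2 * pi * real_of_int l * (x - y)))"
    using int unfolding cis_eq by (intro integral_sum[symmetric]) auto
  also have "\<dots> = integral {0..1} (\<lambda>y. complex_of_real (f y * Dirichlet_kernel N (y - x)))"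
  proof -
    have "(\<Sum>l\<in>{- int N..int N}. complex_of_real (f y) * cis (2 * pi * real_of_int l * (x - y)))
       = complex_of_real (f y * Dirichlet_kernel N (y - x))" for y
      using symsum_cis_eq_Dirichlet_kernel[of "x - y" N] Dirichlet_kernel_minus[of N "y - x"]
      by (simp add: symsum_def sum_distrib_left[symmetric])
    then show ?thesis by presburger
  qed
  also have "\<dots> = of_real (integral {0..1} (\<lambda>y. f y * Dirichlet_kernel N (y - x)))"
  proof (rule integral_unique, rule has_integral_of_real, rule integrable_integral)
    have "(\<lambda>y. Dirichlet_kernel N (y - x) * f y) absolutely_integrable_on {0..1}"
      by (intro absolutely_integrable_continuous_mult continuous_on_Dirichlet_kernel continuous_intros f)
    then show "(\<lambda>y. f y * Dirichlet_kernel N (y - x)) integrable_on {0..1}"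
      by (simp add: mult.commute absolutely_integrable_on_imp_integrable_on)
  qed
  finally show ?thesis .
qed

text \<open>The integral is a Fourier partial sum of the constant function 1, whose only nonzero
  coefficient is the one at l = 0.\<close>

lemma integral_Dirichlet_kernel: "integral {0..1} (\<lambda>y. Dirichlet_kernel N (y - x)) = 1"
proof -
  have c: "fcoeff (\<lambda>_. 1) l = (if l = 0 then 1 else 0)" for l
    using integral_cis_period[of "-l"] by (simp add: fcoeff_def)
  have i: "(\<lambda>_. 1::real) absolutely_integrable_on {0..1::real}"
    by (intro absolutely_integrable_continuous_real continuous_intros)
  have "of_real (integral {0..1} (\<lambda>y. 1 * Dirichlet_kernel N (y - x))) = (1::complex)"
    unfolding Fourier_partial_sum[OF i, symmetric] c symsum_def
    by (simp add: if_distrib[of "\<lambda>z. z * _"] cong: if_cong)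
  then show ?thesis by simp
qed

text \<open>By the mean value theorem sin (\<pi>u) = \<pi>u cos z with z below \<pi>/3, where cos z
  \<ge> 1/2, and \<pi>/2 \<ge> 1. This makes u / sin (\<pi>u) bounded by 1 near 0.\<close>

lemma sin_pi_lower_bound:
  assumes "0 \<le> u" "u \<le> 1/3" shows "u \<le> sin (pi * u)"
proof (cases "u = 0")
  case False
  with assms have u: "0 < pi * u" by simp
  obtain z where z: "0 < z" "z < pi * u" "sin (pi * u) - sin 0 = (pi * u - 0) * cos z"
    using MVT2[OF u, of sin cos] by (auto intro: derivative_eq_intros)
  have "pi * u \<le> pi / 3" using assms by simp
  then have "cos (pi/3) \<le> cos z" using z pi_gt_zero by (intro cos_monotone_0_pi_le) linarith+
  then have "1/2 \<le> cos z" by (simp add: cos_60)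
  then have "pi * u * (1/2) \<le> sin (pi * u)" using z mult_left_mono[of "1/2" "cos z" "pi * u"] u by simp
  moreover have "u \<le> pi * u * (1/2)" using pi_gt3 assms mult_right_mono[of 2 pi u] by simp
  ultimately show ?thesis by simp
qed simp

text \<open>Subtract f(x), which the kernel reproduces, and split at distance \<delta> from x.
  Outside, 1 / sin (\<pi>(y-x)) is bounded, so the integrand is an integrable \<open>w1\<close>
  times the sine. Inside, the points x+u and x-u are folded together; their combined value divided
  by u is integrable by the Dini condition, hence so is \<open>w2\<close>. Both sine integrals tend
  to 0 by the Riemann-Lebesgue lemma.\<close>

lemma Dini_Fourier_convergence:
  fixes f :: "real \<Rightarrow> real"
  assumes f: "f absolutely_integrable_on {0..1}" and x: "0 < x" "x < 1" and d0: "\<delta>0 > 0"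
    and dini: "(\<lambda>u. \<bar>f (x + u) + f (x - u) - 2 * f x\<bar> / u) integrable_on {0..\<delta>0}"
  shows "symsum (\<lambda>l. fcoeff f l * cis (2 * pi * real_of_int l * x)) \<longlonglongrightarrow> complex_of_real (f x)"
proof -
  \<comment> \<open>The minimum with x and 1-x keeps [x-\<delta>, x+\<delta>] inside [0,1] and also
    forces |y-x| \<le> 1-\<delta> for y in [0,1]; 1/3 is the range of
    \<open>sin_pi_lower_bound\<close>.\<close>
  define \<delta> where "\<delta> = min \<delta>0 (min x (min (1 - x) (1/3)))"
  have d: "0 < \<delta>" "\<delta> \<le> \<delta>0" "\<delta> \<le> x" "\<delta> \<le> 1 - x" "\<delta> \<le> 1/3"
    using x d0 by (auto simp: \<delta>_def min_def)
  define g where "g y = f y - f x" for y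
  define k where "k u = g (x + u) + g (x - u)" for u
  have g: "g absolutely_integrable_on {0..1}" unfolding g_def
    by (intro set_integral_diff(1) f absolutely_integrable_continuous_real continuous_intros)
  have shift: "(\<lambda>y. h (x + y)) absolutely_integrable_on {a-x..b-x}"
    if "h absolutely_integrable_on {a..b}" for h :: "real \<Rightarrow> real" and a b
    using that integrable_shift_real_ivl_iff[of h x a b] integrable_shift_real_ivl_iff[of "\<lambda>x. norm (h x)" x a b]
    by (simp add: absolutely_integrable_on_def add.commute)
  have ga: "(\<lambda>u. g (x + u)) absolutely_integrable_on {-\<delta>..\<delta>}"
    using shift[where h = g and a = "x-\<delta>" and b = "x+\<delta>"] absolutely_integrable_on_subinterval[OF g, of "x-\<delta>" "x+\<delta>"] d x by simp
  have gp: "(\<lambda>u. g (x + u)) absolutely_integrable_on {0..\<delta>}"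
    using absolutely_integrable_on_subinterval[OF ga] d by simp
  have gm: "(\<lambda>u. g (x - u)) absolutely_integrable_on {0..\<delta>}"
  proof -
    have "(\<lambda>u. g (x + u)) absolutely_integrable_on {-\<delta>..-0}"
      using absolutely_integrable_on_subinterval[OF ga] d by simp
    then show ?thesis
      using absolutely_integrable_reflect_real[where f = "\<lambda>u. g (x - u)" and a = 0 and b = \<delta>] by simp
  qed
  have k: "k absolutely_integrable_on {0..\<delta>}"
    unfolding k_def using gp gm by (intro set_integral_add(1))
  \<comment> \<open>\<open>k\<close> is the second difference of the Dini condition, so that
    condition supplies the majorant. At u = 0 both quotients are 0, because division by zero gives
    0.\<close>
  have ku: "(\<lambda>u. k u / u) absolutely_integrable_on {0..\<delta>}"
  proof (rule measurable_bounded_by_integrable_imp_absolutely_integrable)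
    have "k \<in> borel_measurable (lebesgue_on {0..\<delta>})" using k absolutely_integrable_measurable[of "{0..\<delta>}" k] by simp
    moreover have "(\<lambda>u::real. u) \<in> borel_measurable (lebesgue_on {0..\<delta>})"
      by (intro continuous_imp_measurable_on_sets_lebesgue continuous_intros) auto
    ultimately show "(\<lambda>u. k u / u) \<in> borel_measurable (lebesgue_on {0..\<delta>})" by measurable
    show "(\<lambda>u. \<bar>f (x + u) + f (x - u) - 2 * f x\<bar> / u) integrable_on {0..\<delta>}"
      using d by (intro integrable_on_subinterval[OF dini]) auto
    show "norm (k u / u) \<le> \<bar>f (x + u) + f (x - u) - 2 * f x\<bar> / u" if "u \<in> {0..\<delta>}" for u
      using that by (simp add: k_def g_def algebra_simps)
  qed auto
  define w1 where "w1 y = (if \<bar>y - x\<bar> < \<delta> then 0 else 1 / sin (pi * (y - x))) * g y" for y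
  \<comment> \<open>Extension by 0 turns the inner part into an integral over [0,1] again, to which
    the Riemann-Lebesgue lemma applies with shift 0.\<close>
  define w2 where "w2 u = (if u \<in> {0..\<delta>} then k u / sin (pi * u) else 0)" for u
  have sin_pos: "sin (pi * \<delta>) > 0" using d by (intro sin_gt_zero) auto
  \<comment> \<open>The distance v lies in [\<delta>, 1-\<delta>]. On this interval sin (\<pi>v) is
    symmetric about 1/2 and increasing up to there, so its minimum is attained at the ends.\<close>
  have sin_ge: "\<bar>sin (pi * (y - x))\<bar> \<ge> sin (pi * \<delta>)" if "y \<in> {0..1}" "\<not> \<bar>y - x\<bar> < \<delta>" for y
  proof -
    define v where "v = \<bar>y - x\<bar>"
    have v: "\<delta> \<le> v" "v \<le> 1 - \<delta>" using that d by (auto simp: v_def)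
    have "sin (pi * \<delta>) \<le> sin (pi * v)"
    proof (cases "v \<le> 1/2")
      case True
      have "0 \<le> pi * \<delta>" "pi * \<delta> \<le> pi * v" "pi * v \<le> pi * (1/2)"
        using True v d by (auto intro!: mult_left_mono simp del: times_divide_eq_right)
      then show ?thesis using pi_gt_zero by (intro sin_monotone_2pi_le) linarith+
    next
      case False
      have "sin (pi * \<delta>) \<le> sin (pi * (1 - v))"
      proof (intro sin_monotone_2pi_le)
        have "0 \<le> pi * \<delta>" "pi * (1 - v) \<le> pi * (1/2)"
          using False d by (auto intro!: mult_left_mono simp del: times_divide_eq_right)
        then show "- (pi / 2) \<le> pi * \<delta>" "pi * (1 - v) \<le> pi / 2" using pi_gt_zero by linarith+
        show "pi * \<delta> \<le> pi * (1 - v)" using v by (intro mult_left_mono) auto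
      qed
      then show ?thesis by (simp add: right_diff_distrib)
    qed
    also have "\<dots> \<le> \<bar>sin (pi * v)\<bar>" by simp
    also have "\<dots> = \<bar>sin (pi * (y - x))\<bar>"
    proof -
      have "sin (pi * (x - y)) = - sin (pi * (y - x))"
        by (metis minus_diff_eq mult_minus_right sin_minus)
      then show ?thesis by (auto simp: v_def abs_if[of "y - x"])
    qed
    finally show ?thesis .
  qed
  have w1: "w1 absolutely_integrable_on {0..1}"
    unfolding w1_def
  proof (rule absolutely_integrable_bounded_measurable_product_real[OF _ _ _ g])
    have "(\<lambda>y. if \<bar>y - x\<bar> < \<delta> then 0 else 1 / sin (pi * (y - x))) \<in> borel_measurable borel"
      by measurable
    then show "(\<lambda>y. if \<bar>y - x\<bar> < \<delta> then 0 else 1 / sin (pi * (y - x))) \<in> borel_measurable (lebesgue_on {0..1})"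
      by (intro measurable_restrict_space1 measurable_completion) simp
    show "bounded ((\<lambda>y. if \<bar>y - x\<bar> < \<delta> then 0 else 1 / sin (pi * (y - x))) ` {0..1})"
      unfolding bounded_iff
    proof (intro exI[of _ "1 / sin (pi * \<delta>)"] ballI)
      fix z assume "z \<in> (\<lambda>y. if \<bar>y - x\<bar> < \<delta> then 0 else 1 / sin (pi * (y - x))) ` {0..1}"
      then obtain y where y: "y \<in> {0..1}" "z = (if \<bar>y - x\<bar> < \<delta> then 0 else 1 / sin (pi * (y - x)))" by auto
      show "norm z \<le> 1 / sin (pi * \<delta>)"
      proof (cases "\<bar>y - x\<bar> < \<delta>")
        case True
        then show ?thesis using y sin_pos by simp
      next
        case False
        then show ?thesis using y sin_pos sin_ge[OF y(1) False] by (auto intro!: frac_le)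
      qed
    qed
  qed simp
  have w2': "(\<lambda>u. u / sin (pi * u) * (k u / u)) absolutely_integrable_on {0..\<delta>}"
  proof (rule absolutely_integrable_bounded_measurable_product_real[OF _ _ _ ku])
    have "(\<lambda>u. u / sin (pi * u)) \<in> borel_measurable borel" by measurable
    then show "(\<lambda>u. u / sin (pi * u)) \<in> borel_measurable (lebesgue_on {0..\<delta>})"
      by (intro measurable_restrict_space1 measurable_completion) simp
    show "bounded ((\<lambda>u. u / sin (pi * u)) ` {0..\<delta>})"
      unfolding bounded_iff
    proof (intro exI[of _ 1] ballI)
      fix z assume "z \<in> (\<lambda>u. u / sin (pi * u)) ` {0..\<delta>}"
      then obtain u where u: "0 \<le> u" "u \<le> 1/3" "z = u / sin (pi * u)" using d by auto
      then show "norm z \<le> 1" using sin_pi_lower_bound[of u] by (auto simp: divide_le_eq_1)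
    qed
  qed simp
  have k0: "k 0 = 0" by (simp add: k_def g_def)
  have w2: "w2 absolutely_integrable_on {0..1}"
  proof -
    have "w2 absolutely_integrable_on {0..\<delta>}"
      using w2' by (rule set_integrable_cong[THEN iffD1, rotated -1]) (auto simp: w2_def k0)
    then have "(\<lambda>u. if u \<in> {0..\<delta>} then w2 u else 0) absolutely_integrable_on UNIV"
      by (simp only: absolutely_integrable_restrict_UNIV)
    then have "w2 absolutely_integrable_on UNIV"
      by (rule set_integrable_cong[THEN iffD1, rotated -1]) (auto simp: w2_def)
    then show ?thesis by (rule set_integrable_subset) auto
  qed
  let ?D = "Dirichlet_kernel"
  have main: "integral {0..1} (\<lambda>y. f y * ?D N (y - x)) = f x
     + integral {0..1} (\<lambda>y. w1 y * sin ((2 * real N + 1) * pi * (y - x)))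
     + integral {0..1} (\<lambda>u. w2 u * sin ((2 * real N + 1) * pi * (u - 0)))" for N
  proof -
    have cD: "continuous_on A (\<lambda>y. ?D N (y - x))" "continuous_on A (?D N)" for A
      by (intro continuous_on_Dirichlet_kernel continuous_intros)+
    have iD: "(\<lambda>y. f x * ?D N (y - x)) integrable_on {0..1}"
      by (intro integrable_continuous_real continuous_intros cD)
    have "(\<lambda>y. ?D N (y - x) * g y) absolutely_integrable_on {0..1}"
      by (intro absolutely_integrable_continuous_mult cD g)
    then have igD: "(\<lambda>y. g y * ?D N (y - x)) absolutely_integrable_on {0..1}" by (simp add: mult.commute)
    have "(\<lambda>y. sin ((2 * real N + 1) * pi * (y - x)) * w1 y) absolutely_integrable_on {0..1}"
      by (intro absolutely_integrable_continuous_mult w1 continuous_intros)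
    then have iw1: "(\<lambda>y. w1 y * sin ((2 * real N + 1) * pi * (y - x))) integrable_on {0..1}"
      by (simp add: mult.commute absolutely_integrable_on_imp_integrable_on)
    have "integral {0..1} (\<lambda>y. f y * ?D N (y - x)) = integral {0..1} (\<lambda>y. f x * ?D N (y - x) + g y * ?D N (y - x))"
      by (simp add: g_def algebra_simps)
    also have "\<dots> = f x + integral {0..1} (\<lambda>y. g y * ?D N (y - x))"
      using iD igD by (subst integral_add) (auto simp: absolutely_integrable_on_imp_integrable_on integral_Dirichlet_kernel)
    also have "integral {0..1} (\<lambda>y. g y * ?D N (y - x)) =
       integral {0..1} (\<lambda>y. w1 y * sin ((2 * real N + 1) * pi * (y - x)) + (if y \<in> {x-\<delta><..<x+\<delta>} then g y * ?D N (y - x) else 0))"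
    proof (rule integral_cong)
      fix y :: real assume y: "y \<in> {0..1}"
      show "g y * ?D N (y - x) = w1 y * sin ((2 * real N + 1) * pi * (y - x)) + (if y \<in> {x-\<delta><..<x+\<delta>} then g y * ?D N (y - x) else 0)"
      proof (cases "\<bar>y - x\<bar> < \<delta>")
        case True
        then show ?thesis by (auto simp: w1_def abs_if split: if_splits)
      next
        case False
        then have "sin (pi * (y - x)) \<noteq> 0" using sin_ge[OF y] sin_pos by force
        then have "g y * ?D N (y - x) = w1 y * (sin (pi * (y - x)) * ?D N (y - x))"
          using False by (simp add: w1_def)
        then show ?thesis using False unfolding Dirichlet_kernel_sin by auto
      qed
    qed
    also have "\<dots> = integral {0..1} (\<lambda>y. w1 y * sin ((2 * real N + 1) * pi * (y - x)))
        + integral {0..1} (\<lambda>y. if y \<in> {x-\<delta><..<x+\<delta>} then g y * ?D N (y - x) else 0)"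
    proof (rule integral_add[OF iw1])
      have "(\<lambda>y. g y * ?D N (y - x)) integrable_on {x-\<delta><..<x+\<delta>}"
        unfolding integrable_on_open_interval_real
        using d by (intro integrable_on_subinterval[OF absolutely_integrable_on_imp_integrable_on[OF igD]]) auto
      moreover have "{x-\<delta><..<x+\<delta>} \<inter> {0..1} = {x-\<delta><..<x+\<delta>}" using d by auto
      ultimately show "(\<lambda>y. if y \<in> {x-\<delta><..<x+\<delta>} then g y * ?D N (y - x) else 0) integrable_on {0..1}"
        by (simp only: integrable_restrict_Int)
    qed
    also have "integral {0..1} (\<lambda>y. if y \<in> {x-\<delta><..<x+\<delta>} then g y * ?D N (y - x) else 0)
        = integral {x-\<delta>..x+\<delta>} (\<lambda>y. g y * ?D N (y - x))"
    proof -
      have "{x-\<delta><..<x+\<delta>} \<inter> {0..1} = {x-\<delta><..<x+\<delta>}" using d by auto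
      then show ?thesis by (simp only: integral_restrict_Int integral_open_interval_real)
    qed
    also have "\<dots> = integral {-\<delta>..\<delta>} (\<lambda>u. g (x + u) * ?D N u)"
      using integral_shift_real_ivl[of "x-\<delta>" x "x+\<delta>" "\<lambda>y. g y * ?D N (y - x)"] by (simp add: add.commute)
    also have "\<dots> = integral {-\<delta>..0} (\<lambda>u. g (x + u) * ?D N u) + integral {0..\<delta>} (\<lambda>u. g (x + u) * ?D N u)"
    proof (rule Henstock_Kurzweil_Integration.integral_combine[symmetric])
      have "(\<lambda>u. ?D N u * g (x + u)) absolutely_integrable_on {-\<delta>..\<delta>}"
        by (intro absolutely_integrable_continuous_mult cD ga)
      then show "(\<lambda>u. g (x + u) * ?D N u) integrable_on {-\<delta>..\<delta>}"
        by (simp add: mult.commute absolutely_integrable_on_imp_integrable_on)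
    qed (use d in auto)
    \<comment> \<open>Reflection u to -u; the kernel is even, so both halves carry the same factor
      and can be added.\<close>
    also have "integral {-\<delta>..0} (\<lambda>u. g (x + u) * ?D N u) = integral {0..\<delta>} (\<lambda>u. g (x - u) * ?D N u)"
      using Henstock_Kurzweil_Integration.integral_reflect_real[of \<delta> 0 "\<lambda>u. g (x - u) * ?D N u"] by (simp add: Dirichlet_kernel_minus)
    also have "integral {0..\<delta>} (\<lambda>u. g (x - u) * ?D N u) + integral {0..\<delta>} (\<lambda>u. g (x + u) * ?D N u)
       = integral {0..\<delta>} (\<lambda>u. g (x - u) * ?D N u + g (x + u) * ?D N u)"
    proof (rule integral_add[symmetric])
      have "(\<lambda>u. ?D N u * g (x - u)) integrable_on {0..\<delta>}" "(\<lambda>u. ?D N u * g (x + u)) integrable_on {0..\<delta>}"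
        by (intro absolutely_integrable_on_imp_integrable_on absolutely_integrable_continuous_mult cD gp gm)+
      then show "(\<lambda>u. g (x - u) * ?D N u) integrable_on {0..\<delta>}" "(\<lambda>u. g (x + u) * ?D N u) integrable_on {0..\<delta>}"
        by (simp_all add: mult.commute)
    qed
    also have "\<dots> = integral {0..\<delta>} (\<lambda>u. w2 u * sin ((2 * real N + 1) * pi * (u - 0)))"
    proof (rule integral_cong)
      fix u assume u: "u \<in> {0..\<delta>}"
      show "g (x - u) * ?D N u + g (x + u) * ?D N u = w2 u * sin ((2 * real N + 1) * pi * (u - 0))"
      proof (cases "u = 0")
        case True
        then show ?thesis by (simp add: g_def)
      next
        case False
        then have "sin (pi * u) > 0" using sin_pi_lower_bound[of u] u d by auto
        then have "k u * ?D N u = w2 u * (sin (pi * u) * ?D N u)" using u by (simp add: w2_def)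
        then show ?thesis unfolding Dirichlet_kernel_sin by (simp add: k_def algebra_simps)
      qed
    qed
    also have "\<dots> = integral {0..1} (\<lambda>u. w2 u * sin ((2 * real N + 1) * pi * (u - 0)))"
    proof -
      have "integral {0..1} (\<lambda>u. w2 u * sin ((2 * real N + 1) * pi * (u - 0)))
         = integral {0..1} (\<lambda>u. if u \<in> {0..\<delta>} then w2 u * sin ((2 * real N + 1) * pi * (u - 0)) else 0)"
        by (rule integral_cong) (simp add: w2_def)
      also have "\<dots> = integral ({0..\<delta>} \<inter> {0..1}) (\<lambda>u. w2 u * sin ((2 * real N + 1) * pi * (u - 0)))"
        by (rule integral_restrict_Int)
      also have "{0..\<delta>} \<inter> {0..1} = {0..\<delta>}" using d by auto
      finally show ?thesis by simp
    qed
    finally show ?thesis by simp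
  qed
  have "(\<lambda>N. f x + integral {0..1} (\<lambda>y. w1 y * sin ((2 * real N + 1) * pi * (y - x)))
     + integral {0..1} (\<lambda>u. w2 u * sin ((2 * real N + 1) * pi * (u - 0)))) \<longlonglongrightarrow> f x + 0 + 0"
    by (intro tendsto_intros Riemann_Lebesgue_sin w1 w2)
  then have "(\<lambda>N. complex_of_real (integral {0..1} (\<lambda>y. f y * ?D N (y - x)))) \<longlonglongrightarrow> complex_of_real (f x)"
    unfolding main by (intro tendsto_of_real) simp
  moreover have "symsum (\<lambda>l. fcoeff f l * cis (2 * pi * real_of_int l * x))
      = (\<lambda>N. complex_of_real (integral {0..1} (\<lambda>y. f y * ?D N (y - x))))"
    by (rule ext) (rule Fourier_partial_sum[OF f])
  ultimately show ?thesis by simp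
qed

section \<open>Dirichlet series\<close>

text \<open>\<open>npow s x\<close> is \<open>x\<close> to the power \<open>-s\<close>; it is only meant for \<open>x > 0\<close>, since \<open>ln 0 = 0\<close> makes
  \<open>npow s 0 = 1\<close>.\<close>

definition npow :: "complex \<Rightarrow> real \<Rightarrow> complex" where
  "npow s x = exp (- (s * of_real (ln x)))"

lemma npow_1 [simp]: "npow s 1 = 1"
  by (simp add: npow_def)

lemma npow_mult: "x > 0 \<Longrightarrow> y > 0 \<Longrightarrow> npow s (x * y) = npow s x * npow s y"
  by (simp add: npow_def ln_mult exp_add[symmetric] algebra_simps)

lemma norm_npow: "x > 0 \<Longrightarrow> norm (npow s x) = x powr (- Re s)"
  by (simp add: npow_def powr_def)

lemma npow_divide: "x > 0 \<Longrightarrow> npow s x / of_real x = npow (s + 1) x"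
proof -
  assume "x > 0"
  then have "complex_of_real x = exp (of_real (ln x))" by (simp add: exp_of_real)
  then have "npow s x / of_real x = exp (- (s * of_real (ln x)) - of_real (ln x))"
    by (simp add: npow_def exp_diff)
  also have "- (s * of_real (ln x)) - of_real (ln x) = - ((s + 1) * complex_of_real (ln x))"
    by (simp add: algebra_simps)
  finally show ?thesis by (simp only: npow_def)
qed

lemma npow_has_vector_derivative:
  assumes "x > 0"
  shows "(npow s has_vector_derivative (- s * npow (s + 1) x)) (at x within A)"
proof -
  have "((\<lambda>x. - (s * of_real (ln x))) has_vector_derivative (- (s * of_real (1 / x)))) (at x within A)"
    using assms by (auto intro!: derivative_eq_intros has_vector_derivative_of_real
        simp: has_real_derivative_iff_has_vector_derivative[symmetric])
  then have "((exp \<circ> (\<lambda>x. - (s * of_real (ln x)))) has_vector_derivative (- (s * of_real (1 / x))) * exp (- (s * of_real (ln x)))) (at x within A)"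
    by (rule field_vector_diff_chain_within) (rule has_field_derivative_at_within[OF DERIV_exp])
  moreover have "(exp \<circ> (\<lambda>x. - (s * complex_of_real (ln x)))) = npow s" by (auto simp: npow_def)
  moreover have "(- (s * of_real (1 / x))) * exp (- (s * of_real (ln x))) = - s * npow (s + 1) x"
    unfolding npow_divide[OF assms, of s, symmetric] by (simp add: npow_def)
  ultimately show ?thesis by simp
qed

text \<open>With B an antiderivative of F, this compares one summand with the integral of F over the
  following unit interval; there F stays within c of F(a), by integrating F'.\<close>

lemma euler_maclaurin_step:
  fixes B F F' :: "real \<Rightarrow> complex"
  assumes B: "\<And>x. x \<in> {a..a+1} \<Longrightarrow> (B has_vector_derivative F x) (at x within {a..a+1})"
    and F: "\<And>x. x \<in> {a..a+1} \<Longrightarrow> (F has_vector_derivative F' x) (at x within {a..a+1})"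
    and c: "\<And>x. x \<in> {a..a+1} \<Longrightarrow> norm (F' x) \<le> c"
  shows "norm (F a - (B (a + 1) - B a)) \<le> c"
proof -
  have c0: "c \<ge> 0" using c[of a] norm_ge_zero[of "F' a"] by (meson atLeastAtMost_iff le_add_same_cancel1 order_refl order_trans zero_le_one)
  have Fd: "norm (F x - F a) \<le> c" if x: "x \<in> {a..a+1}" for x
  proof -
    have "(F' has_integral (F x - F a)) {a..x}"
      using x by (intro fundamental_theorem_of_calculus has_vector_derivative_within_subset[OF F]) auto
    then have "norm (F x - F a) \<le> c * measure lborel {a..x}"
      using x c c0 by (intro has_integral_bound_real) auto
    also have "\<dots> \<le> c" using x c0 by (auto intro: mult_left_le)
    finally show ?thesis .
  qed
  have "(F has_integral (B (a + 1) - B a)) {a..a+1}"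
    by (intro fundamental_theorem_of_calculus B) auto
  moreover have "((\<lambda>_. F a) has_integral F a) {a..a+1}"
    using has_integral_const_real[of "F a" a "a + 1"] by simp
  ultimately have "((\<lambda>x. F x - F a) has_integral (B (a + 1) - B a - F a)) {a..a+1}"
    by (rule has_integral_diff)
  then have "norm (B (a + 1) - B a - F a) \<le> c * measure lborel {a..a+1}"
    using Fd c0 by (intro has_integral_bound_real) auto
  then show ?thesis by (simp add: norm_minus_commute)
qed

text \<open>With \<open>a\<close> and \<open>b\<close> the two square roots, 1/a - 1/b = 1/(a b
  (a+b)) since b^2 - a^2 = 1. The factor 4 comes from ab \<le> 2a^2 and b^2 \<le> 2a^2.\<close>

lemma powr_three_halves_le_telescope:
  fixes n :: nat assumes "n \<ge> 1"
  shows "real n powr (-3/2) \<le> 4 * (1 / sqrt (real n) - 1 / sqrt (real (Suc n)))"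
proof -
  define a where "a = sqrt (real n)"
  define b where "b = sqrt (real (Suc n))"
  have a: "a > 0" "a^2 = real n" "a \<ge> 1" using assms by (auto simp: a_def)
  have b: "b > 0" "b^2 = a^2 + 1" using assms by (auto simp: a_def b_def)
  have b2a: "b \<le> 2 * a"
  proof (rule power2_le_imp_le)
    have "1 \<le> a^2" using a(3) by (rule one_le_power)
    then show "b^2 \<le> (2 * a)^2" using b by (simp add: power_mult_distrib)
  qed (use a in auto)
  have "1 \<le> a^2" using a(3) by (rule one_le_power)
  then have "b * (a + b) \<le> 4 * a^2"
  proof -
    have "a * b \<le> 2 * a^2" using mult_left_mono[OF b2a, of a] a(1) unfolding power2_eq_square by simp
    moreover have "b * (a + b) = a * b + b^2" by (simp add: power2_eq_square algebra_simps)
    ultimately show ?thesis using b \<open>1 \<le> a^2\<close> by linarith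
  qed
  then have "1 / a^3 \<le> 4 * (1 / (a * b * (a + b)))"
    using a b by (simp add: divide_simps power3_eq_cube power2_eq_square mult_ac)
  also have "1 / (a * b * (a + b)) = 1 / a - 1 / b"
  proof -
    have "(b - a) * (a + b) = 1" using b by (simp add: power2_eq_square algebra_simps)
    then have "1 / (a * b * (a + b)) = ((b - a) * (a + b)) / (a * b * (a + b))" by simp
    also have "\<dots> = (b - a) / (a * b)" using a(1) b(1) by simp
    also have "\<dots> = 1 / a - 1 / b" using a(1) b(1) by (simp add: diff_divide_distrib)
    finally show ?thesis .
  qed
  also have "1 / a^3 = real n powr (-3/2)"
  proof -
    have "a^3 = (real n powr (1/2)) powr 3" using assms by (simp add: a_def powr_half_sqrt powr_numeral)
    also have "\<dots> = real n powr (3/2)" by (simp add: powr_powr)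
    finally show ?thesis using assms by (simp add: powr_minus_divide)
  qed
  finally show ?thesis by (simp add: a_def b_def)
qed

text \<open>As B vanishes at infinity, -B(N) is the integral of F from N on, and the unit-interval
  errors are summed by the telescoping bound. The exponent -3/2, rather than -2, leaves room for the
  logarithm in the series of \<zeta>'.\<close>

lemma euler_maclaurin_tail:
  fixes B F F' :: "real \<Rightarrow> complex"
  assumes N: "N \<ge> 1"
    and B: "\<And>x A. x \<ge> 1 \<Longrightarrow> (B has_vector_derivative F x) (at x within A)"
    and F: "\<And>x A. x \<ge> 1 \<Longrightarrow> (F has_vector_derivative F' x) (at x within A)"
    and c: "\<And>x. x \<ge> 1 \<Longrightarrow> norm (F' x) \<le> C * x powr (-3/2)"
    and B0: "(\<lambda>n. B (real n)) \<longlonglongrightarrow> 0"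
    and sF: "summable (\<lambda>n. F (real (n + N)))"
  shows "norm ((\<Sum>n. F (real (n + N))) + B (real N)) \<le> 4 * C / sqrt (real N)"
proof -
  have "0 \<le> norm (F' 1)" by simp
  also have "\<dots> \<le> C" using c[of 1] by simp
  finally have C0: "C \<ge> 0" .
  define r where "r n = F (real (n + N)) - (B (real (Suc n + N)) - B (real (n + N)))" for n
  have rb: "norm (r n) \<le> C * (4 * (1 / sqrt (real (n + N)) - 1 / sqrt (real (Suc n + N))))" for n
  proof -
    have "norm (F (real (n + N)) - (B (real (n + N) + 1) - B (real (n + N)))) \<le> C * real (n + N) powr (-3/2)"
    proof (rule euler_maclaurin_step)
      fix x assume x: "x \<in> {real (n + N)..real (n + N) + 1}"
      then have x1: "x \<ge> 1" using N by auto
      show "(B has_vector_derivative F x) (at x within {real (n + N)..real (n + N) + 1})" by (rule B[OF x1])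
      show "(F has_vector_derivative F' x) (at x within {real (n + N)..real (n + N) + 1})" by (rule F[OF x1])
      have "norm (F' x) \<le> C * x powr (-3/2)" by (rule c[OF x1])
      also have "\<dots> \<le> C * real (n + N) powr (-3/2)"
        using x N C0 by (intro mult_left_mono powr_mono2') auto
      finally show "norm (F' x) \<le> C * real (n + N) powr (-3/2)" .
    qed
    also have "\<dots> \<le> C * (4 * (1 / sqrt (real (n + N)) - 1 / sqrt (real (Suc (n + N)))))"
      using N C0 by (intro mult_left_mono powr_three_halves_le_telescope) auto
    finally show ?thesis by (simp add: r_def add.commute)
  qed
  have tele: "(\<lambda>n. 1 / sqrt (real (n + N)) - 1 / sqrt (real (Suc n + N))) sums (1 / sqrt (real (0 + N)) - 0)"
  proof (rule telescope_sums')
    have "(\<lambda>n. 1 / sqrt (real n)) \<longlonglongrightarrow> 0" by real_asymp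
    then show "(\<lambda>n. 1 / sqrt (real (n + N))) \<longlonglongrightarrow> 0" by (rule LIMSEQ_ignore_initial_segment)
  qed
  then have tele2: "(\<lambda>n. C * (4 * (1 / sqrt (real (n + N)) - 1 / sqrt (real (Suc n + N))))) sums (C * (4 * (1 / sqrt (real N))))"
    by (intro sums_mult) simp
  have Bs: "(\<lambda>n. B (real (Suc n + N)) - B (real (n + N))) sums (0 - B (real (0 + N)))"
    by (rule telescope_sums) (rule LIMSEQ_ignore_initial_segment[OF B0])
  have "r sums ((\<Sum>n. F (real (n + N))) - (0 - B (real (0 + N))))"
    unfolding r_def by (intro sums_diff summable_sums sF Bs)
  then have "(\<Sum>n. F (real (n + N))) + B (real N) = suminf r" by (simp add: sums_iff)
  also have "norm \<dots> \<le> (\<Sum>n. C * (4 * (1 / sqrt (real (n + N)) - 1 / sqrt (real (Suc n + N)))))"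
  proof -
    have s2: "summable (\<lambda>n. C * (4 * (1 / sqrt (real (n + N)) - 1 / sqrt (real (Suc n + N)))))"
      using tele2 by (rule sums_summable)
    have s1: "summable (\<lambda>n. norm (r n))"
      by (rule summable_comparison_test'[OF s2, of 0]) (use rb in simp)
    show ?thesis by (rule order.trans[OF summable_norm[OF s1] suminf_le[OF rb s1 s2]])
  qed
  also have "\<dots> = 4 * C / sqrt (real N)" using tele2 by (simp add: sums_iff)
  finally show ?thesis .
qed


section \<open>Absolutely convergent Dirichlet series and their products\<close>

definition dser :: "(nat \<Rightarrow> real) \<Rightarrow> complex \<Rightarrow> complex" where
  "dser a s = (\<Sum>n. of_real (a (Suc n)) * npow s (real (Suc n)))"

lemma summable_log_powr:
  assumes "\<sigma> > 1"
  shows "summable (\<lambda>n. (1 + ln (real (Suc n))) * real (Suc n) powr (-\<sigma>))"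
proof -
  \<comment> \<open>Half of the excess of \<sigma> over 1 is spent on absorbing the logarithm; the
    other half keeps the exponent below -1.\<close>
  define \<epsilon> where "\<epsilon> = (\<sigma> - 1) / 2"
  have e: "\<epsilon> > 0" using assms by (simp add: \<epsilon>_def)
  have s: "summable (\<lambda>n. (1 + 1 / \<epsilon>) * real (Suc n) powr (\<epsilon> - \<sigma>))"
  proof (rule summable_mult)
    have "summable (\<lambda>n. real n powr (\<epsilon> - \<sigma>))"
      using assms unfolding summable_real_powr_iff by (simp add: \<epsilon>_def field_simps)
    then show "summable (\<lambda>n. real (Suc n) powr (\<epsilon> - \<sigma>))" by (subst summable_Suc_iff)
  qed
  show ?thesis
  proof (rule summable_comparison_test'[OF s, of 0])
    fix n :: nat
    have l: "ln (real (Suc n)) \<le> real (Suc n) powr \<epsilon> / \<epsilon>" using e by (intro ln_powr_bound) auto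
    have o: "1 \<le> real (Suc n) powr \<epsilon>" using e by (intro ge_one_powr_ge_zero) auto
    have "(1 + ln (real (Suc n))) * real (Suc n) powr (-\<sigma>)
        \<le> (real (Suc n) powr \<epsilon> + real (Suc n) powr \<epsilon> / \<epsilon>) * real (Suc n) powr (-\<sigma>)"
      using l o by (intro mult_right_mono add_mono) auto
    also have "\<dots> = (1 + 1 / \<epsilon>) * (real (Suc n) powr \<epsilon> * real (Suc n) powr (-\<sigma>))"
      by (simp add: algebra_simps)
    also have "real (Suc n) powr \<epsilon> * real (Suc n) powr (-\<sigma>) = real (Suc n) powr (\<epsilon> - \<sigma>)"
      by (simp add: powr_add[symmetric])
    finally show "norm ((1 + ln (real (Suc n))) * real (Suc n) powr (-\<sigma>)) \<le> (1 + 1 / \<epsilon>) * real (Suc n) powr (\<epsilon> - \<sigma>)"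
      by simp
  qed
qed

text \<open>The growth bound \<open>1 + ln n\<close> is a common majorant for the coefficient
  sequences 1, ln n, \<mu>(n) and \<mu>(n) ln n.\<close>

lemma dser_norm_summable:
  assumes s: "Re s > 1" and a: "\<And>n. n \<ge> 1 \<Longrightarrow> \<bar>a n\<bar> \<le> 1 + ln (real n)"
  shows "summable (\<lambda>n. norm (of_real (a (Suc n)) * npow s (real (Suc n))))"
proof (rule summable_comparison_test'[OF summable_log_powr[OF s], of 0])
  fix n :: nat
  show "norm (norm (of_real (a (Suc n)) * npow s (real (Suc n)))) \<le> (1 + ln (real (Suc n))) * real (Suc n) powr (- Re s)"
    using mult_right_mono[OF a[of "Suc n"], of "real (Suc n) powr (- Re s)"]
    by (simp add: norm_mult norm_npow)
qed

lemma dser_has_sum: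
  assumes s: "Re s > 1" and a: "\<And>n. n \<ge> 1 \<Longrightarrow> \<bar>a n\<bar> \<le> 1 + ln (real n)"
  shows "((\<lambda>n. of_real (a n) * npow s (real n)) has_sum dser a s) {1..}"
proof -
  have "((\<lambda>n. of_real (a (Suc n)) * npow s (real (Suc n))) has_sum dser a s) UNIV"
    unfolding dser_def
    by (rule norm_summable_imp_has_sum[OF _ summable_sums[OF summable_norm_cancel]]) (rule dser_norm_summable[OF assms], assumption)+
  moreover have "bij_betw Suc UNIV {1..}"
    by (rule bij_betwI[of _ _ _ "\<lambda>n. n - 1"]) auto
  ultimately show ?thesis
    using has_sum_reindex_bij_betw[of Suc UNIV "{1..}" "\<lambda>n. of_real (a n) * npow s (real n)"] by simp
qed

lemma dser_abs_summable_on: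
  assumes s: "Re s > 1" and a: "\<And>n. n \<ge> 1 \<Longrightarrow> \<bar>a n\<bar> \<le> 1 + ln (real n)"
  shows "(\<lambda>n. norm (of_real (a n) * npow s (real n) :: complex)) summable_on {1..}"
proof -
  have "((\<lambda>n. norm (of_real (a (Suc n)) * npow s (real (Suc n)))) summable_on UNIV)"
    using dser_norm_summable[OF assms] by (intro norm_summable_imp_summable_on) simp
  moreover have "bij_betw Suc UNIV {1..}"
    by (rule bij_betwI[of _ _ _ "\<lambda>n. n - 1"]) auto
  ultimately show ?thesis
    using summable_on_reindex_bij_betw[of Suc UNIV "{1..}" "\<lambda>n. norm (of_real (a n) * npow s (real n))"] by simp
qed

text \<open>The double series is absolutely summable over all pairs (n,m), so it may be regrouped by
  the product k = n m. The result is stated by \<open>has_sum\<close> and not through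
  \<open>dser\<close>, because a convolution may violate the growth bound: for 1 * 1 it is the
  divisor function.\<close>

lemma dser_mult:
  assumes s: "Re s > 1" and a: "\<And>n. n \<ge> 1 \<Longrightarrow> \<bar>a n\<bar> \<le> 1 + ln (real n)"
    and b: "\<And>n. n \<ge> 1 \<Longrightarrow> \<bar>b n\<bar> \<le> 1 + ln (real n)"
  shows "((\<lambda>k. of_real (\<Sum>d | d dvd k. a d * b (k div d)) * npow s (real k)) has_sum (dser a s * dser b s)) {1..}"
proof -
  let ?A = "\<lambda>n. of_real (a n) * npow s (real n)" and ?B = "\<lambda>n. of_real (b n) * npow s (real n)"
  have "(\<lambda>x. norm (case x of (n,m) \<Rightarrow> ?A n * ?B m)) summable_on ({1..} \<times> {1..})"
  proof (subst Infinite_Sum.abs_summable_on_Sigma_iff, intro conjI ballI)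
    show "(\<lambda>m. norm (case (n, m) of (n,m) \<Rightarrow> ?A n * ?B m)) summable_on {1..}" for n
      using summable_on_cmult_right[OF dser_abs_summable_on[OF s b], of "norm (?A n)"] by (simp add: norm_mult)
    have "(\<lambda>n. norm (?A n) * (\<Sum>\<^sub>\<infinity>m\<in>{1..}. norm (?B m))) summable_on {1..}"
      by (rule summable_on_cmult_left[OF dser_abs_summable_on[OF s a]])
    then show "(\<lambda>n. norm (\<Sum>\<^sub>\<infinity>m\<in>{1..}. norm (case (n, m) of (n,m) \<Rightarrow> ?A n * ?B m))) summable_on {1..}"
      by (simp add: norm_mult infsum_cmult_right' abs_mult infsum_nonneg)
  qed
  then have sm: "(\<lambda>(n,m). ?A n * ?B m) summable_on ({1..} \<times> {1..})" by (rule abs_summable_summable)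
  have prod: "((\<lambda>(n,m). ?A n * ?B m) has_sum (dser a s * dser b s)) ({1..} \<times> {1..})"
  proof -
    have "infsum (\<lambda>(n,m). ?A n * ?B m) ({1..} \<times> {1..}) = (\<Sum>\<^sub>\<infinity>n\<in>{1..}. \<Sum>\<^sub>\<infinity>m\<in>{1..}. ?A n * ?B m)"
      using infsum_Sigma'_banach[OF sm] by simp
    also have "\<dots> = (\<Sum>\<^sub>\<infinity>n\<in>{1..}. ?A n * dser b s)"
      using infsumI[OF dser_has_sum[OF s b]] by (simp add: infsum_cmult_right')
    also have "\<dots> = dser a s * dser b s"
      using infsumI[OF dser_has_sum[OF s a]] by (simp add: infsum_cmult_left')
    finally show ?thesis using has_sum_infsum[OF sm] by simp
  qed
  let ?S = "SIGMA k:{1::nat..}. {d. d dvd k}"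
  have "bij_betw (\<lambda>(k,d). (d, k div d)) ?S ({1..} \<times> {1::nat..})"
  proof (rule bij_betwI[where g = "\<lambda>(n,m). (n * m, n)"])
    show "(\<lambda>(k,d). (d, k div d)) \<in> ?S \<rightarrow> {1..} \<times> {1..}"
      by (auto simp: Suc_le_eq div_greater_zero_iff dvd_imp_le intro!: Nat.gr0I)
  qed (auto simp: Suc_le_eq)
  from has_sum_reindex_bij_betw[OF this, of "\<lambda>(n,m). ?A n * ?B m" "dser a s * dser b s"] prod
  have "((\<lambda>x. case (case x of (k,d) \<Rightarrow> (d, k div d)) of (n,m) \<Rightarrow> ?A n * ?B m) has_sum (dser a s * dser b s)) ?S" by simp
  then have "((\<lambda>(k,d). ?A d * ?B (k div d)) has_sum (dser a s * dser b s)) ?S"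
    by (simp add: case_prod_unfold)
  moreover have "((\<lambda>d. case (k,d) of (k,d) \<Rightarrow> ?A d * ?B (k div d)) has_sum
      (of_real (\<Sum>d | d dvd k. a d * b (k div d)) * npow s (real k))) {d. d dvd k}" if k: "k \<in> {1..}" for k
  proof -
    have "(\<Sum>d | d dvd k. ?A d * ?B (k div d)) = (\<Sum>d | d dvd k. of_real (a d * b (k div d)) * npow s (real k))"
    proof (rule sum.cong)
      fix d assume "d \<in> {d. d dvd k}"
      then obtain e where e: "k = d * e" by auto
      then have "d > 0" "e > 0" using k by auto
      then show "?A d * ?B (k div d) = of_real (a d * b (k div d)) * npow s (real k)"
        using e by (simp add: npow_mult)
    qed simp
    also have "\<dots> = of_real (\<Sum>d | d dvd k. a d * b (k div d)) * npow s (real k)"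
      by (simp add: sum_distrib_right)
    finally show ?thesis using has_sum_finite[of "{d. d dvd k}" "\<lambda>d. ?A d * ?B (k div d)"] k by simp
  qed
  ultimately show ?thesis by (rule has_sum_Sigma')
qed

lemma has_sum_single_1:
  assumes "(g has_sum S) {1..}" "\<And>k. k \<ge> 2 \<Longrightarrow> g k = (0::complex)"
  shows "S = g (1::nat)"
proof -
  have "(g has_sum S) {1}"
    using assms(1) by (rule has_sum_cong_neutral[THEN iffD1, rotated -1]) (use assms(2) in auto)
  moreover have "(g has_sum g 1) {1}" using has_sum_finite[of "{1}" g] by simp
  ultimately show ?thesis by (rule has_sum_unique)
qed

text \<open>These are \<open>\<zeta>\<close>, \<open>-\<zeta>'\<close>, \<open>1/\<zeta>\<close> and \<open>-(1/\<zeta>)'\<close> on the half-plane \<open>Re s > 1\<close>.\<close>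

abbreviation dzeta :: "complex \<Rightarrow> complex" where
  "dzeta \<equiv> dser (\<lambda>_. 1)"

abbreviation dzeta_ln :: "complex \<Rightarrow> complex" where
  "dzeta_ln \<equiv> dser (\<lambda>n. ln (real n))"

abbreviation dmoebius :: "complex \<Rightarrow> complex" where
  "dmoebius \<equiv> dser (\<lambda>n. real_of_int (moebius n))"

abbreviation dmoebius_ln :: "complex \<Rightarrow> complex" where
  "dmoebius_ln \<equiv> dser (\<lambda>n. real_of_int (moebius n) * ln (real n))"

lemma coefficient_bounds:
  assumes "n \<ge> 1"
  shows "\<bar>1::real\<bar> \<le> 1 + ln (real n)" "\<bar>ln (real n)\<bar> \<le> 1 + ln (real n)"
    "\<bar>real_of_int (moebius n)\<bar> \<le> 1 + ln (real n)" "\<bar>real_of_int (moebius n) * ln (real n)\<bar> \<le> 1 + ln (real n)"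
proof -
  have l: "ln (real n) \<ge> 0" using assms by simp
  have m: "\<bar>real_of_int (moebius n)\<bar> \<le> 1" using abs_moebius_le_1[of n] by linarith
  show "\<bar>1::real\<bar> \<le> 1 + ln (real n)" "\<bar>ln (real n)\<bar> \<le> 1 + ln (real n)"
    "\<bar>real_of_int (moebius n)\<bar> \<le> 1 + ln (real n)" using l m by auto
  have "\<bar>real_of_int (moebius n) * ln (real n)\<bar> \<le> 1 * ln (real n)"
    unfolding abs_mult using l m by (intro mult_mono) auto
  then show "\<bar>real_of_int (moebius n) * ln (real n)\<bar> \<le> 1 + ln (real n)" by simp
qed

lemma dmoebius_dzeta:
  assumes s: "Re s > 1"
  shows "dmoebius s * dzeta s = 1"
proof -
  have m: "(\<Sum>d | d dvd k. real_of_int (moebius d) * 1) = (if k = 1 then 1 else 0)" if "k \<ge> 1" for k :: nat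
  proof -
    have "(\<Sum>d | d dvd k. real_of_int (moebius d) * 1) = real_of_int (\<Sum>d | d dvd k. moebius d)" by simp
    then show ?thesis using sum_moebius_divisors[of k] that by simp
  qed
  have "dmoebius s * dzeta s = of_real (\<Sum>d | d dvd (1::nat). real_of_int (moebius d) * 1) * npow s (real (1::nat))"
    by (rule has_sum_single_1[OF dser_mult[OF s coefficient_bounds(3) coefficient_bounds(1)]]) (use m in auto)
  then show ?thesis using m[of 1] by simp
qed

text \<open>This is (1/\<zeta>)' = -\<zeta>'/\<zeta>^2, obtained from coefficients. As ln d + ln
  (k/d) = ln k, the product rule for the convolution of \<mu> and 1 gives ln k times the divisor sum
  of \<mu>, which is 0 for every k, including k = 1.\<close>

lemma dmoebius_ln_eq:
  assumes s: "Re s > 1"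
  shows "dmoebius_ln s = - dzeta_ln s * (dmoebius s)\<^sup>2"
proof -
  let ?g = "\<lambda>k::nat. of_real (\<Sum>d | d dvd k. real_of_int (moebius d) * ln (real d) * 1) * npow s (real k)
    + of_real (\<Sum>d | d dvd k. real_of_int (moebius d) * ln (real (k div d))) * npow s (real k)"
  have g0: "?g k = 0" if k: "k \<ge> 1" for k
  proof -
    have "(\<Sum>d | d dvd k. real_of_int (moebius d) * ln (real d) * 1) + (\<Sum>d | d dvd k. real_of_int (moebius d) * ln (real (k div d)))
      = (\<Sum>d | d dvd k. real_of_int (moebius d) * ln (real k))"
      unfolding sum.distrib[symmetric]
    proof (rule sum.cong)
      fix d assume "d \<in> {d. d dvd k}"
      then obtain e where e: "k = d * e" by auto
      then have "d > 0" "e > 0" using k by (auto intro: Nat.gr0I)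
      then show "real_of_int (moebius d) * ln (real d) * 1 + real_of_int (moebius d) * ln (real (k div d)) = real_of_int (moebius d) * ln (real k)"
        using e by (simp add: ln_mult algebra_simps)
    qed simp
    also have "\<dots> = real_of_int (\<Sum>d | d dvd k. moebius d) * ln (real k)" by (simp add: sum_distrib_right)
    also have "\<dots> = 0" using sum_moebius_divisors[of k] k by simp
    finally show ?thesis unfolding distrib_right[symmetric] of_real_add[symmetric] by simp
  qed
  have "(?g has_sum (dmoebius_ln s * dzeta s + dmoebius s * dzeta_ln s)) {1..}"
    by (intro has_sum_add dser_mult[OF s] coefficient_bounds)
  then have "dmoebius_ln s * dzeta s + dmoebius s * dzeta_ln s = ?g 1"
    by (rule has_sum_single_1) (use g0 in auto)
  then have "dmoebius_ln s * dzeta s = - dmoebius s * dzeta_ln s" using g0[of 1] by (simp add: eq_neg_iff_add_eq_0)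
  then have "(dmoebius_ln s * dzeta s) * dmoebius s = (- dmoebius s * dzeta_ln s) * dmoebius s" by (rule arg_cong)
  moreover have "(dmoebius_ln s * dzeta s) * dmoebius s = dmoebius_ln s * (dmoebius s * dzeta s)" by (simp only: mult_ac)
  ultimately show ?thesis unfolding dmoebius_dzeta[OF s] by (simp add: power2_eq_square mult_ac)
qed

section \<open>Approximation of zeta and its derivative by finite sums\<close>

lemma powr_neg_tendsto_0: "c > 0 \<Longrightarrow> (\<lambda>n. real n powr (- c)) \<longlonglongrightarrow> 0"
  by (rule tendsto_neg_powr[OF _ filterlim_real_sequentially]) auto

lemma ln_mult_powr_neg_tendsto_0: "c > 0 \<Longrightarrow> (\<lambda>n. ln (real n) * real n powr (- c)) \<longlonglongrightarrow> 0"
  by real_asymp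

text \<open>Euler-Maclaurin with the antiderivative -x^(1-s)/(s-1). The free parameter M serves two
  purposes: M = 0 isolates the pole at 1, and M of order |Im s|^2 makes the error bounded.\<close>

lemma dzeta_approx:
  assumes s: "Re s > 1"
  shows "norm (dzeta s - (\<Sum>n<M. npow s (real (Suc n))) - npow (s - 1) (real (Suc M)) / (s - 1)) \<le> 4 * norm s / sqrt (real (Suc M))"
proof -
  have s1: "s - 1 \<noteq> 0" using s by auto
  define B where "B x = - npow (s - 1) x / (s - 1)" for x
  have sum: "summable (\<lambda>n. npow s (real (Suc n)))"
    using summable_norm_cancel[OF dser_norm_summable[OF s coefficient_bounds(1)]] by simp
  have "norm ((\<Sum>n. npow s (real (n + Suc M))) + B (real (Suc M))) \<le> 4 * norm s / sqrt (real (Suc M))"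
  proof (rule euler_maclaurin_tail)
    fix x :: real and A :: "real set" assume x: "x \<ge> 1"
    have "((\<lambda>x. - npow (s - 1) x / (s - 1)) has_vector_derivative (- (- (s - 1) * npow (s - 1 + 1) x) / (s - 1))) (at x within A)"
      using x by (intro has_vector_derivative_divide has_vector_derivative_minus npow_has_vector_derivative) auto
    moreover have "- (- (s - 1) * npow (s - 1 + 1) x) / (s - 1) = npow s x"
      using nonzero_mult_div_cancel_left[OF s1, of "npow s x"]
      by (simp only: minus_mult_left[symmetric] minus_minus diff_add_cancel)
    ultimately show "(B has_vector_derivative npow s x) (at x within A)" unfolding B_def by simp
    show "(npow s has_vector_derivative (- s * npow (s + 1) x)) (at x within A)"
      using x by (intro npow_has_vector_derivative) auto
    have "x powr (- Re (s + 1)) \<le> x powr (-3/2)" using x s by (intro powr_mono) auto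
    then show "norm (- s * npow (s + 1) x) \<le> norm s * x powr (-3/2)"
      using x by (simp add: norm_mult norm_npow mult_left_mono)
  next
    have "(\<lambda>n. real n powr (- (Re s - 1)) / norm (s - 1)) \<longlonglongrightarrow> 0 / norm (s - 1)"
      using s s1 by (intro tendsto_divide powr_neg_tendsto_0 tendsto_const) auto
    then have lim: "(\<lambda>n. real n powr (- (Re s - 1)) / norm (s - 1)) \<longlonglongrightarrow> 0" by simp
    have "(\<lambda>n. norm (B (real n))) \<longlonglongrightarrow> 0"
    proof (rule Lim_transform_eventually[OF lim])
      show "\<forall>\<^sub>F n in sequentially. real n powr (- (Re s - 1)) / norm (s - 1) = norm (B (real n))"
        by (rule eventually_sequentiallyI[of 1]) (auto simp: B_def norm_divide norm_npow)
    qed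
    then show "(\<lambda>n. B (real n)) \<longlonglongrightarrow> 0" by (simp only: tendsto_norm_zero_iff)
    show "summable (\<lambda>n. npow s (real (n + Suc M)))"
      using sum summable_iff_shift[of "\<lambda>n. npow s (real (Suc n))" M] by simp
  qed simp
  moreover have "dzeta s = (\<Sum>n. npow s (real (n + Suc M))) + (\<Sum>n<M. npow s (real (Suc n)))"
    using suminf_split_initial_segment[OF sum, of M] by (simp add: dser_def)
  ultimately show ?thesis by (simp add: B_def)
qed

lemma ln_le_two_sqrt: "x \<ge> 1 \<Longrightarrow> ln x \<le> 2 * sqrt x" for x :: real
proof -
  assume x: "x \<ge> 1"
  have "ln x = 2 * ln (sqrt x)" using x by (simp add: ln_sqrt)
  also have "ln (sqrt x) \<le> sqrt x" using x by (intro ln_bound) auto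
  finally show ?thesis by simp
qed

text \<open>The antiderivative of ln x * x^(-s) comes from integration by parts, which produces the
  double pole at 1. The derivative of the summand is x^(-s-1) (1 - s ln x); ln x \<le> 2 sqrt x
  reduces its decay from x^(-2) to x^(-3/2).\<close>

lemma dzeta_ln_approx:
  assumes s: "Re s > 1"
  shows "norm (dzeta_ln s - (\<Sum>n<M. of_real (ln (real (Suc n))) * npow s (real (Suc n)))
     - npow (s - 1) (real (Suc M)) * (of_real (ln (real (Suc M))) / (s - 1) + 1 / (s - 1)\<^sup>2)) \<le> 4 * (1 + 2 * norm s) / sqrt (real (Suc M))"
proof -
  have s1: "s - 1 \<noteq> 0" using s by auto
  define F where "F x = of_real (ln x) * npow s x" for x
  define B where "B x = - (npow (s - 1) x * (of_real (ln x) / (s - 1) + 1 / (s - 1)\<^sup>2))" for x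
  have sum: "summable (\<lambda>n. F (real (Suc n)))"
    unfolding F_def by (rule summable_norm_cancel[OF dser_norm_summable[OF s coefficient_bounds(2)]])
  have ln_der: "((\<lambda>x. complex_of_real (ln x)) has_vector_derivative of_real (1 / x)) (at x within A)" if "x \<ge> 1" for x A
    using that by (auto intro!: derivative_eq_intros has_vector_derivative_of_real
        simp: has_real_derivative_iff_has_vector_derivative[symmetric])
  have "norm ((\<Sum>n. F (real (n + Suc M))) + B (real (Suc M))) \<le> 4 * (1 + 2 * norm s) / sqrt (real (Suc M))"
  proof (rule euler_maclaurin_tail)
    fix x :: real and A :: "real set" assume x: "x \<ge> 1"
    then have x0: "x > 0" by simp
    have div: "npow (s - 1) x / of_real x = npow s x" "npow s x / of_real x = npow (s + 1) x"
      using npow_divide[OF x0, of "s - 1"] npow_divide[OF x0, of s] by simp_all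
    have "(B has_vector_derivative - (npow (s - 1) x * (of_real (1 / x) / (s - 1) + 0) +
       (- (s - 1) * npow (s - 1 + 1) x) * (of_real (ln x) / (s - 1) + 1 / (s - 1)\<^sup>2))) (at x within A)"
      unfolding B_def
      by (intro has_vector_derivative_minus has_vector_derivative_mult has_vector_derivative_add
          has_vector_derivative_divide has_vector_derivative_const ln_der[OF x] npow_has_vector_derivative x0)
    moreover have "- (npow (s - 1) x * (of_real (1 / x) / (s - 1) + 0) +
       (- (s - 1) * npow (s - 1 + 1) x) * (of_real (ln x) / (s - 1) + 1 / (s - 1)\<^sup>2)) = F x"
    proof -
      have "npow (s - 1) x * (of_real (1 / x) / (s - 1) + 0) = npow s x / (s - 1)"
        unfolding div(1)[symmetric] by simp
      moreover have "(- (s - 1) * npow (s - 1 + 1) x) * (of_real (ln x) / (s - 1) + 1 / (s - 1)\<^sup>2)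
         = - F x - npow s x / (s - 1)"
      proof -
        have "(s - 1) * (of_real (ln x) / (s - 1) + 1 / (s - 1)\<^sup>2) = of_real (ln x) + 1 / (s - 1)"
          using s1 by (simp add: distrib_left power2_eq_square)
        then have "npow s x * ((s - 1) * (of_real (ln x) / (s - 1) + 1 / (s - 1)\<^sup>2)) = F x + npow s x / (s - 1)"
          unfolding F_def by (simp add: distrib_left mult.commute)
        moreover have "(- (s - 1) * npow (s - 1 + 1) x) * (of_real (ln x) / (s - 1) + 1 / (s - 1)\<^sup>2)
           = - (npow s x * ((s - 1) * (of_real (ln x) / (s - 1) + 1 / (s - 1)\<^sup>2)))"
          by (simp only: minus_mult_left[symmetric] mult_minus_right[symmetric] diff_add_cancel mult_ac)
        ultimately show ?thesis by simp
      qed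
      ultimately show ?thesis by simp
    qed
    ultimately show "(B has_vector_derivative F x) (at x within A)" by simp
    have "(F has_vector_derivative (of_real (ln x) * (- s * npow (s + 1) x) + of_real (1 / x) * npow s x)) (at x within A)"
      unfolding F_def by (intro has_vector_derivative_mult ln_der[OF x] npow_has_vector_derivative x0)
    moreover have "of_real (1 / x) * npow s x = npow (s + 1) x" unfolding div(2)[symmetric] by simp
    ultimately show "(F has_vector_derivative (npow (s + 1) x * (1 - s * of_real (ln x)))) (at x within A)"
      by (simp add: algebra_simps)
    have l: "0 \<le> ln x" "ln x \<le> 2 * sqrt x" using x ln_le_two_sqrt by auto
    have "norm (1 - s * of_real (ln x)) \<le> 1 + norm s * ln x"
      using norm_triangle_ineq4[of 1 "s * of_real (ln x)"] l by (simp add: norm_mult)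
    also have "\<dots> \<le> sqrt x + norm s * (2 * sqrt x)"
      using l x by (intro add_mono mult_left_mono) auto
    also have "\<dots> = (1 + 2 * norm s) * sqrt x" by (simp add: algebra_simps)
    finally have a: "norm (1 - s * of_real (ln x)) \<le> (1 + 2 * norm s) * sqrt x" .
    have "norm (npow (s + 1) x) \<le> x powr (-2)" unfolding norm_npow[OF x0] using x s by (intro powr_mono) auto
    then have "norm (npow (s + 1) x * (1 - s * of_real (ln x))) \<le> x powr (-2) * ((1 + 2 * norm s) * sqrt x)"
      unfolding norm_mult using a by (intro mult_mono) auto
    also have "\<dots> = (1 + 2 * norm s) * (x powr (-2) * x powr (1/2))" using x by (simp add: powr_half_sqrt)
    also have "x powr (-2) * x powr (1/2) = x powr (-3/2)" by (simp add: powr_add[symmetric])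
    finally show "norm (npow (s + 1) x * (1 - s * of_real (ln x))) \<le> (1 + 2 * norm s) * x powr (-3/2)" .
  next
    let ?w = "\<lambda>n. real n powr (- (Re s - 1))"
    have "(\<lambda>n. (ln (real n) * ?w n) / norm (s - 1) + ?w n / norm ((s - 1)\<^sup>2)) \<longlonglongrightarrow> 0 / norm (s - 1) + 0 / norm ((s - 1)\<^sup>2)"
      using s s1 by (intro tendsto_add tendsto_divide powr_neg_tendsto_0 ln_mult_powr_neg_tendsto_0 tendsto_const) auto
    then have lim: "(\<lambda>n. (ln (real n) * ?w n) / norm (s - 1) + ?w n / norm ((s - 1)\<^sup>2)) \<longlonglongrightarrow> 0" by simp
    show "(\<lambda>n. B (real n)) \<longlonglongrightarrow> 0"
    proof (rule Lim_null_comparison[OF _ lim])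
      show "\<forall>\<^sub>F n in sequentially. norm (B (real n)) \<le> (ln (real n) * ?w n) / norm (s - 1) + ?w n / norm ((s - 1)\<^sup>2)"
      proof (rule eventually_sequentiallyI[of 1])
        fix n :: nat assume n: "n \<ge> 1"
        have "norm (B (real n)) = ?w n * norm (of_real (ln (real n)) / (s - 1) + 1 / (s - 1)\<^sup>2)"
          using n by (simp add: B_def norm_mult norm_npow)
        also have "\<dots> \<le> ?w n * (norm (of_real (ln (real n)) / (s - 1)) + norm (1 / (s - 1)\<^sup>2))"
          by (intro mult_left_mono norm_triangle_ineq) auto
        also have "\<dots> = (ln (real n) * ?w n) / norm (s - 1) + ?w n / norm ((s - 1)\<^sup>2)"
          using n by (simp add: norm_divide algebra_simps)
        finally show "norm (B (real n)) \<le> (ln (real n) * ?w n) / norm (s - 1) + ?w n / norm ((s - 1)\<^sup>2)" .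
      qed
    qed
    show "summable (\<lambda>n. F (real (n + Suc M)))"
      using sum summable_iff_shift[of "\<lambda>n. F (real (Suc n))" M] by simp
  qed simp
  moreover have "dzeta_ln s = (\<Sum>n. F (real (n + Suc M))) + (\<Sum>n<M. F (real (Suc n)))"
    using suminf_split_initial_segment[OF sum, of M] by (simp add: dser_def F_def)
  ultimately show ?thesis by (simp add: B_def F_def)
qed

section \<open>The 3-4-1 inequality\<close>

lemma ln_norm_one_minus_sums:
  assumes "norm z < 1"
  shows "(\<lambda>n. - Re (z ^ n) / real n) sums ln (norm (1 - z))"
proof -
  have "(\<lambda>n. - ((- (- z)) ^ n) / of_nat n) sums Ln (1 + (- z))"
    using assms by (intro Ln_series') simp
  then have "(\<lambda>n. Re (- (z ^ n) / of_nat n)) sums Re (Ln (1 - z))" by (intro sums_Re) simp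
  moreover have "Re (- (z ^ n) / of_nat n) = - Re (z ^ n) / real n" for n
    by (simp add: Re_divide_of_nat)
  moreover have "1 - z \<noteq> 0" using assms by auto
  ultimately show ?thesis by (simp add: Re_Ln)
qed

text \<open>In the power series of the logarithms, the n-th coefficient is -x^n/n times 3 + 4 cos
  \<theta> + cos 2\<theta> = 2 (1 + cos \<theta>)^2, where \<theta> is the argument of w^n.\<close>

lemma three_four_one_local:
  fixes w :: complex
  assumes x: "0 \<le> x" "x < 1" and w: "norm w = 1"
  shows "norm (1 - complex_of_real x) ^ 3 * norm (1 - of_real x * w) ^ 4 * norm (1 - of_real x * w\<^sup>2) \<le> 1"
proof -
  have n: "norm (complex_of_real x) < 1" "norm (of_real x * w) < 1" "norm (of_real x * w\<^sup>2) < 1"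
    using x w by (simp_all add: norm_mult norm_power)
  define A B C where "A = norm (1 - complex_of_real x)" and "B = norm (1 - of_real x * w)" and "C = norm (1 - of_real x * w\<^sup>2)"
  have pos: "A > 0" "B > 0" "C > 0" using n unfolding A_def B_def C_def by force+
  have sums: "(\<lambda>n. 3 * (- Re ((of_real x) ^ n) / real n) + 4 * (- Re ((of_real x * w) ^ n) / real n) + (- Re ((of_real x * w\<^sup>2) ^ n) / real n))
      sums (3 * ln A + 4 * ln B + ln C)"
    unfolding A_def B_def C_def by (intro sums_add sums_mult ln_norm_one_minus_sums n)
  \<comment> \<open>The series start at n = 0; that term is 0 because division by zero gives
    0.\<close>
  have nonpos: "3 * (- Re ((of_real x) ^ n) / real n) + 4 * (- Re ((of_real x * w) ^ n) / real n) + (- Re ((of_real x * w\<^sup>2) ^ n) / real n) \<le> 0" for n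
  proof -
    define v where "v = w ^ n"
    have v: "(Re v)\<^sup>2 + (Im v)\<^sup>2 = 1"
      using w by (simp add: v_def norm_power flip: cmod_power2)
    have "Re (v\<^sup>2) = 2 * (Re v)\<^sup>2 - 1" using v by (simp add: power2_eq_square)
    then have "3 + 4 * Re v + Re (v\<^sup>2) = 2 * (1 + Re v)\<^sup>2" by (simp add: power2_eq_square algebra_simps)
    then have nn: "3 + 4 * Re v + Re (v\<^sup>2) \<ge> 0" by simp
    have e: "Re ((of_real x) ^ n) = x ^ n" "Re ((of_real x * w) ^ n) = x ^ n * Re v" "Re ((of_real x * w\<^sup>2) ^ n) = x ^ n * Re (v\<^sup>2)"
      by (simp_all add: power_mult_distrib v_def power_mult[symmetric] mult.commute flip: of_real_power)
    have "3 * (- Re ((of_real x) ^ n) / real n) + 4 * (- Re ((of_real x * w) ^ n) / real n) + (- Re ((of_real x * w\<^sup>2) ^ n) / real n)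
      = - (x ^ n / real n * (3 + 4 * Re v + Re (v\<^sup>2)))"
      unfolding e by (simp add: algebra_simps add_divide_distrib)
    also have "\<dots> \<le> 0" using x nn by simp
    finally show ?thesis .
  qed
  have "3 * ln A + 4 * ln B + ln C \<le> 0"
    by (rule sums_le[OF nonpos sums sums_zero])
  then have "ln (A ^ 3 * B ^ 4 * C) \<le> 0" using pos by (simp add: ln_mult ln_realpow)
  then have "A ^ 3 * B ^ 4 * C \<le> 1" using pos by (subst (asm) ln_le_zero_iff) auto
  then show ?thesis by (simp add: A_def B_def C_def)
qed

definition sifted :: "nat set \<Rightarrow> nat set" where
  "sifted Q = {n. n \<ge> 1 \<and> (\<forall>p\<in>Q. \<not> p dvd n)}"

lemma npow_summable_on:
  assumes "Re s > 1" "A \<subseteq> {1..}"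
  shows "(\<lambda>n. norm (npow s (real n))) summable_on A" "(\<lambda>n. npow s (real n)) summable_on A"
proof -
  have "(\<lambda>n. norm (npow s (real n))) summable_on {1..}"
    using dser_abs_summable_on[OF assms(1) coefficient_bounds(1)] by simp
  then show 1: "(\<lambda>n. norm (npow s (real n))) summable_on A"
    using assms(2) by (rule summable_on_subset_banach)
  show "(\<lambda>n. npow s (real n)) summable_on A" using 1 by (rule abs_summable_summable)
qed

text \<open>Inserting a prime \<open>p\<close> into the sieve removes exactly the multiples \<open>p * m\<close> of the numbers \<open>m\<close>
  that had survived so far.\<close>

lemma euler_product_sifted:
  assumes s: "Re s > 1" and Q: "finite Q" "\<And>p. p \<in> Q \<Longrightarrow> prime p"
  shows "(\<Sum>\<^sub>\<infinity>n\<in>sifted Q. npow s (real n)) = dzeta s * (\<Prod>p\<in>Q. 1 - npow s (real p))"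
  using Q
proof (induction Q)
  case empty
  have "sifted {} = {1..}" by (auto simp: sifted_def)
  then show ?case using infsumI[OF dser_has_sum[OF s coefficient_bounds(1)]] by simp
next
  case (insert p Q)
  have p: "prime p" using insert.prems by auto
  have p0: "p > 0" using p prime_gt_0_nat by blast
  have Qp: "prime q" if "q \<in> Q" for q using insert.prems that by auto
  have split: "sifted Q = sifted (insert p Q) \<union> (\<lambda>m. p * m) ` sifted Q"
  proof (intro equalityI subsetI)
    fix n assume n: "n \<in> sifted Q"
    show "n \<in> sifted (insert p Q) \<union> (\<lambda>m. p * m) ` sifted Q"
    proof (cases "p dvd n")
      case True
      then obtain m where m: "n = p * m" by auto
      then have "m \<in> sifted Q" using n by (auto simp: sifted_def intro: Nat.gr0I)
      then show ?thesis using m by auto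
    qed (use n in \<open>auto simp: sifted_def\<close>)
  next
    fix n assume "n \<in> sifted (insert p Q) \<union> (\<lambda>m. p * m) ` sifted Q"
    then show "n \<in> sifted Q"
    proof
      assume "n \<in> (\<lambda>m. p * m) ` sifted Q"
      then obtain m where m: "n = p * m" "m \<in> sifted Q" by auto
      have "\<not> q dvd n" if q: "q \<in> Q" for q
      proof
        assume "q dvd n"
        then have "q dvd p \<or> q dvd m" using m Qp[OF q] by (simp add: prime_dvd_mult_iff)
        then have "q dvd p" using m q by (auto simp: sifted_def)
        then have "q = p" using Qp[OF q] p by (simp add: primes_dvd_imp_eq)
        then show False using q insert.hyps by simp
      qed
      then show ?thesis using m p0 by (auto simp: sifted_def)
    qed (auto simp: sifted_def)
  qed
  have disj: "sifted (insert p Q) \<inter> (\<lambda>m. p * m) ` sifted Q = {}" by (auto simp: sifted_def)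
  have sub: "sifted A \<subseteq> {1..}" "(\<lambda>m. p * m) ` sifted A \<subseteq> {1..}" for A using p0 by (auto simp: sifted_def)
  have "(\<Sum>\<^sub>\<infinity>n\<in>sifted Q. npow s (real n)) = (\<Sum>\<^sub>\<infinity>n\<in>sifted (insert p Q). npow s (real n)) + (\<Sum>\<^sub>\<infinity>n\<in>(\<lambda>m. p * m) ` sifted Q. npow s (real n))"
    by (subst split, rule infsum_Un_disjoint) (intro npow_summable_on s sub disj)+
  also have "(\<Sum>\<^sub>\<infinity>n\<in>(\<lambda>m. p * m) ` sifted Q. npow s (real n)) = (\<Sum>\<^sub>\<infinity>m\<in>sifted Q. npow s (real p) * npow s (real m))"
  proof -
    have inj: "inj_on (\<lambda>m. p * m) (sifted Q)" using p0 by (auto simp: inj_on_def)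
    show ?thesis
      unfolding infsum_reindex[OF inj] by (rule infsum_cong) (use p0 in \<open>auto simp: npow_mult sifted_def\<close>)
  qed
  also have "\<dots> = npow s (real p) * (\<Sum>\<^sub>\<infinity>m\<in>sifted Q. npow s (real m))" by (rule infsum_cmult_right')
  finally have "(\<Sum>\<^sub>\<infinity>n\<in>sifted (insert p Q). npow s (real n)) = (1 - npow s (real p)) * (\<Sum>\<^sub>\<infinity>n\<in>sifted Q. npow s (real n))"
    by (simp add: algebra_simps)
  then show ?case using insert.IH Qp insert.hyps by (simp add: mult_ac)
qed

text \<open>The finite Euler product of 1/\<zeta>, kept as a product of the factors themselves
  instead of their inverses.\<close>

definition euler_factor :: "nat \<Rightarrow> complex \<Rightarrow> complex" where
  "euler_factor N s = (\<Prod>p | prime p \<and> p \<le> N. 1 - npow s (real p))"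

text \<open>Sieving by the primes up to N leaves 1 and otherwise only numbers above N, since each of
  the latter has no prime factor up to N. The difference from 1 is thus bounded by a tail of the
  absolutely convergent series.\<close>

lemma euler_product_tendsto:
  assumes s: "Re s > 1"
  shows "(\<lambda>N. dzeta s * euler_factor N s) \<longlonglongrightarrow> 1"
proof -
  let ?u = "\<lambda>n. norm (npow s (real n))"
  define tail where "tail N = (\<Sum>\<^sub>\<infinity>n\<in>{1..}. ?u n) - (\<Sum>n<N. ?u (Suc n))" for N
  have us: "?u summable_on {1..}" by (rule npow_summable_on[OF s]) simp
  have "((\<lambda>n. ?u (Suc n)) has_sum (\<Sum>\<^sub>\<infinity>n\<in>{1..}. ?u n)) UNIV"
  proof -
    have "bij_betw Suc UNIV {1..}" by (rule bij_betwI[of _ _ _ "\<lambda>n. n - 1"]) auto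
    then show ?thesis using has_sum_infsum[OF us] has_sum_reindex_bij_betw[of Suc UNIV "{1..}" ?u] by simp
  qed
  then have "(\<lambda>n. ?u (Suc n)) sums (\<Sum>\<^sub>\<infinity>n\<in>{1..}. ?u n)" by (rule has_sum_imp_sums)
  then have "tail \<longlonglongrightarrow> (\<Sum>\<^sub>\<infinity>n\<in>{1..}. ?u n) - (\<Sum>\<^sub>\<infinity>n\<in>{1..}. ?u n)"
    unfolding tail_def sums_def by (intro tendsto_diff tendsto_const)
  then have tail0: "tail \<longlonglongrightarrow> 0" by simp
  have "norm (dzeta s * euler_factor N s - 1) \<le> tail N" if N: "N \<ge> 1" for N
  proof -
    let ?Q = "{p. prime p \<and> p \<le> N}"
    have finQ: "finite ?Q" by (rule finite_subset[of _ "{..N}"]) auto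
    have one: "1 \<in> sifted ?Q" by (auto simp: sifted_def)
    have big: "n > N" if n: "n \<in> sifted ?Q - {1}" for n
    proof (rule ccontr)
      assume "\<not> n > N"
      moreover have "n \<noteq> 1" "n \<ge> 1" using n by (auto simp: sifted_def)
      then obtain p where "prime p" "p dvd n" using prime_factor_nat by blast
      moreover have "p \<le> n" using \<open>p dvd n\<close> \<open>n \<ge> 1\<close> by (simp add: dvd_imp_le)
      ultimately show False using n by (auto simp: sifted_def)
    qed
    have sub: "sifted ?Q - {1} \<subseteq> {N<..}" using big by auto
    have N1: "{N<..} \<subseteq> {1..}" by auto
    have "dzeta s * euler_factor N s = (\<Sum>\<^sub>\<infinity>n\<in>sifted ?Q. npow s (real n))"
      unfolding euler_factor_def by (rule euler_product_sifted[OF s finQ, symmetric]) auto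
    also have "\<dots> = (\<Sum>\<^sub>\<infinity>n\<in>{1} \<union> (sifted ?Q - {1}). npow s (real n))"
      using one by (intro arg_cong[of _ _ "infsum _"]) auto
    also have "\<dots> = (\<Sum>\<^sub>\<infinity>n\<in>{1}. npow s (real n)) + (\<Sum>\<^sub>\<infinity>n\<in>sifted ?Q - {1}. npow s (real n))"
      by (rule infsum_Un_disjoint) (use sub N1 in \<open>auto intro!: npow_summable_on s\<close>)
    finally have "dzeta s * euler_factor N s - 1 = (\<Sum>\<^sub>\<infinity>n\<in>sifted ?Q - {1}. npow s (real n))" by simp
    also have "norm \<dots> \<le> (\<Sum>\<^sub>\<infinity>n\<in>sifted ?Q - {1}. ?u n)"
      by (rule norm_infsum_bound) (rule npow_summable_on[OF s order.trans[OF sub N1]])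
    also have "\<dots> \<le> (\<Sum>\<^sub>\<infinity>n\<in>{N<..}. ?u n)"
      by (rule infsum_mono2) (use sub N1 in \<open>auto intro!: npow_summable_on s\<close>)
    also have "\<dots> = tail N"
    proof -
      have "(\<Sum>\<^sub>\<infinity>n\<in>{1..}. ?u n) = (\<Sum>\<^sub>\<infinity>n\<in>{1..N} \<union> {N<..}. ?u n)"
        by (intro arg_cong[of _ _ "infsum _"]) auto
      also have "\<dots> = (\<Sum>\<^sub>\<infinity>n\<in>{1..N}. ?u n) + (\<Sum>\<^sub>\<infinity>n\<in>{N<..}. ?u n)"
        by (rule infsum_Un_disjoint) (use N1 in \<open>auto intro!: npow_summable_on s\<close>)
      also have "(\<Sum>\<^sub>\<infinity>n\<in>{1..N}. ?u n) = (\<Sum>n<N. ?u (Suc n))"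
        unfolding infsum_finite[OF finite_atLeastAtMost]
        by (rule sum.reindex_bij_witness[of _ Suc "\<lambda>n. n - 1"]) auto
      finally show ?thesis by (simp add: tail_def)
    qed
    finally show ?thesis .
  qed
  then have "(\<lambda>N. dzeta s * euler_factor N s - 1) \<longlonglongrightarrow> 0"
    by (intro Lim_null_comparison[OF _ tail0] eventually_sequentiallyI[of 1])
  then show ?thesis by (simp add: LIM_zero_iff)
qed

text \<open>The local inequality at each prime bounds the finite Euler products of 1/\<zeta>,
  combined with powers 3, 4, 1, by 1. Multiplied by the corresponding values of \<zeta> the
  combination tends to 1, which gives the claim in the limit.\<close>

lemma dzeta_three_four_one:
  assumes \<sigma>: "\<sigma> > 1"
  shows "1 \<le> norm (dzeta (of_real \<sigma>)) ^ 3 * norm (dzeta (Complex \<sigma> t)) ^ 4 * norm (dzeta (Complex \<sigma> (2 * t)))"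
proof -
  let ?s0 = "complex_of_real \<sigma>" and ?s1 = "Complex \<sigma> t" and ?s2 = "Complex \<sigma> (2 * t)"
  let ?X = "\<lambda>N s. norm (dzeta s * euler_factor N s)"
  have lim: "(\<lambda>N. ?X N s) \<longlonglongrightarrow> 1" if "Re s = \<sigma>" for s
    using tendsto_norm[OF euler_product_tendsto[of s]] that \<sigma> by simp
  have "(\<lambda>N. ?X N ?s0 ^ 3 * ?X N ?s1 ^ 4 * ?X N ?s2) \<longlonglongrightarrow> 1 ^ 3 * 1 ^ 4 * 1"
    by (intro tendsto_mult tendsto_power lim) auto
  moreover have "?X N ?s0 ^ 3 * ?X N ?s1 ^ 4 * ?X N ?s2
      \<le> norm (dzeta ?s0) ^ 3 * norm (dzeta ?s1) ^ 4 * norm (dzeta ?s2)" for N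
  proof -
    let ?Q = "{p. prime p \<and> p \<le> N}"
    have "norm (euler_factor N ?s0) ^ 3 * norm (euler_factor N ?s1) ^ 4 * norm (euler_factor N ?s2)
      = (\<Prod>p\<in>?Q. norm (1 - npow ?s0 (real p)) ^ 3 * norm (1 - npow ?s1 (real p)) ^ 4 * norm (1 - npow ?s2 (real p)))"
      by (simp only: euler_factor_def prod.distrib prod_power_distrib[symmetric] prod_norm)
    also have "\<dots> \<le> 1"
    proof (rule prod_le_1)
      fix p assume "p \<in> ?Q"
      then have "prime p" by simp
      then have p: "real p > 1" using prime_gt_1_nat by simp
      define x where "x = real p powr (-\<sigma>)"
      define w where "w = cis (- t * ln (real p))"
      have x: "0 \<le> x" "x < 1" using p \<sigma> by (auto simp: x_def powr_less_one)
      have polar: "npow (Complex \<sigma> r) (real p) = of_real x * cis (- r * ln (real p))" for r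
      proof -
        have "- (Complex \<sigma> r * of_real (ln (real p))) = of_real (- \<sigma> * ln (real p)) + \<i> * of_real (- r * ln (real p))"
          by (simp add: complex_eq_iff)
        then have "npow (Complex \<sigma> r) (real p) = exp (of_real (- \<sigma> * ln (real p))) * cis (- r * ln (real p))"
          unfolding npow_def cis_conv_exp exp_add[symmetric] by simp
        also have "exp (of_real (- \<sigma> * ln (real p))) = complex_of_real x"
          unfolding exp_of_real x_def using p by (simp add: powr_def)
        finally show ?thesis .
      qed
      have e0: "npow ?s0 (real p) = of_real x"
        using polar[of 0] by (simp add: complex_of_real_def)
      have e1: "npow ?s1 (real p) = of_real x * w" using polar[of t] by (simp add: w_def)
      have e2: "npow ?s2 (real p) = of_real x * w\<^sup>2"
        using polar[of "2 * t"] by (simp add: w_def power2_eq_square cis_mult algebra_simps)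
      have "norm w = 1" by (simp add: w_def)
      from three_four_one_local[OF x this]
      show "0 \<le> norm (1 - npow ?s0 (real p)) ^ 3 * norm (1 - npow ?s1 (real p)) ^ 4 * norm (1 - npow ?s2 (real p)) \<and>
          norm (1 - npow ?s0 (real p)) ^ 3 * norm (1 - npow ?s1 (real p)) ^ 4 * norm (1 - npow ?s2 (real p)) \<le> 1"
        unfolding e0 e1 e2 by simp
    qed
    finally have P: "norm (euler_factor N ?s0) ^ 3 * norm (euler_factor N ?s1) ^ 4 * norm (euler_factor N ?s2) \<le> 1" .
    have "?X N ?s0 ^ 3 * ?X N ?s1 ^ 4 * ?X N ?s2 = (norm (dzeta ?s0) ^ 3 * norm (dzeta ?s1) ^ 4 * norm (dzeta ?s2))
      * (norm (euler_factor N ?s0) ^ 3 * norm (euler_factor N ?s1) ^ 4 * norm (euler_factor N ?s2))"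
      by (simp add: norm_mult power_mult_distrib mult_ac)
    also have "\<dots> \<le> norm (dzeta ?s0) ^ 3 * norm (dzeta ?s1) ^ 4 * norm (dzeta ?s2)"
      using P by (intro mult_left_le) auto
    finally show ?thesis .
  qed
  ultimately show ?thesis by (intro LIMSEQ_le_const2) auto
qed

lemma dzeta_has_field_derivative:
  assumes s: "Re s > 1"
  shows "(dzeta has_field_derivative (- dzeta_ln s)) (at s)"
proof -
  \<comment> \<open>Halfway between 1 and Re s: on the half-plane to the right of c the
    differentiated series has a summable majorant.\<close>
  define c where "c = (1 + Re s) / 2"
  have c: "1 < c" "c < Re s" using s by (auto simp: c_def field_simps)
  let ?S = "{z. Re z > c}"
  have "((\<lambda>z. \<Sum>n. npow z (real (Suc n))) has_field_derivative (\<Sum>n. - (of_real (ln (real (Suc n))) * npow s (real (Suc n))))) (at s)"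
  proof (rule has_field_derivative_series'(2))
    show "convex ?S" by (rule convex_halfspace_Re_gt)
    fix n :: nat and z assume "z \<in> ?S"
    show "((\<lambda>z. npow z (real (Suc n))) has_field_derivative - (of_real (ln (real (Suc n))) * npow z (real (Suc n)))) (at z within ?S)"
      unfolding npow_def by (auto intro!: derivative_eq_intros)
  next
    show "uniformly_convergent_on ?S (\<lambda>n z. \<Sum>i<n. - (of_real (ln (real (Suc i))) * npow z (real (Suc i))))"
    proof (rule Weierstrass_m_test'[OF _ summable_log_powr[OF c(1)]])
      fix n :: nat and z assume z: "z \<in> ?S"
      have "ln (real (Suc n)) * real (Suc n) powr (- Re z) \<le> (1 + ln (real (Suc n))) * real (Suc n) powr (- c)"
        using z by (intro mult_mono powr_mono) auto
      then show "norm (- (of_real (ln (real (Suc n))) * npow z (real (Suc n)))) \<le> (1 + ln (real (Suc n))) * real (Suc n) powr (- c)"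
        by (simp add: norm_mult norm_npow)
    qed
    show "s \<in> ?S" using c by simp
    show "summable (\<lambda>n. npow s (real (Suc n)))"
      using summable_norm_cancel[OF dser_norm_summable[OF s coefficient_bounds(1)]] by simp
    have "open ?S" by (rule open_halfspace_Re_gt)
    then show "s \<in> interior ?S" using c by (simp add: interior_open)
  qed
  moreover have "(\<lambda>z. \<Sum>n. npow z (real (Suc n))) = dzeta" by (rule ext) (simp add: dser_def)
  moreover have "(\<Sum>n. - (of_real (ln (real (Suc n))) * npow s (real (Suc n)))) = - dzeta_ln s"
    unfolding dser_def using summable_norm_cancel[OF dser_norm_summable[OF s coefficient_bounds(2)]]
    by (rule suminf_minus)
  ultimately show ?thesis by simp
qed

section \<open>Bounds near the line Re s = 1\<close>

lemma sum_inverse_Suc_le: "(\<Sum>n<M. 1 / real (Suc n)) \<le> 1 + ln (real (Suc M))"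
proof -
  have "harm (Suc M) - ln (real (Suc M)) \<le> harm (Suc 0) - ln (real (Suc 0))"
    using decseqD[OF decseq_harm_diff_ln, of 0 M] by simp
  then have h: "harm (Suc M) \<le> 1 + ln (real (Suc M))" by (simp add: harm_def)
  have "(\<Sum>n<M. 1 / real (Suc n)) = (\<Sum>k=1..M. inverse (real k))"
    by (rule sum.reindex_bij_witness[of _ "\<lambda>k. k - 1" Suc]) (auto simp: inverse_eq_divide)
  also have "\<dots> = harm M" by (simp add: harm_def)
  also have "\<dots> \<le> harm (Suc M)" by (simp add: harm_Suc)
  finally show ?thesis using h by linarith
qed

text \<open>Cutting the series at about T^2 terms, with |s| \<le> T, makes the Euler-Maclaurin error
  bounded, so the growth is logarithmic: l for \<zeta> and l^2 for \<zeta>', where l = ln (M+1).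
  Distance 1/32 from the real axis bounds the polar terms by powers of 32.\<close>

lemma dzeta_upper_bounds:
  assumes s: "1 < Re s" "Re s \<le> 2" and t: "1/32 \<le> \<bar>Im s\<bar>"
  shows "norm (dzeta s) \<le> 60000 * (\<bar>Im s\<bar> + 2) powr (1/36)"
    and "norm (dzeta_ln s) \<le> 60000 * (\<bar>Im s\<bar> + 2) powr (1/36)"
proof -
  define T where "T = \<bar>Im s\<bar> + 2"
  \<comment> \<open>The bound for \<zeta>' contains l^2, so l is compared with T^(1/72), whose
    square is T^(1/36). From M + 1 \<le> T^3 and ln T \<le> 72 P one gets l \<le> 216 P.\<close>
  define P where "P = T powr (1/72)"
  define M where "M = nat \<lceil>T\<^sup>2\<rceil>"
  define l where "l = ln (real (Suc M))"
  have T: "T \<ge> 2" by (simp add: T_def)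
  have P1: "P \<ge> 1" unfolding P_def using T by (intro ge_one_powr_ge_zero) auto
  have PP: "T powr (1/36) = P\<^sup>2"
    using T by (simp add: P_def powr_power)
  have sT: "norm s \<le> T" using cmod_le[of s] s by (simp add: T_def)
  have M1: "T\<^sup>2 \<le> real (Suc M)" and M2: "real (Suc M) \<le> T\<^sup>2 + 2"
    unfolding M_def by (auto simp: real_nat_ceiling_ge intro: order.trans) linarith+
  have "T = sqrt (T\<^sup>2)" using T by simp
  also have "\<dots> \<le> sqrt (real (Suc M))" using M1 by (rule real_sqrt_le_mono)
  finally have sqM: "T \<le> sqrt (real (Suc M))" .
  have "2\<^sup>2 \<le> T\<^sup>2" using T by (intro power_mono) auto
  then have "T\<^sup>2 + 2 \<le> 2 * T\<^sup>2" by simp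
  also have "\<dots> \<le> T * T\<^sup>2" using T by (intro mult_right_mono) auto
  finally have "real (Suc M) \<le> T ^ 3" using M2 by (simp add: power3_eq_cube power2_eq_square)
  then have "l \<le> ln (T ^ 3)" unfolding l_def using T by (subst ln_le_cancel_iff) auto
  also have "\<dots> = 3 * ln T" using T by (simp add: ln_realpow)
  also have "ln T \<le> T powr (1/72) / (1/72)" using T by (intro ln_powr_bound) auto
  finally have lP: "l \<le> 216 * P" by (simp add: P_def)
  have l0: "l \<ge> 0" by (simp add: l_def)
  have s1: "norm (s - 1) \<ge> 1/32"
    using t abs_Im_le_cmod[of "s - 1"] by simp
  then have inv1: "1 / norm (s - 1) \<le> 32" by (simp add: divide_le_eq split: if_splits)
  have npow1: "norm (npow (s - 1) (real (Suc M))) \<le> 1"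
    using s powr_mono[of "- (Re s - 1)" 0 "real (Suc M)"] by (simp add: norm_npow)
  have npow_le: "norm (npow s (real (Suc n))) \<le> 1 / real (Suc n)" for n
  proof -
    have "real (Suc n) powr (- Re s) \<le> real (Suc n) powr (-1)" using s by (intro powr_mono) auto
    then show ?thesis by (simp add: norm_npow powr_minus_divide)
  qed
  have H: "(\<Sum>n<M. norm (npow s (real (Suc n)))) \<le> 1 + l"
    unfolding l_def by (rule order.trans[OF sum_mono sum_inverse_Suc_le]) (rule npow_le)
  have "norm (dzeta s) \<le> norm (dzeta s - (\<Sum>n<M. npow s (real (Suc n))) - npow (s - 1) (real (Suc M)) / (s - 1))
      + norm ((\<Sum>n<M. npow s (real (Suc n))) + npow (s - 1) (real (Suc M)) / (s - 1))"
    using norm_triangle_ineq[of "dzeta s - (\<Sum>n<M. npow s (real (Suc n))) - npow (s - 1) (real (Suc M)) / (s - 1)"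
       "(\<Sum>n<M. npow s (real (Suc n))) + npow (s - 1) (real (Suc M)) / (s - 1)"] by simp
  also have "\<dots> \<le> 4 + ((1 + l) + 32)"
  proof (intro add_mono)
    have "4 * norm s / sqrt (real (Suc M)) \<le> 4"
      using sT sqM T by (simp add: divide_le_eq)
    then show "norm (dzeta s - (\<Sum>n<M. npow s (real (Suc n))) - npow (s - 1) (real (Suc M)) / (s - 1)) \<le> 4"
      using dzeta_approx[OF s(1), of M] by linarith
    have "norm (npow (s - 1) (real (Suc M)) / (s - 1)) \<le> 1 * 32"
      unfolding norm_divide using mult_mono[OF npow1 inv1] by simp
    moreover have "norm (\<Sum>n<M. npow s (real (Suc n))) \<le> 1 + l" using norm_sum H by (rule order.trans)
    ultimately show "norm ((\<Sum>n<M. npow s (real (Suc n))) + npow (s - 1) (real (Suc M)) / (s - 1)) \<le> (1 + l) + 32"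
      using norm_triangle_ineq[of "\<Sum>n<M. npow s (real (Suc n))" "npow (s - 1) (real (Suc M)) / (s - 1)"] by linarith
  qed
  also have "\<dots> \<le> 253 * P" using lP P1 by simp
  also have "\<dots> \<le> 60000 * P\<^sup>2" using P1 by (simp add: power2_eq_square)
  finally show "norm (dzeta s) \<le> 60000 * (\<bar>Im s\<bar> + 2) powr (1/36)" by (simp add: PP T_def[symmetric])
  let ?F = "\<Sum>n<M. complex_of_real (ln (real (Suc n))) * npow s (real (Suc n))"
  let ?R = "npow (s - 1) (real (Suc M)) * (of_real (ln (real (Suc M))) / (s - 1) + 1 / (s - 1)\<^sup>2)"
  have "norm (dzeta_ln s) \<le> norm (dzeta_ln s - ?F - ?R) + norm (?F + ?R)"
    using norm_triangle_ineq[of "dzeta_ln s - ?F - ?R" "?F + ?R"] by simp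
  also have "\<dots> \<le> 12 + (l * (1 + l) + (32 * l + 1024))"
  proof (intro add_mono)
    have "4 * (1 + 2 * norm s) \<le> 12 * T" using sT T by simp
    also have "\<dots> \<le> 12 * sqrt (real (Suc M))" using sqM by (intro mult_left_mono) auto
    finally have "4 * (1 + 2 * norm s) \<le> 12 * sqrt (real (Suc M))" .
    then have "4 * (1 + 2 * norm s) / sqrt (real (Suc M)) \<le> 12"
      by (subst divide_le_eq) simp
    then show "norm (dzeta_ln s - ?F - ?R) \<le> 12"
      using dzeta_ln_approx[OF s(1), of M] by linarith
    have "norm ?F \<le> (\<Sum>n<M. l * norm (npow s (real (Suc n))))"
    proof (rule order.trans[OF norm_sum sum_mono])
      fix n assume "n \<in> {..<M}"
      then have "ln (real (Suc n)) \<le> l" unfolding l_def by (subst ln_le_cancel_iff) auto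
      then show "norm (complex_of_real (ln (real (Suc n))) * npow s (real (Suc n))) \<le> l * norm (npow s (real (Suc n)))"
        unfolding norm_mult by (intro mult_right_mono) auto
    qed
    also have "\<dots> \<le> l * (1 + l)" unfolding sum_distrib_left[symmetric] using H l0 by (intro mult_left_mono)
    finally have F: "norm ?F \<le> l * (1 + l)" .
    have "norm (of_real l / (s - 1) + 1 / (s - 1)\<^sup>2) \<le> norm (of_real l / (s - 1)) + norm (1 / (s - 1)\<^sup>2)"
      by (rule norm_triangle_ineq)
    also have "\<dots> = l * (1 / norm (s - 1)) + (1 / norm (s - 1))\<^sup>2"
      using l0 by (simp add: norm_divide norm_power power_divide)
    also have "\<dots> \<le> l * 32 + 32\<^sup>2" using inv1 l0 by (intro add_mono mult_left_mono power_mono) auto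
    finally have "norm (of_real l / (s - 1) + 1 / (s - 1)\<^sup>2) \<le> 32 * l + 1024" by simp
    then have "norm ?R \<le> 1 * (32 * l + 1024)"
      unfolding norm_mult l_def[symmetric] using npow1 by (intro mult_mono) auto
    then show "norm (?F + ?R) \<le> l * (1 + l) + (32 * l + 1024)"
      by (intro norm_triangle_mono F) simp
  qed
  \<comment> \<open>The constants add up to 216^2 + 33 * 216 + 12 + 1024 = 54820.\<close>
  also have "\<dots> \<le> 60000 * P\<^sup>2"
  proof -
    have "l * l \<le> (216 * P) * (216 * P)" using lP l0 by (intro mult_mono) auto
    moreover have "P \<le> P\<^sup>2" "1 \<le> P\<^sup>2" using P1 by (auto simp: power2_eq_square intro: mult_ge1_I)
    ultimately show ?thesis using lP by (simp add: power2_eq_square algebra_simps)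
  qed
  finally show "norm (dzeta_ln s) \<le> 60000 * (\<bar>Im s\<bar> + 2) powr (1/36)" by (simp add: PP T_def[symmetric])
qed

lemma dzeta_real_bound:
  assumes \<sigma>: "1 < \<sigma>" "\<sigma> \<le> 2"
  shows "norm (dzeta (of_real \<sigma>)) \<le> 9 / (\<sigma> - 1)"
proof -
  have "norm (dzeta (of_real \<sigma>) - 1 / (of_real \<sigma> - 1)) \<le> 4 * \<sigma>"
    using dzeta_approx[of "of_real \<sigma>" 0] \<sigma> by simp
  moreover have "norm (1 / (complex_of_real \<sigma> - 1)) = 1 / (\<sigma> - 1)"
  proof -
    have "complex_of_real \<sigma> - 1 = of_real (\<sigma> - 1)" by simp
    then show ?thesis using \<sigma> unfolding norm_divide by (simp only: norm_of_real norm_one)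
  qed
  ultimately have "norm (dzeta (of_real \<sigma>)) \<le> 4 * \<sigma> + 1 / (\<sigma> - 1)"
    using norm_triangle_ineq[of "dzeta (of_real \<sigma>) - 1 / (of_real \<sigma> - 1)" "1 / (of_real \<sigma> - 1)"] by simp
  also have "4 * \<sigma> \<le> 8 / (\<sigma> - 1)" using \<sigma> mult_mono[of \<sigma> 2 "\<sigma> - 1" 1] by (simp add: le_divide_eq)
  finally show ?thesis by (simp add: add_divide_distrib[symmetric])
qed

text \<open>At distance at least \<open>a\<close> from the line \<open>Re s = 1\<close> the 3-4-1 inequality suffices. Closer to the line,
  the value at \<open>1 + a\<close> is transported by the bound on the derivative; \<open>a\<close> is chosen so that this
  transport costs at most half of that value.\<close>

lemma dzeta_lower_bound:
  fixes C :: real defines "C \<equiv> 60000"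
  assumes \<sigma>: "1 < \<sigma>" "\<sigma> \<le> 2" and t: "1/32 \<le> \<bar>t\<bar>"
  shows "norm (dzeta (Complex \<sigma> t)) \<ge> 1 / (23328 * C ^ 4 * ((\<bar>t\<bar> + 2) powr (1/36)) ^ 4)"
proof -
  define L where "L = (\<bar>t\<bar> + 2) powr (1/36)"
  have L1: "L \<ge> 1" unfolding L_def by (intro ge_one_powr_ge_zero) auto
  have C1: "C \<ge> 1" by (simp add: C_def)
  \<comment> \<open>The solution of (2aCL)^4 * 1458 C L = a^3, as 16 * 1458 = 23328. At \<sigma> = 1
    + a the 3-4-1 bound then gives 2aCL, twice what the derivative bound CL can lose over a distance
    a.\<close>
  define a where "a = 1 / (23328 * C ^ 5 * L ^ 5)"
  have CL: "C ^ 5 * L ^ 5 \<ge> 1" using C1 L1 one_le_power[of C 5] one_le_power[of L 5] mult_mono[of 1 "C^5" 1 "L^5"] by simp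
  have a: "0 < a" "a \<le> 1" using CL L1 C1 by (auto simp: a_def divide_le_eq)
  \<comment> \<open>1458 = 2 * 9^3: the cube of the bound 9/(\<sigma>'-1) at the real point, and a
    factor 2 from replacing |2t| + 2 by 2(|t| + 2).\<close>
  have key: "(\<sigma>' - 1) ^ 3 \<le> 1458 * C * L * norm (dzeta (Complex \<sigma>' t)) ^ 4" if \<sigma>': "1 < \<sigma>'" "\<sigma>' \<le> 2" for \<sigma>'
  proof -
    have "norm (dzeta (Complex \<sigma>' (2 * t))) \<le> C * (\<bar>2 * t\<bar> + 2) powr (1/36)"
      using dzeta_upper_bounds(1)[of "Complex \<sigma>' (2 * t)"] \<sigma>' t by (simp add: C_def)
    also have "(\<bar>2 * t\<bar> + 2) powr (1/36) \<le> (2 * (\<bar>t\<bar> + 2)) powr (1/36)" by (intro powr_mono2) auto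
    also have "\<dots> = 2 powr (1/36) * L" by (simp only: powr_mult L_def)
    also have "2 powr (1/36) \<le> (2::real) powr 1" by (intro powr_mono) auto
    finally have Z2: "norm (dzeta (Complex \<sigma>' (2 * t))) \<le> C * (2 * L)" using L1 C1 by (simp add: mult_right_mono)
    have "1 \<le> norm (dzeta (of_real \<sigma>')) ^ 3 * norm (dzeta (Complex \<sigma>' t)) ^ 4 * norm (dzeta (Complex \<sigma>' (2 * t)))"
      by (rule dzeta_three_four_one[OF \<sigma>'(1)])
    also have "\<dots> \<le> (9 / (\<sigma>' - 1)) ^ 3 * norm (dzeta (Complex \<sigma>' t)) ^ 4 * (C * (2 * L))"
      using \<sigma>' by (intro mult_mono power_mono dzeta_real_bound Z2) auto
    finally show ?thesis using \<sigma>' by (simp add: field_simps power_divide)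
  qed
  have aeq: "(2 * a * C * L) ^ 4 * (1458 * C * L) = a ^ 3"
  proof -
    have "(2 * a * C * L) ^ 4 * (1458 * C * L) = a ^ 3 * (a * (23328 * C ^ 5 * L ^ 5))"
      by (simp add: power_mult_distrib eval_nat_numeral)
    also have "a * (23328 * C ^ 5 * L ^ 5) = 1" using CL L1 C1 by (simp add: a_def)
    finally show ?thesis by simp
  qed
  have far: "2 * a * C * L \<le> norm (dzeta (Complex \<sigma>' t))" if \<sigma>': "1 + a \<le> \<sigma>'" "\<sigma>' \<le> 2" for \<sigma>'
  proof -
    have "(2 * a * C * L) ^ 4 * (1458 * C * L) \<le> (\<sigma>' - 1) ^ 3"
      unfolding aeq using \<sigma>' a by (intro power_mono) auto
    also have "\<dots> \<le> 1458 * C * L * norm (dzeta (Complex \<sigma>' t)) ^ 4" using key \<sigma>' a by auto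
    finally have "(2 * a * C * L) ^ 4 \<le> norm (dzeta (Complex \<sigma>' t)) ^ 4" using L1 C1 by (simp add: mult.commute)
    then show ?thesis using power_mono_iff[of "2 * a * C * L" "norm (dzeta (Complex \<sigma>' t))" 4] a L1 C1 by simp
  qed
  have "a * C * L \<le> norm (dzeta (Complex \<sigma> t))"
  proof (cases "1 + a \<le> \<sigma>")
    case True
    have "0 \<le> a * C * L" using a L1 C1 by simp
    moreover have "2 * (a * C * L) \<le> norm (dzeta (Complex \<sigma> t))" using far[OF True \<sigma>(2)] by (simp add: mult.assoc)
    ultimately show ?thesis by linarith
  next
    case False
    let ?S = "closed_segment (Complex \<sigma> t) (Complex (1 + a) t)"
    have S: "Im z = t \<and> \<sigma> \<le> Re z \<and> Re z \<le> 1 + a" if "z \<in> ?S" for z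
      using that False by (simp add: closed_segment_same_Im closed_segment_eq_real_ivl)
    have "norm (dzeta (Complex (1 + a) t) - dzeta (Complex \<sigma> t)) \<le> (C * L) * norm (Complex (1 + a) t - Complex \<sigma> t)"
    proof (rule field_differentiable_bound[of ?S])
      show "convex ?S" by simp
      fix z assume z: "z \<in> ?S"
      then have z': "1 < Re z" "Re z \<le> 2" "Im z = t" using S[OF z] \<sigma> a by auto
      show "(dzeta has_field_derivative (- dzeta_ln z)) (at z within ?S)"
        by (rule has_field_derivative_at_within[OF dzeta_has_field_derivative[OF z'(1)]])
      show "norm (- dzeta_ln z) \<le> C * L"
        using dzeta_upper_bounds(2)[OF z'(1,2)] t unfolding z'(3) C_def L_def norm_minus_cancel by blast
    qed (rule ends_in_segment)+
    also have "norm (Complex (1 + a) t - Complex \<sigma> t) = 1 + a - \<sigma>"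
    proof -
      have "Complex (1 + a) t - Complex \<sigma> t = of_real (1 + a - \<sigma>)" by (simp add: complex_eq_iff)
      then show ?thesis using False by (simp only: norm_of_real)
    qed
    also have "(C * L) * (1 + a - \<sigma>) \<le> (C * L) * a" using \<sigma> L1 C1 by (intro mult_left_mono) auto
    finally have "norm (dzeta (Complex (1 + a) t)) \<le> norm (dzeta (Complex \<sigma> t)) + C * L * a"
      using norm_triangle_ineq2[of "dzeta (Complex (1 + a) t)" "dzeta (Complex \<sigma> t)"] by linarith
    moreover have "2 * a * C * L \<le> norm (dzeta (Complex (1 + a) t))" using far[of "1 + a"] a by simp
    ultimately show ?thesis by (simp add: mult_ac)
  qed
  moreover have "a * C * L = 1 / (23328 * C ^ 4 * L ^ 4)"
    using L1 C1 by (simp add: a_def field_simps eval_nat_numeral)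
  ultimately show ?thesis by (simp add: L_def)
qed

text \<open>With M = 0 in the approximations and |s| \<le> 2, \<zeta> differs from 1/(s-1) by at
  most 8, which is at most half of the pole when |s-1| \<le> 1/16. The double pole of \<zeta>' is
  compensated by the double zero of 1/\<zeta>^2.\<close>

lemma dmoebius_bounds_near_1:
  assumes s: "1 < Re s" "norm (s - 1) \<le> 1/16"
  shows "norm (dmoebius s) \<le> 5" "norm (dmoebius_ln s) \<le> 5"
proof -
  define r where "r = norm (s - 1)"
  have r: "0 < r" "r \<le> 1/16" using s by (auto simp: r_def)
  have "norm s \<le> norm (s - 1) + norm (1::complex)" using norm_triangle_ineq[of "s - 1" 1] by simp
  then have ns: "norm s \<le> 2" using r by (simp add: r_def)
  have "norm (dzeta s - 1 / (s - 1)) \<le> 8" using dzeta_approx[OF s(1), of 0] ns by simp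
  moreover have "norm (1 / (s - 1)) = 1 / r" by (simp add: r_def norm_divide)
  moreover have "1 / (2 * r) \<ge> 8" using r by (simp add: le_divide_eq)
  moreover have "1 / r = 1 / (2 * r) + 1 / (2 * r)" by (simp add: field_simps)
  moreover have "norm (1 / (s - 1)) \<le> norm (dzeta s) + norm (dzeta s - 1 / (s - 1))"
    using norm_triangle_ineq4[of "dzeta s" "dzeta s - 1 / (s - 1)"] by simp
  ultimately have Z: "norm (dzeta s) \<ge> 1 / (2 * r)" by linarith
  have Gn: "norm (dmoebius s) * norm (dzeta s) = 1"
    using dmoebius_dzeta[OF s(1)] by (metis norm_mult norm_one)
  have "norm (dmoebius s) * (1 / (2 * r)) \<le> norm (dmoebius s) * norm (dzeta s)" using Z by (intro mult_left_mono) auto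
  then have G: "norm (dmoebius s) \<le> 2 * r" using r Gn by (simp add: divide_le_eq)
  then show "norm (dmoebius s) \<le> 5" using r by simp
  have "norm (dzeta_ln s - 1 / (s - 1)\<^sup>2) \<le> 20" using dzeta_ln_approx[OF s(1), of 0] ns by simp
  moreover have "norm (1 / (s - 1)\<^sup>2) = 1 / r\<^sup>2" by (simp add: r_def norm_divide norm_power)
  ultimately have Z1: "norm (dzeta_ln s) \<le> 1 / r\<^sup>2 + 20"
    using norm_triangle_ineq[of "dzeta_ln s - 1 / (s - 1)\<^sup>2" "1 / (s - 1)\<^sup>2"] by simp
  have "norm (dmoebius_ln s) = norm (dzeta_ln s) * norm (dmoebius s) ^ 2"
    unfolding dmoebius_ln_eq[OF s(1)] by (simp add: norm_mult norm_power)
  also have "\<dots> \<le> (1 / r\<^sup>2 + 20) * (2 * r)\<^sup>2" using Z1 G r by (intro mult_mono power_mono) auto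
  also have "\<dots> = 4 + 80 * r\<^sup>2" using r by (simp add: field_simps power2_eq_square)
  also have "r\<^sup>2 \<le> (1/16)\<^sup>2" using r by (intro power_mono) auto
  finally show "norm (dmoebius_ln s) \<le> 5" by (simp add: power2_eq_square)
qed

text \<open>For |t| \<ge> 1/32 the upper and lower bounds for \<zeta> combine to C L (D L^4)^2 = K
  L^9, and L^9 is the fourth root of |t| + 2. For smaller |t|, the range \<sigma> \<le> 1 + 1/32
  places s within 1/16 of the pole.\<close>

lemma dmoebius_bounds:
  obtains K where "K \<ge> 0" "\<And>\<sigma> t. 1 < \<sigma> \<Longrightarrow> \<sigma> \<le> 1 + 1/32 \<Longrightarrow> norm (dmoebius (Complex \<sigma> t)) \<le> K * (\<bar>t\<bar> + 2) powr (1/4)"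
    "\<And>\<sigma> t. 1 < \<sigma> \<Longrightarrow> \<sigma> \<le> 1 + 1/32 \<Longrightarrow> norm (dmoebius_ln (Complex \<sigma> t)) \<le> K * (\<bar>t\<bar> + 2) powr (1/4)"
proof -
  define C :: real where "C = 60000"
  define D where "D = 23328 * C ^ 4"
  define K where "K = C * D ^ 2"
  have C1: "C \<ge> 1" by (simp add: C_def)
  have D1: "D \<ge> 1" using one_le_power[OF C1, of 4] by (simp add: D_def)
  have DD: "D \<le> D\<^sup>2" using D1 by (simp add: power2_eq_square)
  have DK: "D \<le> K" using mult_mono[of 1 C D "D\<^sup>2"] C1 D1 DD by (simp add: K_def)
  have K5: "K \<ge> 5" using DK one_le_power[OF C1, of 4] by (simp add: D_def)
  have both: "norm (dmoebius (Complex \<sigma> t)) \<le> K * (\<bar>t\<bar> + 2) powr (1/4) \<and> norm (dmoebius_ln (Complex \<sigma> t)) \<le> K * (\<bar>t\<bar> + 2) powr (1/4)"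
    if \<sigma>: "1 < \<sigma>" "\<sigma> \<le> 1 + 1/32" for \<sigma> t
  proof (cases "1/32 \<le> \<bar>t\<bar>")
    case True
    define L where "L = (\<bar>t\<bar> + 2) powr (1/36)"
    have L1: "L \<ge> 1" unfolding L_def by (intro ge_one_powr_ge_zero) auto
    have L9: "L ^ 9 = (\<bar>t\<bar> + 2) powr (1/4)" by (simp add: L_def powr_power)
    let ?s = "Complex \<sigma> t"
    have s: "1 < Re ?s" "Re ?s \<le> 2" using \<sigma> by auto
    have Z: "norm (dzeta ?s) \<ge> 1 / (D * L ^ 4)"
      using dzeta_lower_bound[of \<sigma> t] \<sigma> True by (simp add: D_def C_def L_def mult_ac)
    have Gn: "norm (dmoebius ?s) * norm (dzeta ?s) = 1"
      using dmoebius_dzeta[OF s(1)] by (metis norm_mult norm_one)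
    have "norm (dmoebius ?s) * (1 / (D * L ^ 4)) \<le> norm (dmoebius ?s) * norm (dzeta ?s)" using Z by (intro mult_left_mono) auto
    then have G: "norm (dmoebius ?s) \<le> D * L ^ 4" using Gn D1 L1 by (simp add: divide_le_eq)
    also have "\<dots> \<le> K * L ^ 9" using DK D1 L1 by (intro mult_mono power_increasing) auto
    finally have 1: "norm (dmoebius ?s) \<le> K * L ^ 9" .
    have "norm (dmoebius_ln ?s) = norm (dzeta_ln ?s) * norm (dmoebius ?s) ^ 2"
      unfolding dmoebius_ln_eq[OF s(1)] by (simp add: norm_mult norm_power)
    also have "\<dots> \<le> (C * L) * (D * L ^ 4)\<^sup>2"
      using dzeta_upper_bounds(2)[OF s] True G L1 C1 by (intro mult_mono power_mono) (auto simp: C_def L_def)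
    also have "\<dots> = K * L ^ 9" by (simp add: K_def power_mult_distrib eval_nat_numeral)
    finally show ?thesis using 1 L9 by simp
  next
    case False
    have "norm (Complex \<sigma> t - 1) \<le> \<bar>Re (Complex \<sigma> t - 1)\<bar> + \<bar>Im (Complex \<sigma> t - 1)\<bar>" by (rule cmod_le)
    also have "\<dots> \<le> 1/16" using False \<sigma> by simp
    finally have n: "norm (Complex \<sigma> t - 1) \<le> 1/16" .
    have "1 \<le> (\<bar>t\<bar> + 2) powr (1/4)" by (intro ge_one_powr_ge_zero) auto
    then have "5 \<le> K * (\<bar>t\<bar> + 2) powr (1/4)" using K5 mult_mono[of 5 K 1 "(\<bar>t\<bar> + 2) powr (1/4)"] by simp
    then show ?thesis using dmoebius_bounds_near_1[of "Complex \<sigma> t"] n \<sigma> by simp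
  qed
  show ?thesis by (rule that[of K]) (use both K5 in auto)
qed

section \<open>Plancherel's inequality\<close>

lemma borel_measurable_cis [measurable (raw)]:
  "f \<in> borel_measurable M \<Longrightarrow> (\<lambda>x. cis (f x)) \<in> borel_measurable M"
  by (rule measurable_compose[of f _ borel], assumption)
    (intro borel_measurable_continuous_onI continuous_intros)

text \<open>Smoothing with a Gaussian of width \<open>\<delta>\<close>, which is its own Fourier transform, gives an identity in
  which both sides are absolutely integrable; then \<open>\<delta>\<close> tends to 0.\<close>

lemma Plancherel_inequality:
  fixes h :: "real \<Rightarrow> real" and H :: "real \<Rightarrow> complex"
  assumes h: "integrable lborel h" and bd: "\<And>u. \<bar>h u\<bar> \<le> B"
    and cont: "AE u in lborel. isCont h u"
    and H: "\<And>t. H t = (\<integral>u. of_real (h u) * cis (- (t * u)) \<partial>lborel)"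
    and HI: "integrable lborel (\<lambda>t. (norm (H t))\<^sup>2)"
  shows "(\<integral>u. (h u)\<^sup>2 \<partial>lborel) \<le> (\<integral>t. (norm (H t))\<^sup>2 \<partial>lborel) / (2 * pi)"
proof -
  let ?I = "\<integral>t. (norm (H t))\<^sup>2 \<partial>lborel"
  have hm[measurable]: "h \<in> borel_measurable borel" using h by simp
  have B0: "B \<ge> 0" using bd[of 0] by linarith
  interpret N: real_distribution std_normal_distribution by (rule real_dist_normal_dist)
  interpret P: pair_sigma_finite std_normal_distribution "lborel \<Otimes>\<^sub>M lborel :: (real \<times> real) measure"
    by unfold_locales
  have hc: "integrable lborel (\<lambda>u. of_real (h u) * cis (a * u))" for a
    by (rule Bochner_Integration.integrable_bound[OF h]) (auto simp: norm_mult)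
  have Hm[measurable]: "H \<in> borel_measurable borel"
    unfolding H[abs_def] by measurable
  have G: "integrable (lborel \<Otimes>\<^sub>M lborel) (\<lambda>(u,v). of_real (h u * h v) * cis (a * (v - u)))" for a
  proof (rule lborel_pair.Fubini_integrable)
    have "(\<integral>v. norm (of_real (h u * h v) * cis (a * (v - u))) \<partial>lborel) = \<bar>h u\<bar> * (\<integral>v. \<bar>h v\<bar> \<partial>lborel)" for u
      by (simp add: norm_mult abs_mult)
    then show "integrable lborel (\<lambda>u. \<integral>v. norm (case (u, v) of (u,v) \<Rightarrow> of_real (h u * h v) * cis (a * (v - u))) \<partial>lborel)"
      using h by simp
    show "AE u in lborel. integrable lborel (\<lambda>v. case (u, v) of (u,v) \<Rightarrow> of_real (h u * h v) * cis (a * (v - u)))"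
    proof (rule AE_I2)
      fix u
      show "integrable lborel (\<lambda>v. case (u, v) of (u,v) \<Rightarrow> of_real (h u * h v) * cis (a * (v - u)))"
        by (rule Bochner_Integration.integrable_bound[OF integrable_mult_right[OF h, of "h u"]]) (auto simp: norm_mult)
    qed
  qed measurable
  \<comment> \<open>The square |H(a)|^2 is written as a double integral over (u,v), so that the
    Gaussian average over a can be carried out first.\<close>
  have sq: "(\<integral>p. (case p of (u,v) \<Rightarrow> of_real (h u * h v) * cis (a * (v - u))) \<partial>(lborel \<Otimes>\<^sub>M lborel)) = of_real ((norm (H a))\<^sup>2)" for a
  proof -
    have "(\<integral>p. (case p of (u,v) \<Rightarrow> of_real (h u * h v) * cis (a * (v - u))) \<partial>(lborel \<Otimes>\<^sub>M lborel))
       = (\<integral>u. \<integral>v. of_real (h u * h v) * cis (a * (v - u)) \<partial>lborel \<partial>lborel)"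
      using lborel_pair.integral_fst'[OF G] by simp
    also have "\<dots> = (\<integral>u. \<integral>v. (of_real (h u) * cis (- (a * u))) * (of_real (h v) * cis (a * v)) \<partial>lborel \<partial>lborel)"
    proof -
      have "of_real (h u * h v) * cis (a * (v - u)) = (of_real (h u) * cis (- (a * u))) * (of_real (h v) * cis (a * v))" for u v
      proof -
        have "cis (a * (v - u)) = cis (- (a * u)) * cis (a * v)" unfolding cis_mult by (simp add: algebra_simps)
        then show ?thesis by (simp add: mult_ac)
      qed
      then show ?thesis by presburger
    qed
    also have "\<dots> = H a * (\<integral>v. of_real (h v) * cis (a * v) \<partial>lborel)" by (simp add: H)
    also have "(\<integral>v. of_real (h v) * cis (a * v) \<partial>lborel) = cnj (H a)"
    proof -
      have "cnj (H a) = (\<integral>u. cnj (of_real (h u) * cis (- (a * u))) \<partial>lborel)" 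
        unfolding H using integral_bounded_linear[OF bounded_linear_cnj hc[of "- a"]] by simp
      then show ?thesis by (simp add: cis_cnj)
    qed
    finally show ?thesis by (simp only: complex_norm_square)
  qed
  \<comment> \<open>Averaging |H(t/\<delta>)|^2 over a standard normal t weights frequencies by a
    Gaussian of width 1/\<delta>; in the variables u and v this becomes a Gaussian of width \<delta>
    in v - u.\<close>
  have bound: "(\<integral>u. h u * (\<integral>w. h (u + \<delta> * w) * std_normal_density w \<partial>lborel) \<partial>lborel) \<le> ?I / (2 * pi)" if \<delta>: "\<delta> > 0" for \<delta>
  proof -
    let ?F = "\<lambda>t p. case p of (u,v) \<Rightarrow> complex_of_real (h u * h v) * cis ((t / \<delta>) * (v - u))"
    have FI: "integrable (std_normal_distribution \<Otimes>\<^sub>M (lborel \<Otimes>\<^sub>M lborel)) (\<lambda>(t,p). ?F t p)"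
    proof (rule P.Fubini_integrable)
      have "(\<integral>p. norm (?F t p) \<partial>(lborel \<Otimes>\<^sub>M lborel)) = (\<integral>p. norm (?F 0 p) \<partial>(lborel \<Otimes>\<^sub>M lborel))" for t
        by (simp add: case_prod_unfold norm_mult)
      then show "integrable std_normal_distribution (\<lambda>t. \<integral>p. norm (case (t, p) of (t,p) \<Rightarrow> ?F t p) \<partial>(lborel \<Otimes>\<^sub>M lborel))"
        by simp
      show "AE t in std_normal_distribution. integrable (lborel \<Otimes>\<^sub>M lborel) (\<lambda>p. case (t, p) of (t,p) \<Rightarrow> ?F t p)"
      proof (rule AE_I2)
        show "integrable (lborel \<Otimes>\<^sub>M lborel) (\<lambda>p. case (t, p) of (t,p) \<Rightarrow> ?F t p)" for t
          using G[of "t / \<delta>"] by (simp only: prod.case)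
      qed
    qed measurable
    have charN: "(\<integral>t. cis ((t / \<delta>) * (v - u)) \<partial>std_normal_distribution) = of_real (sqrt (2 * pi) * std_normal_density ((v - u) / \<delta>))" for u v
    proof -
      have "(\<integral>t. cis ((t / \<delta>) * (v - u)) \<partial>std_normal_distribution) = char std_normal_distribution ((v - u) / \<delta>)"
      proof -
        have "cis ((t / \<delta>) * (v - u)) = iexp ((v - u) / \<delta> * t)" for t
          unfolding cis_conv_exp by (simp add: mult.commute)
        then show ?thesis unfolding char_def by presburger
      qed
      also have "\<dots> = of_real (exp (- ((v - u) / \<delta>)\<^sup>2 / 2))" by (simp add: char_std_normal_distribution)
      also have "exp (- ((v - u) / \<delta>)\<^sup>2 / 2) = sqrt (2 * pi) * std_normal_density ((v - u) / \<delta>)"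
        by (simp add: std_normal_density_def)
      finally show ?thesis .
    qed
    have swap: "(\<integral>p. (\<integral>t. ?F t p \<partial>std_normal_distribution) \<partial>(lborel \<Otimes>\<^sub>M lborel)) = (\<integral>t. (\<integral>p. ?F t p \<partial>(lborel \<Otimes>\<^sub>M lborel)) \<partial>std_normal_distribution)"
      by (rule P.Fubini_integral[OF FI])
    have left: "(\<integral>p. (\<integral>t. ?F t p \<partial>std_normal_distribution) \<partial>(lborel \<Otimes>\<^sub>M lborel))
       = of_real (\<integral>p. (case p of (u,v) \<Rightarrow> h u * h v * (sqrt (2 * pi) * std_normal_density ((v - u) / \<delta>))) \<partial>(lborel \<Otimes>\<^sub>M lborel))"
    proof -
      have "(\<integral>t. ?F t p \<partial>std_normal_distribution) = of_real (case p of (u,v) \<Rightarrow> h u * h v * (sqrt (2 * pi) * std_normal_density ((v - u) / \<delta>)))" for p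
        by (cases p) (simp only: prod.case integral_mult_right_zero charN of_real_mult)
      then show ?thesis by (simp only: integral_complex_of_real)
    qed
    have right: "(\<integral>t. (\<integral>p. ?F t p \<partial>(lborel \<Otimes>\<^sub>M lborel)) \<partial>std_normal_distribution)
       = of_real (\<integral>t. (norm (H (t / \<delta>)))\<^sup>2 \<partial>std_normal_distribution)"
      unfolding sq by (rule integral_complex_of_real)
    have eq: "(\<integral>p. (case p of (u,v) \<Rightarrow> h u * h v * (sqrt (2 * pi) * std_normal_density ((v - u) / \<delta>))) \<partial>(lborel \<Otimes>\<^sub>M lborel))
      = (\<integral>t. (norm (H (t / \<delta>)))\<^sup>2 \<partial>std_normal_distribution)"
      using swap unfolding left right by (simp only: of_real_eq_iff)
    \<comment> \<open>Replacing the Gaussian by its maximum turns the identity into an inequality.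
      The factor 1/sqrt(2\<pi>) here and the factor sqrt(2\<pi>) on the other side combine to
      1/(2\<pi>).\<close>
    have phi_le: "std_normal_density x \<le> 1 / sqrt (2 * pi)" for x
      by (simp add: std_normal_density_def divide_right_mono)
    have Hd: "integrable lborel (\<lambda>t. (norm (H (t / \<delta>)))\<^sup>2)" "(\<integral>t. (norm (H (t / \<delta>)))\<^sup>2 \<partial>lborel) = \<delta> * ?I"
      using lborel_integrable_real_affine[OF HI, of "1/\<delta>" 0] lborel_integral_real_affine[of "1/\<delta>" "\<lambda>t. (norm (H t))\<^sup>2" 0] \<delta>
      by (simp_all add: field_simps)
    have phiH: "std_normal_density t * (norm (H (t / \<delta>)))\<^sup>2 \<le> 1 / sqrt (2 * pi) * (norm (H (t / \<delta>)))\<^sup>2" for t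
      by (intro mult_right_mono phi_le) simp
    have "(\<integral>t. (norm (H (t / \<delta>)))\<^sup>2 \<partial>std_normal_distribution) = (\<integral>t. std_normal_density t * (norm (H (t / \<delta>)))\<^sup>2 \<partial>lborel)"
      by (subst integral_density) auto
    also have "\<dots> \<le> (\<integral>t. (1 / sqrt (2 * pi)) * (norm (H (t / \<delta>)))\<^sup>2 \<partial>lborel)"
    proof (rule integral_mono)
      show "integrable lborel (\<lambda>t. 1 / sqrt (2 * pi) * (norm (H (t / \<delta>)))\<^sup>2)" using Hd by simp
      show "integrable lborel (\<lambda>t. std_normal_density t * (norm (H (t / \<delta>)))\<^sup>2)"
        by (rule Bochner_Integration.integrable_bound[OF integrable_mult_right[OF Hd(1), of "1 / sqrt (2 * pi)"]])
          (use phiH in \<open>auto simp: abs_mult\<close>)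
    qed (rule phiH)
    also have "\<dots> = \<delta> * ?I / sqrt (2 * pi)" using Hd by simp
    finally have le: "(\<integral>p. (case p of (u,v) \<Rightarrow> h u * h v * (sqrt (2 * pi) * std_normal_density ((v - u) / \<delta>))) \<partial>(lborel \<Otimes>\<^sub>M lborel)) \<le> \<delta> * ?I / sqrt (2 * pi)"
      unfolding eq .
    have GI: "integrable (lborel \<Otimes>\<^sub>M lborel) (\<lambda>(u,v). h u * h v * (sqrt (2 * pi) * std_normal_density ((v - u) / \<delta>)))"
    proof (rule Bochner_Integration.integrable_bound[OF G[of 0]])
      have abs_le: "\<bar>h u * h v * (sqrt (2 * pi) * std_normal_density ((v - u) / \<delta>))\<bar> \<le> \<bar>h u * h v\<bar>" for u v
      proof -
        have "sqrt (2 * pi) * std_normal_density ((v - u) / \<delta>) \<le> 1"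
          using phi_le[of "(v - u) / \<delta>"] by (simp add: field_simps)
        then show ?thesis unfolding abs_mult[of "h u * h v"] by (intro mult_left_le) auto
      qed
      show "AE p in lborel \<Otimes>\<^sub>M lborel. norm (case p of (u,v) \<Rightarrow> h u * h v * (sqrt (2 * pi) * std_normal_density ((v - u) / \<delta>)))
         \<le> norm (case p of (u,v) \<Rightarrow> complex_of_real (h u * h v) * cis (0 * (v - u)))"
      proof (rule AE_I2)
        fix p :: "real \<times> real"
        obtain u v where p: "p = (u, v)" by (cases p)
        have "norm (complex_of_real (h u * h v) * cis (0 * (v - u))) = \<bar>h u * h v\<bar>"
          by (simp add: norm_mult abs_mult)
        then show "norm (case p of (u,v) \<Rightarrow> h u * h v * (sqrt (2 * pi) * std_normal_density ((v - u) / \<delta>)))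
           \<le> norm (case p of (u,v) \<Rightarrow> complex_of_real (h u * h v) * cis (0 * (v - u)))"
          using abs_le[of u v] by (simp only: p prod.case real_norm_def)
      qed
    qed measurable
    have "(\<integral>p. (case p of (u,v) \<Rightarrow> h u * h v * (sqrt (2 * pi) * std_normal_density ((v - u) / \<delta>))) \<partial>(lborel \<Otimes>\<^sub>M lborel))
      = (\<integral>u. \<integral>v. h u * h v * (sqrt (2 * pi) * std_normal_density ((v - u) / \<delta>)) \<partial>lborel \<partial>lborel)"
      using lborel_pair.integral_fst'[OF GI] by simp
    also have "\<dots> = (\<integral>u. (sqrt (2 * pi) * \<delta>) * (h u * (\<integral>w. h (u + \<delta> * w) * std_normal_density w \<partial>lborel)) \<partial>lborel)"
    proof -
      have "(\<integral>v. h u * h v * (sqrt (2 * pi) * std_normal_density ((v - u) / \<delta>)) \<partial>lborel)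
         = (sqrt (2 * pi) * \<delta>) * (h u * (\<integral>w. h (u + \<delta> * w) * std_normal_density w \<partial>lborel))" for u
      proof -
        have "(\<integral>v. h u * h v * (sqrt (2 * pi) * std_normal_density ((v - u) / \<delta>)) \<partial>lborel)
           = h u * sqrt (2 * pi) * (\<integral>v. h v * std_normal_density ((v - u) / \<delta>) \<partial>lborel)"
          by (subst integral_mult_right_zero[symmetric]) (simp add: mult_ac)
        also have "(\<integral>v. h v * std_normal_density ((v - u) / \<delta>) \<partial>lborel) = \<delta> * (\<integral>w. h (u + \<delta> * w) * std_normal_density w \<partial>lborel)"
          using \<delta> by (subst lborel_integral_real_affine[of \<delta> _ u]) auto
        finally show ?thesis by (simp add: mult_ac)
      qed
      then show ?thesis by simp
    qed
    also have "\<dots> = (sqrt (2 * pi) * \<delta>) * (\<integral>u. h u * (\<integral>w. h (u + \<delta> * w) * std_normal_density w \<partial>lborel) \<partial>lborel)"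
      by simp
    finally have "(sqrt (2 * pi) * \<delta>) * (\<integral>u. h u * (\<integral>w. h (u + \<delta> * w) * std_normal_density w \<partial>lborel) \<partial>lborel) \<le> \<delta> * ?I / sqrt (2 * pi)"
      using le by simp
    moreover have "X \<le> I / (2 * pi)" if X: "(sqrt (2 * pi) * \<delta>) * X \<le> \<delta> * I / sqrt (2 * pi)" for X I :: real
    proof -
      define q where "q = sqrt (2 * pi)"
      have q: "q > 0" "q * q = 2 * pi" by (simp_all add: q_def)
      have "\<delta> * (q * q * X) \<le> \<delta> * I" using X q(1) unfolding q_def[symmetric] by (simp add: field_simps)
      then have "2 * pi * X \<le> I" using \<delta> unfolding q(2) by simp
      then show ?thesis by (simp add: field_simps)
    qed
    ultimately show ?thesis by blast
  qed
  define \<delta> :: "nat \<Rightarrow> real" where "\<delta> n = 1 / real (Suc n)" for n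
  have \<delta>0: "\<delta> \<longlonglongrightarrow> 0" unfolding \<delta>_def by (rule LIMSEQ_Suc[OF lim_1_over_n])
  have \<delta>_pos: "\<delta> n > 0" for n by (simp add: \<delta>_def)
  have phiI: "integrable lborel std_normal_density" by (rule integrable_normal_density) simp
  have phi1: "(\<integral>w. std_normal_density w \<partial>lborel) = 1" by (rule integral_normal_density) simp
  \<comment> \<open>The Gaussian averages form an approximate identity, which recovers h at its
    points of continuity; B times the normal density dominates.\<close>
  have inner: "(\<lambda>n. \<integral>w. h (u + \<delta> n * w) * std_normal_density w \<partial>lborel) \<longlonglongrightarrow> h u" if u: "isCont h u" for u
  proof -
    have "(\<lambda>n. \<integral>w. h (u + \<delta> n * w) * std_normal_density w \<partial>lborel) \<longlonglongrightarrow> (\<integral>w. h u * std_normal_density w \<partial>lborel)"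
    proof (rule integral_dominated_convergence[where w = "\<lambda>w. B * std_normal_density w"])
      show "AE w in lborel. (\<lambda>n. h (u + \<delta> n * w) * std_normal_density w) \<longlonglongrightarrow> h u * std_normal_density w"
      proof (intro AE_I2 tendsto_mult tendsto_const isCont_tendsto_compose[OF u])
        fix w
        have "(\<lambda>n. u + \<delta> n * w) \<longlonglongrightarrow> u + 0 * w" by (intro tendsto_intros \<delta>0)
        then show "(\<lambda>n. u + \<delta> n * w) \<longlonglongrightarrow> u" by simp
      qed
      show "AE w in lborel. norm (h (u + \<delta> n * w) * std_normal_density w) \<le> B * std_normal_density w" for n
        by (auto simp: abs_mult intro!: mult_right_mono bd)
    qed (use phiI in auto)
    then show ?thesis using phi1 by simp
  qed
  have inner_bd: "\<bar>\<integral>w. h (u + \<delta> n * w) * std_normal_density w \<partial>lborel\<bar> \<le> B" for u n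
  proof -
    have i: "integrable lborel (\<lambda>w. h (u + \<delta> n * w) * std_normal_density w)"
      by (rule Bochner_Integration.integrable_bound[OF integrable_mult_right[OF phiI, of B]])
        (auto simp: abs_mult B0 intro!: mult_right_mono bd)
    have "\<bar>\<integral>w. h (u + \<delta> n * w) * std_normal_density w \<partial>lborel\<bar> \<le> (\<integral>w. \<bar>h (u + \<delta> n * w) * std_normal_density w\<bar> \<partial>lborel)"
      by (rule integral_abs_bound)
    also have "\<dots> \<le> (\<integral>w. B * std_normal_density w \<partial>lborel)"
    proof (rule integral_mono)
      show "integrable lborel (\<lambda>w. \<bar>h (u + \<delta> n * w) * std_normal_density w\<bar>)" by (rule integrable_abs[OF i])
      show "\<bar>h (u + \<delta> n * w) * std_normal_density w\<bar> \<le> B * std_normal_density w" for w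
        unfolding abs_mult using bd by (auto intro!: mult_right_mono)
    qed (use phiI in auto)
    finally show ?thesis using phi1 by simp
  qed
  have "(\<lambda>n. \<integral>u. h u * (\<integral>w. h (u + \<delta> n * w) * std_normal_density w \<partial>lborel) \<partial>lborel) \<longlonglongrightarrow> (\<integral>u. h u * h u \<partial>lborel)"
  proof (rule integral_dominated_convergence[where w = "\<lambda>u. B * \<bar>h u\<bar>"])
    show "AE u in lborel. (\<lambda>n. h u * (\<integral>w. h (u + \<delta> n * w) * std_normal_density w \<partial>lborel)) \<longlonglongrightarrow> h u * h u"
      using cont by eventually_elim (intro tendsto_mult tendsto_const inner)
    show "AE u in lborel. norm (h u * (\<integral>w. h (u + \<delta> n * w) * std_normal_density w \<partial>lborel)) \<le> B * \<bar>h u\<bar>" for n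
      using inner_bd by (auto simp: abs_mult mult.commute[of B] intro!: mult_left_mono)
  qed (use h in auto)
  then show ?thesis unfolding power2_eq_square[of "h _"]
    by (rule LIMSEQ_le_const2) (intro exI allI impI bound \<delta>_pos)
qed

section \<open>Laplace integrals of step functions with a linear weight\<close>

lemma linear_exp_real_integral:
  fixes a \<sigma> :: real
  assumes \<sigma>: "\<sigma> > 0" and a: "a \<ge> 0"
  shows "set_integrable lborel {a<..} (\<lambda>u. u * exp (- (\<sigma> * u)))"
    "(\<integral>u. indicator {a<..} u * (u * exp (- (\<sigma> * u))) \<partial>lborel) = exp (- (\<sigma> * a)) * (a / \<sigma> + 1 / \<sigma>\<^sup>2)"
proof -
  define F where "F u = - (exp (- (\<sigma> * u)) * (u / \<sigma> + 1 / \<sigma>\<^sup>2))" for u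
  have "isCont F a" unfolding F_def by (intro continuous_intros) (use \<sigma> in auto)
  then have "(F \<longlongrightarrow> F a) (at a)" by (simp add: isCont_def)
  then have "(F \<longlongrightarrow> F a) (at_right a)" by (rule filterlim_mono) (auto simp: at_le)
  then have A: "((F \<circ> real_of_ereal) \<longlongrightarrow> F a) (at_right (ereal a))" by (simp add: ereal_tendsto_simps)
  have "(F \<longlongrightarrow> 0) at_top" unfolding F_def using \<sigma> by real_asymp
  then have B: "((F \<circ> real_of_ereal) \<longlongrightarrow> 0) (at_left \<infinity>)" by (simp add: ereal_tendsto_simps)
  have der: "DERIV F u :> u * exp (- (\<sigma> * u))" for u
    unfolding F_def using \<sigma> by (auto intro!: derivative_eq_intros simp: field_simps power2_eq_square)
  have cont: "isCont (\<lambda>u. u * exp (- (\<sigma> * u))) u" for u by (intro continuous_intros)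
  have nn: "AE u in lborel. ereal a < ereal u \<longrightarrow> ereal u < \<infinity> \<longrightarrow> 0 \<le> u * exp (- (\<sigma> * u))" using a by auto
  have ei: "einterval (ereal a) \<infinity> = {a<..}" by (auto simp: einterval_def)
  note FTC = interval_integral_FTC_nonneg[OF _ der cont nn A B]
  show "set_integrable lborel {a<..} (\<lambda>u. u * exp (- (\<sigma> * u)))" using FTC(1) by (simp add: ei)
  show "(\<integral>u. indicator {a<..} u * (u * exp (- (\<sigma> * u))) \<partial>lborel) = exp (- (\<sigma> * a)) * (a / \<sigma> + 1 / \<sigma>\<^sup>2)"
    using FTC(2) by (simp add: interval_lebesgue_integral_def set_lebesgue_integral_def ei F_def)
qed

text \<open>With a = ln n this is the transform of the single jump at n: n^(-s) (ln n / s + 1/s^2).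
  The first term later collects to the series with \<mu>(n) ln n, the second to the one with
  \<mu>(n).\<close>

lemma linear_exp_complex_integral:
  fixes a :: real and s :: complex
  assumes s: "Re s > 0" and a: "a \<ge> 0"
  shows "integrable lborel (\<lambda>u. indicator {a<..} u *\<^sub>R (of_real u * exp (- (s * of_real u))))"
    "(\<integral>u. indicator {a<..} u *\<^sub>R (of_real u * exp (- (s * of_real u))) \<partial>lborel) = exp (- (s * of_real a)) * (of_real a / s + 1 / s\<^sup>2)"
proof -
  have s0: "s \<noteq> 0" using s by auto
  show I: "integrable lborel (\<lambda>u. indicator {a<..} u *\<^sub>R (of_real u * exp (- (s * of_real u))))"
  proof (rule Bochner_Integration.integrable_bound)
    show "integrable lborel (\<lambda>u. indicator {a<..} u *\<^sub>R (u * exp (- (Re s * u))))"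
      using linear_exp_real_integral(1)[OF s a] by (simp add: set_integrable_def)
    show "AE u in lborel. norm (indicator {a<..} u *\<^sub>R (complex_of_real u * exp (- (s * of_real u)))) \<le> norm (indicator {a<..} u *\<^sub>R (u * exp (- (Re s * u))))"
      by (auto simp: norm_mult indicator_def)
  qed measurable
  define F where "F u = - (exp (- (s * of_real u)) * (of_real u / s + 1 / s\<^sup>2))" for u :: real
  have der: "(F has_vector_derivative (of_real u * exp (- (s * of_real u)))) (at u)" for u
  proof -
    have "((\<lambda>z. - (exp (- (s * z)) * (z / s + 1 / s\<^sup>2))) has_field_derivative (of_real u * exp (- (s * of_real u)))) (at (of_real u))"
      using s0 by (auto intro!: derivative_eq_intros simp: field_simps power2_eq_square)
    then have "((\<lambda>z. - (exp (- (s * z)) * (z / s + 1 / s\<^sup>2))) \<circ> of_real has_vector_derivative (1 * (of_real u * exp (- (s * of_real u))))) (at u)"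
      by (intro field_vector_diff_chain_at) (auto intro!: has_vector_derivative_of_real derivative_eq_intros)
    moreover have "(\<lambda>z. - (exp (- (s * z)) * (z / s + 1 / s\<^sup>2))) \<circ> of_real = F" by (auto simp: F_def)
    ultimately show ?thesis by simp
  qed
  have "isCont F a" using der[of a] has_vector_derivative_continuous by blast
  then have "(F \<longlongrightarrow> F a) (at a)" by (simp add: isCont_def)
  then have "(F \<longlongrightarrow> F a) (at_right a)" by (rule filterlim_mono) (auto simp: at_le)
  then have A: "((F \<circ> real_of_ereal) \<longlongrightarrow> F a) (at_right (ereal a))" by (simp add: ereal_tendsto_simps)
  have "((\<lambda>u. exp (- (Re s * u)) * (u / norm s + 1 / (norm s)\<^sup>2)) \<longlongrightarrow> 0) at_top"
    using s s0 by real_asymp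
  then have "(F \<longlongrightarrow> 0) at_top"
  proof (rule Lim_null_comparison[rotated])
    show "\<forall>\<^sub>F u in at_top. norm (F u) \<le> exp (- (Re s * u)) * (u / norm s + 1 / (norm s)\<^sup>2)"
      using eventually_ge_at_top[of 0]
    proof eventually_elim
      case (elim u)
      have "norm (F u) = exp (- (Re s * u)) * norm (of_real u / s + 1 / s\<^sup>2)"
        by (simp add: F_def norm_mult)
      also have "\<dots> \<le> exp (- (Re s * u)) * (norm (of_real u / s) + norm (1 / s\<^sup>2))"
        by (intro mult_left_mono norm_triangle_ineq) auto
      finally show ?case using elim by (simp add: norm_divide norm_power)
    qed
  qed
  then have B: "((F \<circ> real_of_ereal) \<longlongrightarrow> 0) (at_left \<infinity>)" by (simp add: ereal_tendsto_simps)
  have ei: "einterval (ereal a) \<infinity> = {a<..}" by (auto simp: einterval_def)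
  have "(LBINT u=ereal a..\<infinity>. of_real u * exp (- (s * of_real u))) = 0 - F a"
  proof (rule interval_integral_FTC_integrable[OF _ der _ _ A B])
    show "isCont (\<lambda>u. complex_of_real u * exp (- (s * of_real u))) u" for u by (intro continuous_intros)
    show "set_integrable lborel (einterval (ereal a) \<infinity>) (\<lambda>u. complex_of_real u * exp (- (s * of_real u)))"
      using I by (simp add: set_integrable_def ei)
  qed simp
  then show "(\<integral>u. indicator {a<..} u *\<^sub>R (of_real u * exp (- (s * of_real u))) \<partial>lborel) = exp (- (s * of_real a)) * (of_real a / s + 1 / s\<^sup>2)"
    by (simp add: interval_lebesgue_integral_def set_lebesgue_integral_def ei F_def)
qed

lemma integrable_abs_plus_2_powr: "integrable lborel (\<lambda>t::real. (\<bar>t\<bar> + 2) powr (-3/2))"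
proof -
  \<comment> \<open>The half-line starts at -1 so that 0 lies inside it; \<open>g\<close> and its
    reflection together dominate the even function.\<close>
  define g where "g t = indicator {-1<..} t *\<^sub>R ((t + 2) powr (-3/2))" for t :: real
  define F where "F t = -2 * (t + 2) powr (-1/2)" for t :: real
  have "isCont F (-1)" unfolding F_def by (intro continuous_intros) auto
  then have "(F \<longlongrightarrow> F (-1)) (at (-1))" by (simp add: isCont_def)
  then have "(F \<longlongrightarrow> F (-1)) (at_right (-1))" by (rule filterlim_mono) (auto simp: at_le)
  then have A: "((F \<circ> real_of_ereal) \<longlongrightarrow> F (-1)) (at_right (ereal (-1)))" by (subst ereal_tendsto_simps) simp
  have "(F \<longlongrightarrow> 0) at_top" unfolding F_def by real_asymp
  then have B: "((F \<circ> real_of_ereal) \<longlongrightarrow> 0) (at_left \<infinity>)" by (simp add: ereal_tendsto_simps)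
  have "set_integrable lborel (einterval (ereal (-1)) \<infinity>) (\<lambda>t. (t + 2) powr (-3/2))"
  proof (rule interval_integral_FTC_nonneg(1)[OF _ _ _ _ A B])
    fix t assume "ereal (-1) < ereal t"
    then have t: "t > -1" by simp
    show "DERIV F t :> (t + 2) powr (-3/2)"
      unfolding F_def using t by (auto intro!: derivative_eq_intros)
    show "isCont (\<lambda>t. (t + 2) powr (-3/2)) t" using t by (intro continuous_intros) auto
  qed auto
  moreover have "einterval (ereal (-1)) \<infinity> = {-1<..}" by (auto simp: einterval_def)
  ultimately have g: "integrable lborel g" unfolding g_def set_integrable_def by simp
  have g': "integrable lborel (\<lambda>t. g (0 + (-1) * t))" by (rule lborel_integrable_real_affine[OF g]) simp
  show ?thesis
  proof (rule Bochner_Integration.integrable_bound[OF Bochner_Integration.integrable_add[OF g g']])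
    show "AE t in lborel. norm ((\<bar>t\<bar> + 2) powr (-3/2)) \<le> norm (g t + g (0 + (-1) * t))"
    proof (rule AE_I2)
      fix t :: real
      have nn: "0 \<le> g u" for u by (simp add: g_def)
      have "(\<bar>t\<bar> + 2) powr (-3/2) \<le> g t + g (- t)"
        using nn[of t] nn[of "- t"] by (cases "t \<ge> 0") (simp_all add: g_def)
      then show "norm ((\<bar>t\<bar> + 2) powr (-3/2)) \<le> norm (g t + g (0 + (-1) * t))"
        using nn[of t] nn[of "- t"] by simp
    qed
  qed measurable
qed

section \<open>Summability of the Mertens function\<close>

text \<open>\<open>moebius_step u\<close> is the Mertens function at \<open>exp u\<close>, except at the jumps \<open>u = ln k\<close>, which are counted
  only to the right.\<close>

definition moebius_step :: "real \<Rightarrow> real" where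
  "moebius_step u = (\<Sum>n. real_of_int (moebius (Suc n)) * indicator {ln (real (Suc n))<..} u)"

lemma moebius_step_eq_sum:
  assumes "u \<le> ln (real (Suc N))"
  shows "moebius_step u = (\<Sum>n<N. real_of_int (moebius (Suc n)) * indicator {ln (real (Suc n))<..} u)"
  unfolding moebius_step_def
proof (rule suminf_finite)
  fix n assume "n \<notin> {..<N}"
  then have "ln (real (Suc N)) \<le> ln (real (Suc n))" by simp
  with assms have "u \<le> ln (real (Suc n))" by (rule order.trans)
  then have "u \<notin> {ln (real (Suc n))<..}" by (simp only: greaterThan_iff not_less)
  then show "real_of_int (moebius (Suc n)) * indicator {ln (real (Suc n))<..} u = 0"
    by (simp only: indicator_simps mult_zero_right not_False_eq_True)
qed simp

lemma moebius_step_eq_mertens: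
  assumes k: "k \<ge> 1" and u: "ln (real k) < u" "u \<le> ln (real (Suc k))"
  shows "moebius_step u = real_of_int (mertens (real k))"
proof -
  have "moebius_step u = (\<Sum>n<k. real_of_int (moebius (Suc n)) * indicator {ln (real (Suc n))<..} u)"
    by (rule moebius_step_eq_sum[OF u(2)])
  also have "\<dots> = (\<Sum>n<k. real_of_int (moebius (Suc n)))"
  proof (rule sum.cong)
    fix n assume "n \<in> {..<k}"
    then have "ln (real (Suc n)) \<le> ln (real k)" by (subst ln_le_cancel_iff) auto
    then show "real_of_int (moebius (Suc n)) * indicator {ln (real (Suc n))<..} u = real_of_int (moebius (Suc n))"
      using u by simp
  qed simp
  also have "\<dots> = real_of_int (\<Sum>n\<in>{1..k}. moebius n)"
    unfolding of_int_sum by (rule sum.reindex_bij_witness[of _ "\<lambda>k. k - 1" Suc]) auto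
  also have "(\<Sum>n\<in>{1..k}. moebius n) = mertens (real k)" by (simp add: mertens_def)
  finally show ?thesis .
qed

lemma moebius_step_nonpos: "u \<le> 0 \<Longrightarrow> moebius_step u = 0"
  using moebius_step_eq_sum[of u 0] by simp

lemma exists_ln_bracket:
  assumes "u > 0"
  obtains k :: nat where "k \<ge> 1" "ln (real k) < u" "u \<le> ln (real (Suc k))" "real k < exp u"
proof -
  have e: "exp u > 1" using assms by simp
  \<comment> \<open>Rounding up and subtracting 1 gives k < exp u \<le> k + 1, the half-open
    brackets that match jumps counted only to the right.\<close>
  define k where "k = nat (\<lceil>exp u\<rceil> - 1)"
  have c: "\<lceil>exp u\<rceil> \<ge> 2" using e by linarith
  have kr: "real k = real_of_int \<lceil>exp u\<rceil> - 1" using c by (simp add: k_def)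
  have k: "k \<ge> 1" "real k < exp u" "exp u \<le> real (Suc k)" using c kr unfolding k_def by linarith+
  have "ln (real k) < ln (exp u)" using k by (subst ln_less_cancel_iff) auto
  moreover have "ln (exp u) \<le> ln (real (Suc k))" using k by (subst ln_le_cancel_iff) auto
  ultimately show ?thesis using k by (intro that[of k]) auto
qed

lemma abs_moebius_step_le: "\<bar>moebius_step u\<bar> \<le> exp u"
proof (cases "u > 0")
  case True
  then obtain k where k: "k \<ge> 1" "ln (real k) < u" "u \<le> ln (real (Suc k))" "real k < exp u" by (rule exists_ln_bracket)
  then show ?thesis using moebius_step_eq_mertens[OF k(1-3)] abs_mertens_le_real[of k] by simp
qed (simp add: moebius_step_nonpos)

lemma moebius_step_measurable [measurable]: "moebius_step \<in> borel_measurable borel"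
  unfolding moebius_step_def by measurable

context
  fixes \<sigma> :: real
  assumes \<sigma>: "\<sigma> > 1"
begin

definition "weighted_step u = u * exp (- (\<sigma> * u)) * moebius_step u"

lemma weighted_step_bound: "\<bar>weighted_step u\<bar> \<le> indicator {0<..} u * (u * exp (- ((\<sigma> - 1) * u)))"
proof (cases "u > 0")
  case True
  have "\<bar>weighted_step u\<bar> = u * exp (- (\<sigma> * u)) * \<bar>moebius_step u\<bar>" using True by (simp add: weighted_step_def abs_mult)
  also have "\<dots> \<le> u * exp (- (\<sigma> * u)) * exp u" using True by (intro mult_left_mono abs_moebius_step_le) auto
  also have "\<dots> = u * exp (- ((\<sigma> - 1) * u))" by (simp add: mult.assoc exp_add[symmetric] algebra_simps)
  finally show ?thesis using True by simp
qed (simp add: weighted_step_def moebius_step_nonpos)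

lemma weighted_step_measurable [measurable]: "weighted_step \<in> borel_measurable borel"
  unfolding weighted_step_def[abs_def] by measurable

lemma weighted_step_integrable: "integrable lborel weighted_step"
proof (rule Bochner_Integration.integrable_bound)
  show "integrable lborel (\<lambda>u. indicator {0<..} u *\<^sub>R (u * exp (- ((\<sigma> - 1) * u))))"
    using linear_exp_real_integral(1)[of "\<sigma> - 1" 0] \<sigma> by (simp add: set_integrable_def)
  show "AE u in lborel. norm (weighted_step u) \<le> norm (indicator {0<..} u *\<^sub>R (u * exp (- ((\<sigma> - 1) * u))))"
  proof (rule AE_I2)
    fix u
    show "norm (weighted_step u) \<le> norm (indicator {0<..} u *\<^sub>R (u * exp (- ((\<sigma> - 1) * u))))"
      using weighted_step_bound[of u] by simp
  qed
qed simp

text \<open>From x \<le> exp x with x = (\<sigma>-1)u. The bound blows up as \<sigma> tends to 1,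
  which is harmless: the conclusion of \<open>Plancherel_inequality\<close> does not involve its
  bound \<open>B\<close>.\<close>

lemma weighted_step_le: "\<bar>weighted_step u\<bar> \<le> 1 / (\<sigma> - 1)"
proof (cases "u > 0")
  case True
  have "(\<sigma> - 1) * u \<le> exp ((\<sigma> - 1) * u)" using exp_ge_add_one_self[of "(\<sigma> - 1) * u"] by linarith
  then have "u \<le> exp ((\<sigma> - 1) * u) / (\<sigma> - 1)" using \<sigma> by (simp add: field_simps)
  then have "u * exp (- ((\<sigma> - 1) * u)) \<le> exp ((\<sigma> - 1) * u) / (\<sigma> - 1) * exp (- ((\<sigma> - 1) * u))"
    by (intro mult_right_mono) auto
  also have "\<dots> = 1 / (\<sigma> - 1)" by (simp add: exp_minus)
  finally show ?thesis using weighted_step_bound[of u] True by simp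
qed (use \<sigma> in \<open>simp add: weighted_step_def moebius_step_nonpos\<close>)

lemma weighted_step_isCont: "AE u in lborel. isCont weighted_step u"
proof -
  have "countable (range (\<lambda>n. ln (real (Suc n))))" by simp
  then have "range (\<lambda>n. ln (real (Suc n))) \<in> null_sets lborel" by (rule countable_imp_null_set_lborel)
  then have "AE u in lborel. u \<notin> range (\<lambda>n. ln (real (Suc n)))" by (rule AE_not_in)
  then show ?thesis
  proof eventually_elim
    case (elim u)
    \<comment> \<open>The origin is ln 1, so it is already among the excluded points.\<close>
    have "u \<noteq> ln (real (Suc 0))" using elim by blast
    then have "u \<noteq> 0" by simp
    then consider "u < 0" | "u > 0" by linarith
    then show "isCont weighted_step u"
    proof cases
      case 1
      have "\<forall>\<^sub>F x in nhds u. weighted_step x = 0"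
        using eventually_nhds_in_open[of "{..<0}" u] 1
        by (auto elim!: eventually_mono simp: weighted_step_def moebius_step_nonpos)
      then show ?thesis using isCont_cong[of weighted_step "\<lambda>_. 0" u] by simp
    next
      case 2
      then obtain k where k: "k \<ge> 1" "ln (real k) < u" "u \<le> ln (real (Suc k))" "real k < exp u" by (rule exists_ln_bracket)
      have "u \<noteq> ln (real (Suc k))" using elim by blast
      then have "u \<in> {ln (real k)<..<ln (real (Suc k))}" using k by auto
      then have "\<forall>\<^sub>F x in nhds u. x \<in> {ln (real k)<..<ln (real (Suc k))}"
        by (intro eventually_nhds_in_open) auto
      then have "\<forall>\<^sub>F x in nhds u. weighted_step x = x * exp (- (\<sigma> * x)) * real_of_int (mertens (real k))"
      proof eventually_elim
        case (elim x)
        then show ?case using moebius_step_eq_mertens[OF k(1), of x] by (simp add: weighted_step_def)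
      qed
      then show ?thesis
        using isCont_cong[of weighted_step "\<lambda>x. x * exp (- (\<sigma> * x)) * real_of_int (mertens (real k))" u]
        by (auto intro!: continuous_intros)
    qed
  qed
qed

text \<open>At each u only finitely many jumps have occurred, and the L^1 norms of the single jump
  functions are summable because \<sigma> > 1; the transform may thus be computed jump by jump. The
  result is -(1/(s \<zeta>(s)))' by the product rule.\<close>

lemma weighted_step_transform:
  "(\<integral>u. of_real (weighted_step u) * cis (- (t * u)) \<partial>lborel)
     = dmoebius_ln (Complex \<sigma> t) / Complex \<sigma> t + dmoebius (Complex \<sigma> t) / (Complex \<sigma> t)\<^sup>2"
proof -
  let ?s = "Complex \<sigma> t"
  have s: "Re ?s > 1" using \<sigma> by simp
  define e where "e n u = indicator {ln (real (Suc n))<..} u *\<^sub>R (complex_of_real u * exp (- (?s * of_real u)))" for n :: nat and u :: real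
  define f where "f n u = complex_of_int (moebius (Suc n)) * e n u" for n :: nat and u :: real
  have ln0: "ln (real (Suc n)) \<ge> 0" for n by simp
  have eI: "integrable lborel (e n)" and ev: "integral\<^sup>L lborel (e n) = npow ?s (real (Suc n)) * (of_real (ln (real (Suc n))) / ?s + 1 / ?s\<^sup>2)" for n
    using linear_exp_complex_integral[of ?s "ln (real (Suc n))"] \<sigma> ln0 unfolding e_def npow_def by auto
  have fI: "integrable lborel (f n)" for n unfolding f_def using eI by simp
  have pt: "(\<lambda>n. f n u) sums (of_real (weighted_step u) * cis (- (t * u)))" for u
  proof -
    have ex: "exp (- (?s * of_real u)) = of_real (exp (- (\<sigma> * u))) * cis (- (t * u))"
    proof -
      have "- (?s * of_real u) = of_real (- (\<sigma> * u)) + \<i> * of_real (- (t * u))" by (simp add: complex_eq_iff)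
      then show ?thesis unfolding cis_conv_exp exp_of_real[symmetric] exp_add[symmetric] by simp
    qed
    obtain N where N: "exp u \<le> real N" using real_arch_simple by blast
    then have "ln (exp u) \<le> ln (real (Suc N))" by (subst ln_le_cancel_iff) auto
    then have uN: "u \<le> ln (real (Suc N))" by (simp only: ln_exp)
    have "(\<lambda>n. f n u) sums (\<Sum>n<N. f n u)"
    proof (rule sums_finite)
      fix n assume "n \<notin> {..<N}"
      then have "ln (real (Suc N)) \<le> ln (real (Suc n))" by simp
      with uN have "u \<le> ln (real (Suc n))" by (rule order.trans)
      then have "u \<notin> {ln (real (Suc n))<..}" by (simp only: greaterThan_iff not_less)
      then show "f n u = 0" by (simp only: f_def e_def indicator_simps scaleR_zero_left mult_zero_right not_False_eq_True)
    qed simp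
    also have "(\<Sum>n<N. f n u) = of_real (\<Sum>n<N. real_of_int (moebius (Suc n)) * indicator {ln (real (Suc n))<..} u) * (complex_of_real u * exp (- (?s * of_real u)))"
      unfolding of_real_sum sum_distrib_right
      by (rule sum.cong) (auto simp: f_def e_def indicator_def)
    also have "\<dots> = of_real (weighted_step u) * cis (- (t * u))"
      unfolding moebius_step_eq_sum[OF uN, symmetric] ex weighted_step_def by simp
    finally show ?thesis .
  qed
  \<comment> \<open>The norm of the integrand is at most the real integrand with exponent \<sigma>,
    whose integral is known; \<sigma> > 1 allows the denominators to be dropped.\<close>
  have nf: "(\<integral>u. norm (f n u) \<partial>lborel) \<le> (1 + ln (real (Suc n))) * real (Suc n) powr (-\<sigma>)" for n
  proof -
    have "(\<integral>u. norm (f n u) \<partial>lborel) \<le> (\<integral>u. indicator {ln (real (Suc n))<..} u * (u * exp (- (\<sigma> * u))) \<partial>lborel)"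
    proof (rule integral_mono)
      show "integrable lborel (\<lambda>u. norm (f n u))" using fI by simp
      show "integrable lborel (\<lambda>u. indicator {ln (real (Suc n))<..} u * (u * exp (- (\<sigma> * u))))"
        using linear_exp_real_integral(1)[of \<sigma> "ln (real (Suc n))"] \<sigma> ln0 by (simp add: set_integrable_def)
      fix u
      have m: "\<bar>real_of_int (moebius (Suc n))\<bar> \<le> 1" using abs_moebius_le_1[of "Suc n"] by linarith
      have "norm (f n u) = \<bar>real_of_int (moebius (Suc n))\<bar> * (indicator {ln (real (Suc n))<..} u * (\<bar>u\<bar> * exp (- (\<sigma> * u))))"
        by (simp add: f_def e_def norm_mult)
      also have "\<dots> \<le> 1 * (indicator {ln (real (Suc n))<..} u * (\<bar>u\<bar> * exp (- (\<sigma> * u))))"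
        using m by (intro mult_right_mono) auto
      also have "\<dots> = indicator {ln (real (Suc n))<..} u * (u * exp (- (\<sigma> * u)))"
      proof (cases "u \<in> {ln (real (Suc n))<..}")
        case True
        then have "ln (real (Suc n)) < u" by (simp only: greaterThan_iff)
        then have "u > 0" using ln0[of n] by linarith
        then show ?thesis by simp
      next
        case False
        then show ?thesis by (simp only: indicator_simps not_False_eq_True mult_zero_left mult_zero_right)
      qed
      finally show "norm (f n u) \<le> indicator {ln (real (Suc n))<..} u * (u * exp (- (\<sigma> * u)))" .
    qed
    also have "\<dots> = exp (- (\<sigma> * ln (real (Suc n)))) * (ln (real (Suc n)) / \<sigma> + 1 / \<sigma>\<^sup>2)"
      using \<sigma> ln0 by (intro linear_exp_real_integral(2)) auto
    also have "\<dots> \<le> exp (- (\<sigma> * ln (real (Suc n)))) * (ln (real (Suc n)) + 1)"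
    proof (intro mult_left_mono add_mono)
      show "ln (real (Suc n)) / \<sigma> \<le> ln (real (Suc n))" using \<sigma> ln0[of n] by (simp add: divide_le_eq mult_left_le mult_le_cancel_left1)
      show "1 / \<sigma>\<^sup>2 \<le> 1" using \<sigma> one_le_power[of \<sigma> 2] by (simp add: divide_le_eq)
    qed auto
    also have "\<dots> = (1 + ln (real (Suc n))) * real (Suc n) powr (-\<sigma>)" by (simp add: powr_def mult.commute)
    finally show ?thesis .
  qed
  have sumn: "summable (\<lambda>n. \<integral>u. norm (f n u) \<partial>lborel)"
    by (rule summable_comparison_test'[OF summable_log_powr[OF \<sigma>], of 0]) (use nf in auto)
  have AEs: "AE u in lborel. summable (\<lambda>n. norm (f n u))"
  proof (rule AE_I2)
    fix u
    obtain N where N: "exp u \<le> real N" using real_arch_simple by blast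
    show "summable (\<lambda>n. norm (f n u))"
    proof (rule summable_finite[of "{..<N}"])
      fix n assume "n \<notin> {..<N}"
      then have "exp u < real (Suc n)" using N by auto
      then have "u < ln (real (Suc n))" by (metis exp_gt_zero ln_exp ln_less_cancel_iff order_less_trans)
      then have "u \<le> ln (real (Suc n))" by (rule less_imp_le)
      then have "u \<notin> {ln (real (Suc n))<..}" by (simp only: greaterThan_iff not_less)
      then show "norm (f n u) = 0" by (simp only: f_def e_def indicator_simps scaleR_zero_left mult_zero_right not_False_eq_True norm_zero)
    qed simp
  qed
  have "(\<lambda>n. integral\<^sup>L lborel (f n)) sums (\<integral>u. (\<Sum>n. f n u) \<partial>lborel)"
    by (rule sums_integral[OF fI AEs sumn])
  moreover have "(\<Sum>n. f n u) = of_real (weighted_step u) * cis (- (t * u))" for u using pt by (simp add: sums_iff)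
  ultimately have 1: "(\<lambda>n. integral\<^sup>L lborel (f n)) sums (\<integral>u. of_real (weighted_step u) * cis (- (t * u)) \<partial>lborel)" by simp
  have sm: "(\<lambda>n. of_real (real_of_int (moebius (Suc n))) * npow ?s (real (Suc n))) sums dmoebius ?s"
    unfolding dser_def by (rule summable_sums[OF summable_norm_cancel[OF dser_norm_summable[OF s coefficient_bounds(3)]]])
  have sl: "(\<lambda>n. of_real (real_of_int (moebius (Suc n)) * ln (real (Suc n))) * npow ?s (real (Suc n))) sums dmoebius_ln ?s"
    unfolding dser_def by (rule summable_sums[OF summable_norm_cancel[OF dser_norm_summable[OF s coefficient_bounds(4)]]])
  have "(\<lambda>n. of_real (real_of_int (moebius (Suc n)) * ln (real (Suc n))) * npow ?s (real (Suc n)) / ?s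
      + of_real (real_of_int (moebius (Suc n))) * npow ?s (real (Suc n)) / ?s\<^sup>2) sums (dmoebius_ln ?s / ?s + dmoebius ?s / ?s\<^sup>2)"
    by (intro sums_add sums_divide sm sl)
  also have "(\<lambda>n. of_real (real_of_int (moebius (Suc n)) * ln (real (Suc n))) * npow ?s (real (Suc n)) / ?s
      + of_real (real_of_int (moebius (Suc n))) * npow ?s (real (Suc n)) / ?s\<^sup>2) = (\<lambda>n. integral\<^sup>L lborel (f n))"
  proof (rule ext)
    fix n
    have "integral\<^sup>L lborel (f n) = complex_of_int (moebius (Suc n)) * integral\<^sup>L lborel (e n)"
      unfolding f_def by simp
    then show "of_real (real_of_int (moebius (Suc n)) * ln (real (Suc n))) * npow ?s (real (Suc n)) / ?s
      + of_real (real_of_int (moebius (Suc n))) * npow ?s (real (Suc n)) / ?s\<^sup>2 = integral\<^sup>L lborel (f n)"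
      unfolding ev by (simp add: distrib_left mult_ac)
  qed
  finally show ?thesis using 1 sums_unique2 by blast
qed

end

text \<open>The point is that C does not depend on \<sigma>, so that \<sigma> may tend to 1
  afterwards. The transform is at most 6 K T^(-3/4) with T = |t| + 2, and the square of this is an
  integrable function of t alone.\<close>

lemma weighted_step_square_integral_bound:
  obtains C where "\<And>\<sigma>. 1 < \<sigma> \<Longrightarrow> \<sigma> \<le> 1 + 1/32 \<Longrightarrow> (\<integral>u. (weighted_step \<sigma> u)\<^sup>2 \<partial>lborel) \<le> C"
proof -
  obtain K where K: "K \<ge> 0" "\<And>\<sigma> t. 1 < \<sigma> \<Longrightarrow> \<sigma> \<le> 1 + 1/32 \<Longrightarrow> norm (dmoebius (Complex \<sigma> t)) \<le> K * (\<bar>t\<bar> + 2) powr (1/4)"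
    "\<And>\<sigma> t. 1 < \<sigma> \<Longrightarrow> \<sigma> \<le> 1 + 1/32 \<Longrightarrow> norm (dmoebius_ln (Complex \<sigma> t)) \<le> K * (\<bar>t\<bar> + 2) powr (1/4)"
    using dmoebius_bounds by blast
  define W where "W = (\<integral>t. 36 * K\<^sup>2 * (\<bar>t\<bar> + 2) powr (-3/2) \<partial>lborel)"
  show ?thesis
  proof (rule that[of "W / (2 * pi)"])
    fix \<sigma> :: real assume \<sigma>: "1 < \<sigma>" "\<sigma> \<le> 1 + 1/32"
    define H where "H t = (\<integral>u. of_real (weighted_step \<sigma> u) * cis (- (t * u)) \<partial>lborel)" for t
    have Hb: "(norm (H t))\<^sup>2 \<le> 36 * K\<^sup>2 * (\<bar>t\<bar> + 2) powr (-3/2)" for t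
    proof -
      let ?s = "Complex \<sigma> t"
      define T where "T = \<bar>t\<bar> + 2"
      have T: "T \<ge> 2" by (simp add: T_def)
      have s1: "norm ?s \<ge> 1" using abs_Re_le_cmod[of ?s] \<sigma> by simp
      have st: "norm ?s \<ge> \<bar>t\<bar>" using abs_Im_le_cmod[of ?s] by simp
      \<comment> \<open>Here |s| \<ge> |t| and |s| \<ge> 1, and the latter is used twice to absorb
        the 2 in T.\<close>
      have sT: "T \<le> 3 * norm ?s" using s1 st by (simp add: T_def)
      let ?A = "K * T powr (1/4)"
      have A0: "?A \<ge> 0" using K by simp
      have "norm (H t) \<le> norm (dmoebius_ln ?s / ?s) + norm (dmoebius ?s / ?s\<^sup>2)"
        unfolding H_def weighted_step_transform[OF \<sigma>(1)] by (rule norm_triangle_ineq)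
      also have "\<dots> = norm (dmoebius_ln ?s) / norm ?s + norm (dmoebius ?s) / (norm ?s)\<^sup>2"
        by (simp add: norm_divide norm_power)
      also have "\<dots> \<le> ?A / norm ?s + ?A / norm ?s"
      proof (intro add_mono frac_le)
        show "norm ?s \<le> (norm ?s)\<^sup>2" using s1 by (rule self_le_power) simp
      qed (use K(2,3)[OF \<sigma>, of t] A0 s1 in \<open>auto simp: T_def\<close>)
      also have "\<dots> = 2 * ?A / norm ?s" by simp
      also have "\<dots> \<le> 2 * ?A / (T / 3)" using sT s1 T A0 by (intro frac_le) auto
      also have "\<dots> = 6 * K * (T powr (1/4) * T powr (-1))" using T by (simp add: powr_minus_divide)
      also have "T powr (1/4) * T powr (-1) = T powr (-3/4)" unfolding powr_add[symmetric] by simp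
      finally have "norm (H t) \<le> 6 * K * T powr (-3/4)" .
      then have "(norm (H t))\<^sup>2 \<le> (6 * K * T powr (-3/4))\<^sup>2" by (intro power_mono) auto
      also have "\<dots> = 36 * K\<^sup>2 * (T powr (-3/4))\<^sup>2" by (simp add: power_mult_distrib)
      also have "(T powr (-3/4))\<^sup>2 = T powr (-3/2)" using T by (simp add: powr_power)
      finally show ?thesis by (simp add: T_def)
    qed
    have WI: "integrable lborel (\<lambda>t. 36 * K\<^sup>2 * (\<bar>t\<bar> + 2) powr (-3/2))"
      using integrable_abs_plus_2_powr by (rule integrable_mult_right)
    have [measurable]: "weighted_step \<sigma> \<in> borel_measurable borel" by (rule weighted_step_measurable[OF \<sigma>(1)])
    have [measurable]: "H \<in> borel_measurable borel" unfolding H_def[abs_def] by measurable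
    have HI: "integrable lborel (\<lambda>t. (norm (H t))\<^sup>2)"
      by (rule Bochner_Integration.integrable_bound[OF WI]) (use Hb in \<open>auto intro!: AE_I2 order.trans[OF Hb abs_ge_self]\<close>)
    have "(\<integral>u. (weighted_step \<sigma> u)\<^sup>2 \<partial>lborel) \<le> (\<integral>t. (norm (H t))\<^sup>2 \<partial>lborel) / (2 * pi)"
      by (rule Plancherel_inequality[OF weighted_step_integrable[OF \<sigma>(1)] weighted_step_le[OF \<sigma>(1)] weighted_step_isCont[OF \<sigma>(1)] H_def HI])
    also have "\<dots> \<le> W / (2 * pi)"
      unfolding W_def by (intro divide_right_mono integral_mono HI WI Hb) auto
    finally show "(\<integral>u. (weighted_step \<sigma> u)\<^sup>2 \<partial>lborel) \<le> W / (2 * pi)" .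
  qed
qed

text \<open>A lower Riemann sum of the integral: on (ln k, ln (k+1)), of length at least 1/(k+1),
  the step function is M(k), while u \<ge> ln k and exp (-\<sigma>u) \<ge>
  (k+1)^(-\<sigma>).\<close>

lemma weighted_mertens_sum_le:
  assumes \<sigma>: "1 < \<sigma>"
  shows "(\<Sum>k=1..X. (ln (real k))\<^sup>2 * (real_of_int (mertens (real k)))\<^sup>2 * real (Suc k) powr (- (2 * \<sigma>)) / real (Suc k))
     \<le> (\<integral>u. (weighted_step \<sigma> u)\<^sup>2 \<partial>lborel)"
proof -
  define J where "J k = {ln (real k)<..<ln (real (Suc k))}" for k :: nat
  define c where "c k = (ln (real k))\<^sup>2 * (real_of_int (mertens (real k)))\<^sup>2 * real (Suc k) powr (- (2 * \<sigma>))" for k :: nat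
  have c0: "c k \<ge> 0" for k by (simp add: c_def)
  \<comment> \<open>From ln x \<le> x - 1 at x = k/(k+1).\<close>
  have len: "1 / real (Suc k) \<le> measure lborel (J k)" if k: "k \<ge> 1" for k
  proof -
    have "ln (real k / real (Suc k)) \<le> real k / real (Suc k) - 1" using k by (intro ln_le_minus_one) auto
    also have "\<dots> = - (1 / real (Suc k))" by (simp add: field_simps)
    finally have "1 / real (Suc k) \<le> ln (real (Suc k)) - ln (real k)" using k by (simp add: ln_div)
    moreover have "ln (real k) \<le> ln (real (Suc k))" using k by simp
    ultimately show ?thesis unfolding J_def by simp
  qed
  have uniq: "j = k" if "u \<in> J j" "u \<in> J k" "j \<ge> 1" "k \<ge> 1" for u j k
  proof (rule ccontr)
    assume "j \<noteq> k"
    then consider "Suc j \<le> k" | "Suc k \<le> j" by linarith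
    then show False
    proof cases
      case 1
      then have "ln (real (Suc j)) \<le> ln (real k)" by (subst ln_le_cancel_iff) auto
      then show False using that unfolding J_def greaterThanLessThan_iff by linarith
    next
      case 2
      then have "ln (real (Suc k)) \<le> ln (real j)" by (subst ln_le_cancel_iff) auto
      then show False using that unfolding J_def greaterThanLessThan_iff by linarith
    qed
  qed
  have ptj: "c j \<le> (weighted_step \<sigma> u)\<^sup>2" if u: "u \<in> J j" and j: "j \<ge> 1" for u j
  proof -
    have u': "ln (real j) < u" "u \<le> ln (real (Suc j))" using u unfolding J_def greaterThanLessThan_iff by linarith+
    have l: "0 \<le> ln (real j)" using j by simp
    have "(weighted_step \<sigma> u)\<^sup>2 = u\<^sup>2 * (real_of_int (mertens (real j)))\<^sup>2 * (exp (- (\<sigma> * u)))\<^sup>2"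
      unfolding weighted_step_def[OF \<sigma>] moebius_step_eq_mertens[OF j u'] by (simp add: power_mult_distrib)
    moreover have "(ln (real j))\<^sup>2 \<le> u\<^sup>2" using l u' by (intro power_mono) auto
    moreover have "real (Suc j) powr (- (2 * \<sigma>)) \<le> (exp (- (\<sigma> * u)))\<^sup>2"
    proof -
      have "real (Suc j) powr (- (2 * \<sigma>)) = (exp (- (\<sigma> * ln (real (Suc j)))))\<^sup>2"
        by (simp add: powr_def power2_eq_square exp_add[symmetric])
      also have "\<dots> \<le> (exp (- (\<sigma> * u)))\<^sup>2" using u' \<sigma> by (intro power_mono) (auto intro!: mult_left_mono simp del: of_nat_Suc)
      finally show ?thesis .
    qed
    ultimately show ?thesis unfolding c_def by (auto intro!: mult_mono)
  qed
  have pt: "(\<Sum>k=1..X. indicator (J k) u * c k) \<le> (weighted_step \<sigma> u)\<^sup>2" for u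
  proof (cases "\<exists>j\<in>{1..X}. u \<in> J j")
    case True
    then obtain j where j: "j \<in> {1..X}" "u \<in> J j" by auto
    have "(\<Sum>k=1..X. indicator (J k) u * c k) = (\<Sum>k\<in>{j}. indicator (J k) u * c k)"
      by (rule sum.mono_neutral_right) (use j uniq in \<open>auto simp: indicator_def\<close>)
    also have "\<dots> = c j" using j by simp
    finally show ?thesis using ptj j by simp
  next
    case False
    then have "(\<Sum>k=1..X. indicator (J k) u * c k) = 0" by (intro sum.neutral) (auto simp: indicator_def)
    then show ?thesis by simp
  qed
  have Jf: "emeasure lborel (J k) < \<infinity>" for k 
  proof (rule emeasure_bounded_finite)
    show "bounded (J k)" unfolding J_def
      by (rule bounded_subset[OF bounded_cbox[of "ln (real k)" "ln (real (Suc k))"]]) auto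
  qed
  have Jm[measurable]: "J k \<in> sets borel" for k by (simp add: J_def)
  have [measurable]: "weighted_step \<sigma> \<in> borel_measurable borel" by (rule weighted_step_measurable[OF \<sigma>])
  have Ji: "integrable lborel (\<lambda>u. indicator (J k) u * c k)" for k
    using Jf by (intro integrable_mult_left integrable_real_indicator) auto
  have "(\<Sum>k=1..X. c k / real (Suc k)) \<le> (\<Sum>k=1..X. measure lborel (J k) * c k)"
    using len c0 by (intro sum_mono) (metis atLeastAtMost_iff divide_inverse inverse_eq_divide mult.commute mult_right_mono)
  also have "\<dots> = (\<integral>u. (\<Sum>k=1..X. indicator (J k) u * c k) \<partial>lborel)"
    using Ji by (subst Bochner_Integration.integral_sum) auto
  also have "\<dots> \<le> (\<integral>u. (weighted_step \<sigma> u)\<^sup>2 \<partial>lborel)"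
  proof (intro integral_mono Bochner_Integration.integrable_sum Ji pt)
    show "integrable lborel (\<lambda>u. (weighted_step \<sigma> u)\<^sup>2)"
    proof (rule Bochner_Integration.integrable_bound[OF integrable_mult_right[OF integrable_abs[OF weighted_step_integrable[OF \<sigma>]], of "1 / (\<sigma> - 1)"]])
      show "AE u in lborel. norm ((weighted_step \<sigma> u)\<^sup>2) \<le> norm (1 / (\<sigma> - 1) * \<bar>weighted_step \<sigma> u\<bar>)"
      proof (rule AE_I2)
        fix u
        have "(weighted_step \<sigma> u)\<^sup>2 = \<bar>weighted_step \<sigma> u\<bar> * \<bar>weighted_step \<sigma> u\<bar>" by (simp add: power2_eq_square)
        also have "\<dots> \<le> 1 / (\<sigma> - 1) * \<bar>weighted_step \<sigma> u\<bar>" by (intro mult_right_mono weighted_step_le[OF \<sigma>]) simp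
        finally show "norm ((weighted_step \<sigma> u)\<^sup>2) \<le> norm (1 / (\<sigma> - 1) * \<bar>weighted_step \<sigma> u\<bar>)" using \<sigma> by simp
      qed
    qed measurable
  qed
  finally show ?thesis by (simp add: c_def)
qed

text \<open>Telescoping with the differences of \<open>1 / ln k\<close>.\<close>

lemma summable_inverse_mult_ln_square: "summable (\<lambda>k. 1 / (real k * (ln (real k))\<^sup>2))"
proof -
  have "(\<lambda>k. 1 / ln (real (k + 2)) - 1 / ln (real (Suc k + 2))) sums (1 / ln (real (0 + 2)) - 0)"
  proof (rule telescope_sums')
    show "(\<lambda>k. 1 / ln (real (k + 2))) \<longlonglongrightarrow> 0" by real_asymp
  qed
  then have s: "summable (\<lambda>k. 1 / ln (real (k + 2)) - 1 / ln (real (Suc k + 2)))" by (rule sums_summable)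
  have "summable (\<lambda>k. 1 / (real (k + 3) * (ln (real (k + 3)))\<^sup>2))"
  proof (rule summable_comparison_test'[OF s, of 0])
    fix k :: nat
    define a where "a = ln (real (k + 2))"
    define b where "b = ln (real (Suc k + 2))"
    have a: "a > 0" and ab: "a \<le> b" by (simp_all add: a_def b_def)
    have "ln (real (k + 2) / real (k + 3)) \<le> real (k + 2) / real (k + 3) - 1" by (intro ln_le_minus_one) auto
    also have "\<dots> = - (1 / real (k + 3))" by (simp add: field_simps)
    finally have d: "1 / real (k + 3) \<le> b - a" by (simp add: a_def b_def ln_div eval_nat_numeral)
    have "1 / (real (k + 3) * b\<^sup>2) = (1 / real (k + 3)) / (b * b)" by (simp add: power2_eq_square)
    also have "\<dots> \<le> (b - a) / (a * b)" using a ab d by (intro frac_le mult_mono) auto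
    also have "\<dots> = 1 / a - 1 / b" using a ab by (simp add: diff_divide_distrib)
    finally show "norm (1 / (real (k + 3) * (ln (real (k + 3)))\<^sup>2)) \<le> 1 / ln (real (k + 2)) - 1 / ln (real (Suc k + 2))"
      by (simp add: a_def b_def eval_nat_numeral)
  qed
  then show ?thesis by (subst (asm) summable_iff_shift)
qed

lemma summable_mertens: "summable (\<lambda>k. real_of_int \<bar>mertens (real k)\<bar> / (real k)^2)"
proof -
  obtain C where C: "\<And>\<sigma>. 1 < \<sigma> \<Longrightarrow> \<sigma> \<le> 1 + 1/32 \<Longrightarrow> (\<integral>u. (weighted_step \<sigma> u)\<^sup>2 \<partial>lborel) \<le> C"
    using weighted_step_square_integral_bound by blast
  let ?m = "\<lambda>k. real_of_int (mertens (real k))"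
  define p where "p k = (ln (real k))\<^sup>2 * (?m k)\<^sup>2 * real (Suc k) powr (-2) / real (Suc k)" for k :: nat
  have p0: "p k \<ge> 0" for k by (simp add: p_def)
  have pC: "(\<Sum>k=1..X. p k) \<le> C" for X
  proof -
    \<comment> \<open>A sequence decreasing to 1 within the admissible range of \<sigma>. For fixed
      X the sum is finite and continuous in \<sigma>, so the uniform bound survives the
      limit.\<close>
    define \<tau> where "\<tau> j = 1 + 1 / (32 * real (Suc j))" for j :: nat
    have s: "1 < \<tau> j" "\<tau> j \<le> 1 + 1/32" for j by (simp_all add: \<tau>_def field_simps)
    have sl: "\<tau> \<longlonglongrightarrow> 1" unfolding \<tau>_def by real_asymp
    have "(\<lambda>j. \<Sum>k=1..X. (ln (real k))\<^sup>2 * (?m k)\<^sup>2 * real (Suc k) powr (- (2 * \<tau> j)) / real (Suc k))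
       \<longlonglongrightarrow> (\<Sum>k=1..X. (ln (real k))\<^sup>2 * (?m k)\<^sup>2 * real (Suc k) powr (- (2 * 1)) / real (Suc k))"
      by (intro tendsto_intros sl) auto
    then have "(\<Sum>k=1..X. (ln (real k))\<^sup>2 * (?m k)\<^sup>2 * real (Suc k) powr (- (2 * 1)) / real (Suc k)) \<le> C"
      by (rule LIMSEQ_le_const2) (use order.trans[OF weighted_mertens_sum_le[OF s(1)] C[OF s]] in blast)
    then show ?thesis by (simp add: p_def)
  qed
  have "summable p"
  proof (rule bounded_imp_summable[of p C])
    fix n
    have "(\<Sum>k\<le>n. p k) = p 0 + (\<Sum>k=1..n. p k)"
      using sum.atLeast_Suc_atMost[of 0 n p] by (simp add: atMost_atLeast0)
    also have "p 0 = 0" by (simp add: p_def)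
    finally show "(\<Sum>k\<le>n. p k) \<le> C" using pC[of n] by simp
  qed (rule p0)
  then have S: "summable (\<lambda>k. p k + 8 * (1 / (real k * (ln (real k))\<^sup>2)))"
    by (intro summable_add summable_mult summable_inverse_mult_ln_square)
  show ?thesis
  proof (rule summable_comparison_test'[OF S, of 2])
    fix k :: nat assume k: "k \<ge> 2"
    define l where "l = ln (real k)"
    have l: "l > 0" using k by (simp add: l_def)
    \<comment> \<open>The term |M(k)|/k^2 is split as x * y with x^2 = \<open>p k\<close>, whose sum
      is bounded by Plancherel, and y^2 at most 8/(k (ln k)^2); 8 comes from (k+1)^3 \<le> (2k)^3.
      Then 2xy \<le> x^2 + y^2.\<close>
    define x where "x = \<bar>?m k\<bar> * l / (real (Suc k) * sqrt (real (Suc k)))"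
    define y where "y = real (Suc k) * sqrt (real (Suc k)) / ((real k)\<^sup>2 * l)"
    have k0: "real k > 0" using k by simp
    have xy: "\<bar>?m k\<bar> / (real k)\<^sup>2 = x * y" using l k0 by (simp add: x_def y_def)
    have x2: "x\<^sup>2 = p k"
    proof -
      have "x\<^sup>2 = (?m k)\<^sup>2 * l\<^sup>2 / ((real (Suc k))\<^sup>2 * real (Suc k))"
        by (simp add: x_def power_divide power_mult_distrib)
      also have "\<dots> = p k" by (simp add: p_def l_def powr_minus_divide mult_ac)
      finally show ?thesis .
    qed
    have y2: "y\<^sup>2 \<le> 8 * (1 / (real k * l\<^sup>2))"
    proof -
      have "y\<^sup>2 = real (Suc k) ^ 3 / ((real k)^4 * l\<^sup>2)"
      proof -
        have "(real (Suc k) * sqrt (real (Suc k)))\<^sup>2 = real (Suc k) ^ 3"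
          unfolding power_mult_distrib by (simp add: power3_eq_cube power2_eq_square)
        moreover have "((real k)\<^sup>2 * l)\<^sup>2 = (real k)^4 * l\<^sup>2"
          unfolding power_mult_distrib by (simp flip: power_mult)
        ultimately show ?thesis unfolding y_def power_divide by simp
      qed
      also have "\<dots> \<le> (2 * real k) ^ 3 / ((real k)^4 * l\<^sup>2)"
        using k l by (intro divide_right_mono power_mono) auto
      also have "\<dots> = 8 * (1 / (real k * l\<^sup>2))"
        using k0 by (simp add: power_mult_distrib eval_nat_numeral)
      finally show ?thesis .
    qed
    have "2 * (x * y) \<le> x\<^sup>2 + y\<^sup>2" using sum_squares_bound[of x y] by (simp add: mult.assoc)
    then have "x * y \<le> x\<^sup>2 + y\<^sup>2" using zero_le_power2[of x] zero_le_power2[of y] by linarith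
    then have "\<bar>?m k\<bar> / (real k)\<^sup>2 \<le> p k + 8 * (1 / (real k * l\<^sup>2))" using xy x2 y2 by simp
    then show "norm (real_of_int \<bar>mertens (real k)\<bar> / (real k)^2) \<le> p k + 8 * (1 / (real k * (ln (real k))\<^sup>2))"
      by (simp add: l_def)
  qed
qed

section \<open>Error terms of Farey sums\<close>

lemma symsum_nz_Suc: "symsum_nz a (Suc N) = symsum_nz a N + (a (int (Suc N)) + a (- int (Suc N)))"
proof -
  have "{- int (Suc N)..int (Suc N)} - {0} = insert (int (Suc N)) (insert (- int (Suc N)) ({- int N..int N} - {0}))"
    by auto
  then show ?thesis by (simp add: symsum_nz_def add_ac)
qed

lemma symsum_nz_eq_sum: "symsum_nz a N = (\<Sum>k<N. a (int (Suc k)) + a (- int (Suc k)))"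
proof (induction N)
  case 0
  show ?case by (simp add: symsum_nz_def)
qed (simp add: symsum_nz_Suc del: of_nat_Suc)

lemma symsum_eq_symsum_nz: "symsum a N = a 0 + symsum_nz a N"
  unfolding symsum_def symsum_nz_def by (rule sum.remove) auto

lemma symsum_sum: "symsum (\<lambda>l. \<Sum>x\<in>A. g l x) N = (\<Sum>x\<in>A. symsum (\<lambda>l. g l x) N)"
  unfolding symsum_def by (rule sum.swap)

lemma fcoeff_0:
  assumes "f absolutely_integrable_on {0..1}"
  shows "fcoeff f 0 = complex_of_real (integral {0..1} f)"
proof -
  have "f integrable_on {0..1}" using assms by (rule absolutely_integrable_on_imp_integrable_on)
  then have "((\<lambda>x. complex_of_real (f x)) has_integral complex_of_real (integral {0..1} f)) {0..1}"
    by (intro has_integral_of_real integrable_integral)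
  then show ?thesis by (simp add: fcoeff_def integral_unique)
qed

text \<open>Equal to the sum of the exponentials of frequency l over the Farey fractions, by
  \<open>sum_farey_cis\<close>; it is the coefficient with which c(l) enters the Farey sum.\<close>

definition farey_weight :: "nat \<Rightarrow> int \<Rightarrow> int" where
  "farey_weight n l = (\<Sum>d\<in>{d\<in>{1..n}. int d dvd l}. int d * mertens (real n / real d))"

lemma Ferr_Fourier_series:
  assumes fC: "classC f" and f: "f absolutely_integrable_on {0..1}"
    and S: "symsum (fcoeff f) \<longlonglongrightarrow> S" and n: "n \<ge> 1"
  shows "symsum_nz (\<lambda>l. fcoeff f l * of_int (farey_weight n l))
     \<longlonglongrightarrow> complex_of_real (Ferr n f) - (complex_of_real (f 1) - S)"
proof -
  let ?c = "fcoeff f"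
  have lim_x: "symsum (\<lambda>l. ?c l * cis (2 * pi * real_of_int l * x)) \<longlonglongrightarrow> (if x = 1 then S else complex_of_real (f x))"
    if x: "x \<in> farey n" for x
  \<comment> \<open>At x = 1 all exponentials are 1, so the partial sums are those of \<Sum>c(l) and
    their limit is S, whatever the value f(1).\<close>
  proof (cases "x = 1")
    case True
    have "cis (2 * pi * real_of_int l * x) = 1" for l using cis_multiple_2pi[of "real_of_int l"] True by simp
    then show ?thesis using S True by simp
  next
    case False
    obtain j m where jm: "x = real j / real m" "1 \<le> j" "j \<le> m" using x by (auto simp: farey_def)
    have "0 < x" "x \<le> 1" using jm by auto
    then have x01: "0 < x" "x < 1" using False by auto
    have "x \<in> \<rat>" using jm by simp
    then obtain \<delta> where "\<delta> > 0" "(\<lambda>u. \<bar>f (x + u) + f (x - u) - 2 * f x\<bar> / u) integrable_on {0..\<delta>}"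
      using fC x01 unfolding classC_def by blast
    then show ?thesis using Dini_Fourier_convergence[OF f x01] False by simp
  qed
  have one: "1 \<in> farey n" unfolding farey_def using n by (auto intro!: exI[of _ 1])
  have "(\<lambda>N. \<Sum>x\<in>farey n. symsum (\<lambda>l. ?c l * cis (2 * pi * real_of_int l * x)) N)
      \<longlonglongrightarrow> (\<Sum>x\<in>farey n. if x = 1 then S else complex_of_real (f x))"
    by (intro tendsto_sum lim_x)
  also have "(\<lambda>N. \<Sum>x\<in>farey n. symsum (\<lambda>l. ?c l * cis (2 * pi * real_of_int l * x)) N)
      = symsum (\<lambda>l. ?c l * of_int (farey_weight n l))"
    by (rule ext) (simp only: symsum_sum[symmetric] sum_distrib_left[symmetric] sum_farey_cis farey_weight_def)
  also have "(\<Sum>x\<in>farey n. if x = 1 then S else complex_of_real (f x)) = S + (complex_of_real (Fsum n f) - complex_of_real (f 1))"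
    using sum.remove[OF finite_farey one, of "\<lambda>x. if x = 1 then S else complex_of_real (f x)"]
      sum.remove[OF finite_farey one, of "\<lambda>x. complex_of_real (f x)"]
    by (simp add: Fsum_def)
  finally have 1: "symsum (\<lambda>l. ?c l * of_int (farey_weight n l)) \<longlonglongrightarrow> S + (complex_of_real (Fsum n f) - complex_of_real (f 1))" .
  \<comment> \<open>At frequency 0 each fraction contributes 1, so removing l = 0 subtracts
    \<open>Phi n\<close> times the integral of f. This turns the Farey sum into the error
    term.\<close>
  have A0: "of_int (farey_weight n 0) = complex_of_real (real (Phi n))"
    using sum_farey_cis[of 0 n] by (simp add: farey_weight_def Phi_def)
  have "symsum_nz (\<lambda>l. ?c l * of_int (farey_weight n l)) = (\<lambda>N. symsum (\<lambda>l. ?c l * of_int (farey_weight n l)) N - ?c 0 * of_int (farey_weight n 0))"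
    by (rule ext) (simp add: symsum_eq_symsum_nz)
  also have "\<dots> \<longlonglongrightarrow> S + (complex_of_real (Fsum n f) - complex_of_real (f 1)) - ?c 0 * of_int (farey_weight n 0)"
    by (intro tendsto_diff 1 tendsto_const)
  also have "S + (complex_of_real (Fsum n f) - complex_of_real (f 1)) - ?c 0 * of_int (farey_weight n 0)
     = complex_of_real (Ferr n f) - (complex_of_real (f 1) - S)"
    by (simp add: A0 fcoeff_0[OF f] Ferr_def)
  finally show ?thesis .
qed

text \<open>If |M(n)| \<ge> e n for a large n, then |M| stays above e n/2 on the block of about e
  n/2 integers from n on. This block contributes at least e^2/16 to \<Sum>|M(k)|/k^2, against the
  Cauchy criterion.\<close>

lemma mertens_div_tendsto_0: "(\<lambda>n. real_of_int \<bar>mertens (real n)\<bar> / real n) \<longlonglongrightarrow> 0"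
proof (rule LIMSEQ_I)
  fix e0 :: real assume e0: "e0 > 0"
  \<comment> \<open>Capping at 1 keeps the block of length about e n/2 below 2n, so that k^2 \<le>
    (2n)^2 there.\<close>
  define e where "e = min e0 1"
  have e: "0 < e" "e \<le> 1" "e \<le> e0" using e0 by (auto simp: e_def)
  let ?a = "\<lambda>k. real_of_int \<bar>mertens (real k)\<bar> / (real k)^2"
  obtain N where N: "\<And>m n. m \<ge> N \<Longrightarrow> norm (sum ?a {m..<n}) < e^2 / 16"
    using summable_mertens[unfolded summable_Cauchy] e by (metis zero_less_divide_iff zero_less_numeral zero_less_power)
  show "\<exists>no. \<forall>n\<ge>no. norm (real_of_int \<bar>mertens (real n)\<bar> / real n - 0) < e0"
  proof (intro exI allI impI)
    fix n assume n: "n \<ge> max N 1"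
    show "norm (real_of_int \<bar>mertens (real n)\<bar> / real n - 0) < e0"
    proof (rule ccontr)
      assume "\<not> ?thesis"
      then have big: "real_of_int \<bar>mertens (real n)\<bar> \<ge> e * real n"
        using n e by (auto simp: field_simps not_less) (smt (verit) mult_right_mono of_nat_0_le_iff)
      \<comment> \<open>Rounded down, so that the offsets 0 to j cost at most e n/2, while the j + 1
        terms still number at least e n/2.\<close>
      define j where "j = nat \<lfloor>e * real n / 2\<rfloor>"
      have j: "real j \<le> e * real n / 2" "e * real n / 2 \<le> real (Suc j)"
        using e n real_of_int_floor_add_one_ge[of "e * real n / 2"] of_int_floor_le[of "e * real n / 2"]
        by (auto simp: j_def add.commute simp del: of_int_floor_le)
      have "e * real n \<le> 1 * real n" using e by (intro mult_right_mono) auto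
      then have jn: "j \<le> n" using j by simp
      have lower: "?a k \<ge> e / (8 * real n)" if k: "k \<in> {n..<n + Suc j}" for k
      proof -
        have "\<bar>mertens (real k) - mertens (real n)\<bar> \<le> int (k - n)"
          using k by (intro abs_mertens_diff_le) auto
        then have "\<bar>mertens (real n)\<bar> \<le> \<bar>mertens (real k)\<bar> + int j" using k by auto
        then have "real_of_int \<bar>mertens (real n)\<bar> \<le> real_of_int \<bar>mertens (real k)\<bar> + real j"
          by (metis of_int_add of_int_le_iff of_int_of_nat_eq)
        then have a: "real_of_int \<bar>mertens (real k)\<bar> \<ge> e * real n / 2" using big j by linarith
        have "real k \<le> 2 * real n" using k jn by auto
        then have b: "(real k)^2 \<le> (2 * real n)^2" by (intro power_mono) auto
        have "e / (8 * real n) = (e * real n / 2) / (2 * real n)^2"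
          using n by (simp add: field_simps power2_eq_square)
        also have "\<dots> \<le> real_of_int \<bar>mertens (real k)\<bar> / (real k)^2"
          using a b n k by (intro frac_le) auto
        finally show ?thesis .
      qed
      have "e^2 / 16 = (e * real n / 2) * (e / (8 * real n))"
        using n by (simp add: field_simps power2_eq_square)
      also have "\<dots> \<le> real (Suc j) * (e / (8 * real n))"
        using j e by (intro mult_right_mono) auto
      also have "\<dots> = (\<Sum>k\<in>{n..<n + Suc j}. e / (8 * real n))" by simp
      also have "\<dots> \<le> sum ?a {n..<n + Suc j}" by (intro sum_mono lower)
      also have "\<dots> \<le> norm (sum ?a {n..<n + Suc j})" by simp
      also have "\<dots> < e^2 / 16" by (rule N) (use n in auto)
      finally show False by simp
    qed
  qed
qed

lemma finite_int_divisors: "l \<noteq> 0 \<Longrightarrow> finite {k::nat. 0 < k \<and> int k dvd l}"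
  by (rule finite_subset[of _ "{..nat \<bar>l\<bar>}"]) (use zdvd_imp_le in \<open>force simp: le_nat_iff\<close>)+

text \<open>Letting d run through all divisors of l only adds nonnegative terms and makes the index
  set independent of n, as needed for limits and sums over n.\<close>

lemma abs_farey_weight_le:
  assumes "l \<noteq> 0"
  shows "real_of_int \<bar>farey_weight n l\<bar> \<le>
    (\<Sum>d\<in>{k::nat. 0 < k \<and> int k dvd l}. real d * real_of_int \<bar>mertens (real (n div d))\<bar>)"
proof -
  have "real_of_int \<bar>farey_weight n l\<bar> \<le> (\<Sum>d\<in>{d\<in>{1..n}. int d dvd l}. \<bar>real d * real_of_int (mertens (real (n div d)))\<bar>)"
    unfolding farey_weight_def mertens_div_nat of_int_abs of_int_sum by (rule order.trans[OF sum_abs]) simp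
  also have "\<dots> = (\<Sum>d\<in>{d\<in>{1..n}. int d dvd l}. real d * real_of_int \<bar>mertens (real (n div d))\<bar>)"
    by (simp add: abs_mult)
  also have "\<dots> \<le> (\<Sum>d\<in>{k::nat. 0 < k \<and> int k dvd l}. real d * real_of_int \<bar>mertens (real (n div d))\<bar>)"
    by (rule sum_mono2[OF finite_int_divisors[OF assms]]) auto
  finally show ?thesis .
qed

text \<open>Each divisor contributes at most d (n div d) \<le> n. This is the bound, uniform in l,
  that dominates the tail of the Fourier series in the o(n) statement.\<close>

lemma abs_farey_weight_le_ndiv:
  assumes "l \<noteq> 0"
  shows "real_of_int \<bar>farey_weight n l\<bar> \<le> real n * real (ndiv l)"
proof -
  have "real_of_int \<bar>farey_weight n l\<bar> \<le> (\<Sum>d\<in>{k::nat. 0 < k \<and> int k dvd l}. real d * real_of_int \<bar>mertens (real (n div d))\<bar>)"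
    by (rule abs_farey_weight_le[OF assms])
  also have "\<dots> \<le> (\<Sum>d\<in>{k::nat. 0 < k \<and> int k dvd l}. real n)"
  proof (rule sum_mono)
    fix d
    have "real_of_int \<bar>mertens (real (n div d))\<bar> \<le> real (n div d)"
      by (metis abs_mertens_le of_int_le_iff of_int_of_nat_eq)
    then have "real d * real_of_int \<bar>mertens (real (n div d))\<bar> \<le> real d * real (n div d)"
      by (intro mult_left_mono) auto
    also have "\<dots> = real (d * (n div d))" by simp
    also have "\<dots> \<le> real n" by (intro of_nat_mono) (rule times_div_less_eq_dividend)
    finally show "real d * real_of_int \<bar>mertens (real (n div d))\<bar> \<le> real n" .
  qed
  also have "\<dots> = real n * real (ndiv l)" by (simp add: ndiv_def)
  finally show ?thesis .
qed

text \<open>For fixed l only finitely many d occur, and for each one d |M(n div d)| / n is at most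
  |M(m)|/m with m = n div d, which tends to infinity with n.\<close>

lemma farey_weight_tendsto:
  assumes "l \<noteq> 0"
  shows "(\<lambda>n. real_of_int \<bar>farey_weight n l\<bar> / real n) \<longlonglongrightarrow> 0"
proof -
  let ?D = "{k::nat. 0 < k \<and> int k dvd l}"
  have lim_d: "(\<lambda>n. real d * real_of_int \<bar>mertens (real (n div d))\<bar> / real n) \<longlonglongrightarrow> 0" if "d > 0" for d
  proof (rule tendsto_sandwich[OF _ _ tendsto_const])
    have "filterlim (\<lambda>n. n div d) sequentially sequentially"
      unfolding filterlim_at_top
    proof
      fix Z
      show "\<forall>\<^sub>F n in sequentially. Z \<le> n div d"
        unfolding eventually_sequentially using that
        by (intro exI[of _ "Z * d"]) (auto simp: less_eq_div_iff_mult_less_eq)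
    qed
    from filterlim_compose[OF mertens_div_tendsto_0 this]
    show "(\<lambda>n. real_of_int \<bar>mertens (real (n div d))\<bar> / real (n div d)) \<longlonglongrightarrow> 0" .
    show "\<forall>\<^sub>F n in sequentially. real d * real_of_int \<bar>mertens (real (n div d))\<bar> / real n \<le> real_of_int \<bar>mertens (real (n div d))\<bar> / real (n div d)"
    proof (rule eventually_sequentiallyI)
      fix n assume n: "n \<ge> d"
      then have q: "n div d > 0" using that by (simp add: div_greater_zero_iff)
      have "real (d * (n div d)) \<le> real n" by (intro of_nat_mono) (rule times_div_less_eq_dividend)
      then have "real_of_int \<bar>mertens (real (n div d))\<bar> * (real d * real (n div d)) \<le> real_of_int \<bar>mertens (real (n div d))\<bar> * real n"
        by (intro mult_left_mono) auto
      then show "real d * real_of_int \<bar>mertens (real (n div d))\<bar> / real n \<le> real_of_int \<bar>mertens (real (n div d))\<bar> / real (n div d)"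
        using q n that by (simp add: divide_simps mult_ac)
    qed
  qed auto
  have "(\<lambda>n. \<Sum>d\<in>?D. real d * real_of_int \<bar>mertens (real (n div d))\<bar> / real n) \<longlonglongrightarrow> (\<Sum>d\<in>?D. 0)"
    by (intro tendsto_sum lim_d) auto
  then have lim: "(\<lambda>n. \<Sum>d\<in>?D. real d * real_of_int \<bar>mertens (real (n div d))\<bar> / real n) \<longlonglongrightarrow> 0" by simp
  show ?thesis
  proof (rule tendsto_sandwich[OF _ _ tendsto_const lim])
    show "\<forall>\<^sub>F n in sequentially. real_of_int \<bar>farey_weight n l\<bar> / real n \<le> (\<Sum>d\<in>?D. real d * real_of_int \<bar>mertens (real (n div d))\<bar> / real n)"
      unfolding sum_divide_distrib[symmetric]
      by (intro always_eventually allI divide_right_mono abs_farey_weight_le assms) auto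
  qed auto
qed

text \<open>For fixed d, the d integers n with n div d = k each contribute at most d |M(k)| /
  (kd)^2, together |M(k)|/k^2. The bound no longer depends on d, so the sum over d only produces the
  number of divisors.\<close>

lemma sum_abs_farey_weight_le:
  assumes "l \<noteq> 0"
  shows "(\<Sum>n<X. real_of_int \<bar>farey_weight n l\<bar> / (real n)^2)
     \<le> (\<Sum>k. real_of_int \<bar>mertens (real k)\<bar> / (real k)^2) * real (ndiv l)"
proof -
  let ?D = "{k::nat. 0 < k \<and> int k dvd l}"
  let ?K = "\<Sum>k. real_of_int \<bar>mertens (real k)\<bar> / (real k)^2"
  have one_d: "(\<Sum>n<X. real d * real_of_int \<bar>mertens (real (n div d))\<bar> / (real n)^2) \<le> ?K" if d: "d > 0" for d
  proof -
    let ?t = "\<lambda>n. real d * real_of_int \<bar>mertens (real (n div d))\<bar> / (real n)^2"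
    have "sum ?t {..<X} \<le> sum ?t {..<X * d}"
      using d by (intro sum_mono2) auto
    also have "\<dots> = (\<Sum>k<X. sum ?t {k * d..<k * d + d})" by (rule sum.nat_group[symmetric])
    also have "\<dots> \<le> (\<Sum>k<X. real_of_int \<bar>mertens (real k)\<bar> / (real k)^2)"
    proof (rule sum_mono)
      fix k
      show "sum ?t {k * d..<k * d + d} \<le> real_of_int \<bar>mertens (real k)\<bar> / (real k)^2"
      \<comment> \<open>The block n < d, for which n^2 has no positive lower bound, vanishes because
        M(0) = 0.\<close>
      proof (cases "k = 0")
        case True
        then show ?thesis by (simp add: mertens_0)
      next
        case False
        have "sum ?t {k * d..<k * d + d} \<le> (\<Sum>n\<in>{k * d..<k * d + d}. real d * real_of_int \<bar>mertens (real k)\<bar> / (real (k * d))^2)"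
        proof (rule sum_mono)
          fix n assume n: "n \<in> {k * d..<k * d + d}"
          then have "n div d = k" by (intro div_nat_eqI) (auto simp: mult.commute)
          moreover have "(real (k * d))^2 \<le> (real n)^2" using n by (intro power_mono of_nat_mono) auto
          ultimately show "?t n \<le> real d * real_of_int \<bar>mertens (real k)\<bar> / (real (k * d))^2"
            using False d n by (intro frac_le) auto
        qed
        also have "\<dots> = real_of_int \<bar>mertens (real k)\<bar> / (real k)^2"
          using d False by (simp add: field_simps power2_eq_square)
        finally show ?thesis .
      qed
    qed
    also have "\<dots> \<le> ?K" by (rule sum_le_suminf[OF summable_mertens]) auto
    finally show ?thesis .
  qed
  have "(\<Sum>n<X. real_of_int \<bar>farey_weight n l\<bar> / (real n)^2)
      \<le> (\<Sum>n<X. \<Sum>d\<in>?D. real d * real_of_int \<bar>mertens (real (n div d))\<bar> / (real n)^2)"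
    unfolding sum_divide_distrib[symmetric]
    by (intro sum_mono divide_right_mono abs_farey_weight_le assms) auto
  also have "\<dots> = (\<Sum>d\<in>?D. \<Sum>n<X. real d * real_of_int \<bar>mertens (real (n div d))\<bar> / (real n)^2)"
    by (rule sum.swap)
  also have "\<dots> \<le> (\<Sum>d\<in>?D. ?K)" by (intro sum_mono one_d) auto
  also have "\<dots> = ?K * real (ndiv l)" by (simp add: ndiv_def)
  finally show ?thesis .
qed

lemma ndiv_ge_1: "l \<noteq> 0 \<Longrightarrow> ndiv l \<ge> 1"
  unfolding ndiv_def using card_mono[OF finite_int_divisors, of l "{1}"] by simp

theorem theorem2p5:
  fixes f :: "real \<Rightarrow> real"
  assumes fC: "classC f"
    and fint: "f absolutely_integrable_on {0..1}"
  shows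
    "(convergent (symsum (fcoeff f)) \<longrightarrow>
       (\<forall>n::nat. n \<ge> 1 \<longrightarrow>
          symsum_nz (\<lambda>l. fcoeff f l *
              of_int (\<Sum>d\<in>{d\<in>{1..n}. int d dvd l}. int d * mertens (real n / real d)))
          \<longlonglongrightarrow> complex_of_real (Ferr n f) - (complex_of_real (f 1) - lim (symsum (fcoeff f)))))
     \<and>
     (convergent (symsum_nz (\<lambda>l. norm (fcoeff f l) * real (ndiv l))) \<longrightarrow>
        (\<lambda>n. Ferr n f) \<in> o(\<lambda>n. real n) \<and>
        (symsum (fcoeff f) \<longlonglongrightarrow> complex_of_real (f 1) \<longrightarrow>
           summable (\<lambda>n. \<bar>Ferr n f\<bar> / real n ^ 2)))"
proof (intro conjI impI allI)
  fix n :: nat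
  assume "convergent (symsum (fcoeff f))" "n \<ge> 1"
  then show "symsum_nz (\<lambda>l. fcoeff f l * of_int (\<Sum>d\<in>{d\<in>{1..n}. int d dvd l}. int d * mertens (real n / real d)))
          \<longlonglongrightarrow> complex_of_real (Ferr n f) - (complex_of_real (f 1) - lim (symsum (fcoeff f)))"
    using Ferr_Fourier_series[OF fC fint _ , of "lim (symsum (fcoeff f))" n]
    unfolding farey_weight_def by (simp add: convergent_LIMSEQ_iff)
next
  let ?c = "fcoeff f"
  let ?b = "\<lambda>l. norm (?c l) * real (ndiv l)"
  let ?e = "\<lambda>n. (\<lambda>l. ?c l * of_int (farey_weight n l))"
  assume conv: "convergent (symsum_nz ?b)"
  define T where "T = lim (symsum_nz ?b)"
  have T: "symsum_nz ?b \<longlonglongrightarrow> T" unfolding T_def using conv by (simp add: convergent_LIMSEQ_iff)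
  have T_mono: "symsum_nz ?b N \<le> T" for N
  proof (rule incseq_le[OF _ T])
    show "incseq (symsum_nz ?b)" by (rule incseq_SucI) (simp add: symsum_nz_Suc)
  qed
  \<comment> \<open>As the divisor count is at least 1 for l \<noteq> 0, the hypothesis dominates
    the coefficients themselves. Hence their symmetric sums converge, and the formula of part (i)
    becomes available.\<close>
  have pair_summable: "summable (\<lambda>k. norm (?c (int (Suc k)) + ?c (- int (Suc k))))"
  proof (rule summable_comparison_test'[where N = 0])
    show "summable (\<lambda>k. ?b (int (Suc k)) + ?b (- int (Suc k)))"
      using conv unfolding symsum_nz_eq_sum[abs_def] summable_iff_convergent .
    fix k :: nat
    have "norm (?c l) \<le> ?b l" if "l \<noteq> 0" for l
      using ndiv_ge_1[OF that] mult_left_mono[of 1 "real (ndiv l)" "norm (?c l)"] by simp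
    then show "norm (norm (?c (int (Suc k)) + ?c (- int (Suc k)))) \<le> ?b (int (Suc k)) + ?b (- int (Suc k))"
      by (subst real_norm_def, subst abs_norm_cancel, intro order.trans[OF norm_triangle_ineq] add_mono) auto
  qed
  have "convergent (symsum ?c)"
    unfolding symsum_eq_symsum_nz[abs_def] symsum_nz_eq_sum[abs_def]
    using summable_norm_cancel[OF pair_summable]
    by (auto simp: summable_iff_convergent convergent_add_const_iff)
  then obtain S where S: "symsum ?c \<longlonglongrightarrow> S" by (auto simp: convergent_def)
  have ser: "symsum_nz (?e n) \<longlonglongrightarrow> complex_of_real (Ferr n f) - (complex_of_real (f 1) - S)" if "n \<ge> 1" for n
    by (rule Ferr_Fourier_series[OF fC fint S that])
  show "(\<lambda>n. Ferr n f) \<in> o(\<lambda>n. real n)"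
  proof (rule smalloI_tendsto)
    show "((\<lambda>n. Ferr n f / real n) \<longlongrightarrow> 0) sequentially"
    proof (rule LIMSEQ_I)
      fix e :: real assume e: "e > 0"
      \<comment> \<open>Frequencies beyond \<open>N0\<close> cost at most n e/4 by the bound n d(l).
        The finitely many others form \<open>h n\<close>, which is o(n) frequency by frequency, and
        the constant f(1) - S is divided by n; the three parts stay below 3e/4.\<close>
      from LIMSEQ_D[OF T, of "e/4"] e obtain N0 where "norm (symsum_nz ?b N0 - T) < e/4" by auto
      then have N0: "T - symsum_nz ?b N0 < e/4" unfolding real_norm_def by linarith
      define h where "h n = symsum_nz (\<lambda>l. norm (?c l) * real_of_int \<bar>farey_weight n l\<bar>) N0" for n
      have bound: "norm (complex_of_real (Ferr n f) - (complex_of_real (f 1) - S)) \<le> h n + real n * (e/4)"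
        if n: "n \<ge> 1" for n
      proof (rule Lim_bounded[OF tendsto_norm[OF ser[OF n]]])
        show "\<forall>N\<ge>N0. norm (symsum_nz (?e n) N) \<le> h n + real n * (e/4)"
        proof (intro allI impI)
          fix N assume N: "N \<ge> N0"
          let ?v = "\<lambda>l. norm (?c l) * real_of_int \<bar>farey_weight n l\<bar>"
          have "norm (symsum_nz (?e n) N) \<le> symsum_nz ?v N"
            unfolding symsum_nz_def by (rule order.trans[OF norm_sum]) (simp add: norm_mult)
          \<comment> \<open>Induction on N from \<open>N0\<close> on: each new pair of frequencies
            adds no more on the left than n times its terms in the hypothesis.\<close>
          also have "\<dots> \<le> h n + real n * (symsum_nz ?b N - symsum_nz ?b N0)"
            using N
          proof (induction N rule: dec_induct)
            case base
            show ?case by (simp add: h_def)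
          next
            case (step N)
            have v: "?v l \<le> real n * ?b l" if "l \<noteq> 0" for l
              using mult_left_mono[OF abs_farey_weight_le_ndiv[OF that, of n], of "norm (?c l)"] by (simp add: mult_ac)
            have "?v (int (Suc N)) + ?v (- int (Suc N)) \<le> real n * ?b (int (Suc N)) + real n * ?b (- int (Suc N))"
              by (intro add_mono v) auto
            then show ?case using step.IH unfolding symsum_nz_Suc by (simp add: algebra_simps)
          qed
          also have "\<dots> \<le> h n + real n * (e/4)"
            using N0 T_mono[of N] by (intro add_left_mono mult_left_mono) auto
          finally show "norm (symsum_nz (?e n) N) \<le> h n + real n * (e/4)" .
        qed
      qed
      have "(\<lambda>n. \<Sum>l\<in>{- int N0..int N0} - {0}. norm (?c l) * (real_of_int \<bar>farey_weight n l\<bar> / real n)) \<longlonglongrightarrow>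
          (\<Sum>l\<in>{- int N0..int N0} - {0}. norm (?c l) * 0)"
        by (intro tendsto_intros farey_weight_tendsto) auto
      then have hlim: "(\<lambda>n. h n / real n) \<longlonglongrightarrow> 0"
        unfolding h_def symsum_nz_def sum_divide_distrib by simp
      have klim: "(\<lambda>n. norm (complex_of_real (f 1) - S) / real n) \<longlonglongrightarrow> 0"
        by (rule lim_const_over_n)
      from LIMSEQ_D[OF hlim, of "e/4"] e obtain n1 where n1': "\<And>n. n \<ge> n1 \<Longrightarrow> norm (h n / real n - 0) < e/4" by auto
      have n1: "h n / real n < e/4" if "n \<ge> n1" for n
        using n1'[OF that] abs_ge_self[of "h n / real n"] unfolding real_norm_def diff_0_right by linarith
      from LIMSEQ_D[OF klim, of "e/4"] e obtain n2 where n2: "\<And>n. n \<ge> n2 \<Longrightarrow> norm (complex_of_real (f 1) - S) / real n < e/4" by auto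
      show "\<exists>no. \<forall>n\<ge>no. norm (Ferr n f / real n - 0) < e"
      proof (intro exI allI impI)
        fix n assume "n \<ge> max 1 (max n1 n2)"
        then have n: "n \<ge> 1" "n \<ge> n1" "n \<ge> n2" by auto
        have "\<bar>Ferr n f\<bar> = norm (complex_of_real (Ferr n f))" by simp
        also have "\<dots> \<le> norm (complex_of_real (Ferr n f) - (complex_of_real (f 1) - S)) + norm (complex_of_real (f 1) - S)"
          by (metis diff_add_cancel norm_triangle_ineq)
        also have "\<dots> \<le> h n + real n * (e/4) + norm (complex_of_real (f 1) - S)" using bound[OF n(1)] by simp
        finally have "\<bar>Ferr n f\<bar> / real n \<le> (h n + real n * (e/4) + norm (complex_of_real (f 1) - S)) / real n"
          by (intro divide_right_mono) auto
        also have "\<dots> = h n / real n + e/4 + norm (complex_of_real (f 1) - S) / real n"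
          using n by (simp add: add_divide_distrib)
        also have "\<dots> < e" using n1[OF n(2)] n2[OF n(3)] e by linarith
        finally show "norm (Ferr n f / real n - 0) < e" by simp
      qed
    qed
    show "\<forall>\<^sub>F n in sequentially. real n \<noteq> 0" by (rule eventually_sequentiallyI[of 1]) auto
  qed
  assume "symsum (fcoeff f) \<longlonglongrightarrow> complex_of_real (f 1)"
  then have S1: "S = complex_of_real (f 1)" using S LIMSEQ_unique by blast
  let ?K = "\<Sum>k. real_of_int \<bar>mertens (real k)\<bar> / (real k)^2"
  have K0: "?K \<ge> 0" by (intro suminf_nonneg summable_mertens) auto
  show "summable (\<lambda>n. \<bar>Ferr n f\<bar> / real n ^ 2)"
  proof (rule bounded_imp_summable)
    fix X
    \<comment> \<open>The sum over n is cut at X, so the limit in N may be taken inside; the bound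
      below is uniform in N and X. The term n = 0 is 0, because division by zero gives 0.\<close>
    have "(\<lambda>N. \<Sum>n\<le>X. norm (symsum_nz (?e n) N) / real n ^ 2) \<longlonglongrightarrow> (\<Sum>n\<le>X. \<bar>Ferr n f\<bar> / real n ^ 2)"
    proof (rule tendsto_sum)
      fix n
      show "(\<lambda>N. norm (symsum_nz (?e n) N) / real n ^ 2) \<longlonglongrightarrow> \<bar>Ferr n f\<bar> / real n ^ 2"
      proof (cases "n = 0")
        case False
        then have "symsum_nz (?e n) \<longlonglongrightarrow> complex_of_real (Ferr n f)" using ser[of n] S1 by simp
        from tendsto_norm[OF this] show ?thesis using False by (intro tendsto_divide) auto
      qed simp
    qed
    then show "(\<Sum>n\<le>X. \<bar>Ferr n f\<bar> / real n ^ 2) \<le> ?K * T"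
    proof (rule Lim_bounded[where M = 0], intro allI impI)
      fix N
      let ?L = "{- int N..int N} - {0}"
      have "(\<Sum>n\<le>X. norm (symsum_nz (?e n) N) / real n ^ 2)
         \<le> (\<Sum>n\<le>X. \<Sum>l\<in>?L. norm (?c l) * (real_of_int \<bar>farey_weight n l\<bar> / real n ^ 2))"
      proof (rule sum_mono)
        fix n
        have "norm (symsum_nz (?e n) N) \<le> (\<Sum>l\<in>?L. norm (?c l) * real_of_int \<bar>farey_weight n l\<bar>)"
          unfolding symsum_nz_def by (rule order.trans[OF norm_sum]) (simp add: norm_mult)
        then show "norm (symsum_nz (?e n) N) / real n ^ 2 \<le> (\<Sum>l\<in>?L. norm (?c l) * (real_of_int \<bar>farey_weight n l\<bar> / real n ^ 2))"
          by (simp add: sum_divide_distrib[symmetric] divide_right_mono)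
      qed
      \<comment> \<open>With the sum over n innermost, each frequency costs at most d(l) times
        \<Sum>|M(k)|/k^2, and the hypothesis sums this over l.\<close>
      also have "\<dots> = (\<Sum>l\<in>?L. norm (?c l) * (\<Sum>n<Suc X. real_of_int \<bar>farey_weight n l\<bar> / real n ^ 2))"
        unfolding lessThan_Suc_atMost sum_distrib_left by (rule sum.swap)
      also have "\<dots> \<le> (\<Sum>l\<in>?L. norm (?c l) * (?K * real (ndiv l)))"
        by (intro sum_mono mult_left_mono sum_abs_farey_weight_le) auto
      also have "\<dots> = ?K * symsum_nz ?b N"
        unfolding symsum_nz_def sum_distrib_left by (simp add: mult_ac)
      also have "\<dots> \<le> ?K * T" using K0 T_mono by (intro mult_left_mono)
      finally show "(\<Sum>n\<le>X. norm (symsum_nz (?e n) N) / real n ^ 2) \<le> ?K * T" .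
    qed
  qed auto
qed

end
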